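(* Let $(u_h,q_h)$ be computed by the LDG scheme defined in the context, with general numerical fluxes $\mathcal{F}_u,\widetilde{\mathcal{F}}_u,\widetilde{\mathcal{F}}_q$. Then for every cell $I_j$ and $t\in[0,T]$, $$2\int_0^tb_j(q_h(s),u_h(s))\,ds+\int_{I_j}\langle u_h(\cdot),u_h(\cdot)\rangle_t\,dx=\int_0^t\Bigl(\Lambda_{j+\frac12}(s)-\Lambda_{j-\frac12}(s)+\Theta_{j-\frac12}(s)\Bigr)ds,$$ where $$\Lambda_{j+\frac12}:=\bigl(\sigma(u_h^-\widetilde{\mathcal{F}}_q+\widetilde{\mathcal{F}}_uq_h^--u_h^-q_h^-)\bigr)_{j+\frac12},\qquad\Theta_{j-\frac12}:=\bigl(\sigma(\llbracket u_hq_h\rrbracket-\widetilde{\mathcal{F}}_u\llbracket q_h\rrbracket-\llbracket u_h\rrbracket\widetilde{\mathcal{F}}_q)\bigr)_{j-\frac12},$$ and $\langle\cdot,\cdot\rangle_t$ is the quadratic covariation (pointwise in $x$).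
   Context: Setting. $T>0$; $W$ is a one-dimensional Brownian motion on a filtered probability space satisfying the usual conditions; $\sigma\in C^2(\mathbb{R})$ with $\sigma',\sigma'',(\sigma^2)''\in L^\infty(\mathbb{R})$; $\bar u\in L^2(\mathbb{R})$ is deterministic. Mesh. A bounded computational interval is partitioned into finitely many cells $I_j=[x_{j-\frac12},x_{j+\frac12}]$; $\mathcal{V}^k$ is the space of functions whose restriction to each $I_j$ is a polynomial of degree $\le k$ ($k\ge0$). $v^\pm_{j+\frac12}$ are right/left traces at $x_{j+\frac12}$, $\llbracket v\rrbracket=v^+-v^-$; $(\cdot)_{j\pm\frac12}$ denotes evaluation at $x_{j\pm\frac12}$. At the two end points of the domain the exterior trace is taken equal to the interior trace. LDG scheme. $(u_h,q_h)$ are adapted continuous $\mathcal{V}^k$-valued processes such that for all $j$ and $\varphi,\psi\in\mathcal{V}^k$ $$d\int_{I_j}\varphi u_h\,dx=\bigl(a_j(u_h,\varphi)+b_j(q_h,\varphi)\bigr)dt-\int_{I_j}\varphi q_h\,dx\,dW_t,$$ $$\int_{I_j}\psi q_h\,dx=-\int_{I_j}(\partial_x\psi)\sigma u_h\,dx+(\sigma\widetilde{\mathcal{F}}_u\psi^-)_{j+\frac12}-(\sigma\widetilde{\mathcal{F}}_u\psi^+)_{j-\frac12},$$ $$a_j(u_h,\varphi)=-\tfrac12\int_{I_j}\partial_x(\sigma'\varphi)\sigma u_h\,dx+\tfrac14\Bigl(((\sigma^2)'\mathcal{F}_u\varphi^-)_{j+\frac12}-((\sigma^2)'\mathcal{F}_u\varphi^+)_{j-\frac12}\Bigr),$$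 $$b_j(q_h,\varphi)=-\tfrac12\int_{I_j}\partial_x(\sigma\varphi)q_h\,dx+\tfrac12\Bigl((\sigma\widetilde{\mathcal{F}}_q\varphi^-)_{j+\frac12}-(\sigma\widetilde{\mathcal{F}}_q\varphi^+)_{j-\frac12}\Bigr),$$ and $u_h(0)$ is the $L^2$-projection of $\bar u$ onto $\mathcal{V}^k$. The numerical fluxes $\mathcal{F}_u,\widetilde{\mathcal{F}}_u,\widetilde{\mathcal{F}}_q$ are arbitrary single-valued interface quantities, continuous functions of the two-sided traces of $u_h,q_h$ at the interface. *)

theory Defs
  imports "HOL-Probability.Probability"
begin

section \<open>Brownian motion on a filtered probability space\<close>

text \<open>Filtrations and the driving noise are indexed by all times \<open>t \<ge> 0\<close>; the values
  of \<open>F\<close> and \<open>W\<close> at negative arguments are irrelevant.\<close>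

locale usual_filtered_prob_space = prob_space M + complete_measure M
  for M :: "'w measure" +
  fixes F :: "real \<Rightarrow> 'w measure"
  assumes subalg: "0 \<le> t \<Longrightarrow> subalgebra M (F t)"
    and filtration_mono: "0 \<le> s \<Longrightarrow> s \<le> t \<Longrightarrow> sets (F s) \<subseteq> sets (F t)"
    and right_continuous: "0 \<le> t \<Longrightarrow> sets (F t) = (\<Inter>s\<in>{t<..}. sets (F s))"
    and null_sets_F0: "null_sets M \<subseteq> sets (F 0)"

locale brownian_motion = usual_filtered_prob_space M F
  for M :: "'w measure" and F +
  fixes W :: "real \<Rightarrow> 'w \<Rightarrow> real"
  assumes BM_start: "AE \<omega> in M. W 0 \<omega> = 0"
    and BM_adapted: "0 \<le> t \<Longrightarrow> W t \<in> borel_measurable (F t)"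
    and BM_continuous: "\<omega> \<in> space M \<Longrightarrow> continuous_on {0..} (\<lambda>t. W t \<omega>)"
    and BM_normal: "0 \<le> s \<Longrightarrow> s < t \<Longrightarrow>
      distributed M lborel (\<lambda>\<omega>. W t \<omega> - W s \<omega>) (\<lambda>x. ennreal (normal_density 0 (sqrt (t - s)) x))"
    and BM_indep: "0 \<le> s \<Longrightarrow> s < t \<Longrightarrow>
      indep_set (sets (F s)) {(\<lambda>\<omega>. W t \<omega> - W s \<omega>) -` B \<inter> space M | B. B \<in> sets borel}"


section \<open>Stochastic integral and quadratic covariation\<close>

definition continuous_adapted ::
  "'w measure \<Rightarrow> (real \<Rightarrow> 'w measure) \<Rightarrow> real \<Rightarrow> (real \<Rightarrow> 'w \<Rightarrow> real) \<Rightarrow> bool" where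
  "continuous_adapted M F T X \<longleftrightarrow>
     (\<forall>t\<in>{0..T}. X t \<in> borel_measurable (F t)) \<and>
     (\<forall>\<omega>\<in>space M. continuous_on {0..T} (\<lambda>t. X t \<omega>))"

text \<open>Measurability is part of the definition, because \<^const>\<open>measure\<close> is \<open>0\<close> on
  non-measurable sets.\<close>

definition conv_in_prob :: "'w measure \<Rightarrow> (nat \<Rightarrow> 'w \<Rightarrow> real) \<Rightarrow> ('w \<Rightarrow> real) \<Rightarrow> bool" where
  "conv_in_prob M X Y \<longleftrightarrow>
     (\<forall>n. X n \<in> borel_measurable M) \<and> Y \<in> borel_measurable M \<and>
     (\<forall>\<epsilon>>0. (\<lambda>n. measure M {\<omega>\<in>space M. \<bar>X n \<omega> - Y \<omega>\<bar> > \<epsilon>}) \<longlonglongrightarrow> 0)"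

text \<open>A triple \<open>(m, \<tau>, \<xi>)\<close> encodes the simple process
  \<open>\<Sum>i<m. \<xi>\<^sub>i 1\<^bsub>(\<tau>\<^sub>i, \<tau>\<^sub>i\<^sub>+\<^sub>1]\<^esub>\<close>.\<close>

type_synonym 'w simple_proc = "nat \<times> (nat \<Rightarrow> real) \<times> (nat \<Rightarrow> 'w \<Rightarrow> real)"

definition simple_process ::
  "'w measure \<Rightarrow> (real \<Rightarrow> 'w measure) \<Rightarrow> 'w simple_proc \<Rightarrow> bool" where
  "simple_process M F = (\<lambda>(m, \<tau>, \<xi>).
     0 \<le> \<tau> 0 \<and> (\<forall>i<m. \<tau> i \<le> \<tau> (Suc i)) \<and>
     (\<forall>i<m. \<xi> i \<in> borel_measurable (F (\<tau> i))) \<and>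
     (\<forall>i<m. \<exists>C. \<forall>\<omega>\<in>space M. \<bar>\<xi> i \<omega>\<bar> \<le> C))"

definition simple_value :: "'w simple_proc \<Rightarrow> real \<Rightarrow> 'w \<Rightarrow> real" where
  "simple_value = (\<lambda>(m, \<tau>, \<xi>) s \<omega>. \<Sum>i<m. \<xi> i \<omega> * indicator {\<tau> i<..\<tau> (Suc i)} s)"

definition simple_integral ::
  "(real \<Rightarrow> 'w \<Rightarrow> real) \<Rightarrow> 'w simple_proc \<Rightarrow> real \<Rightarrow> 'w \<Rightarrow> real" where
  "simple_integral W = (\<lambda>(m, \<tau>, \<xi>) t \<omega>.
     \<Sum>i<m. \<xi> i \<omega> * (W (min (\<tau> (Suc i)) t) \<omega> - W (min (\<tau> i) t) \<omega>))"

text \<open>\<open>is_ito_integral M F W T H X\<close> says that \<open>X t\<close> is (the continuous version of)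
  \<open>\<integral>\<^sub>0\<^sup>t H dW\<close> for \<open>t \<in> [0, T]\<close>, with a continuous adapted integrand \<open>H\<close>:
  \<open>H\<close> is approximated by simple processes in \<open>L\<^sup>2(0, T)\<close>, in probability, and \<open>X t\<close> is the limit in
  probability of their elementary integrals.  The limit does not depend on the approximating
  sequence, so that \<open>X\<close> is determined up to indistinguishability.\<close>

definition is_ito_integral ::
  "'w measure \<Rightarrow> (real \<Rightarrow> 'w measure) \<Rightarrow> (real \<Rightarrow> 'w \<Rightarrow> real) \<Rightarrow> real \<Rightarrow>
   (real \<Rightarrow> 'w \<Rightarrow> real) \<Rightarrow> (real \<Rightarrow> 'w \<Rightarrow> real) \<Rightarrow> bool" where
  "is_ito_integral M F W T H X \<longleftrightarrow>
     continuous_adapted M F T H \<and> continuous_adapted M F T X \<and>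
     (\<exists>G. (\<forall>n. simple_process M F (G n)) \<and>
        conv_in_prob M (\<lambda>n \<omega>. LINT s:{0..T}|lborel. (simple_value (G n) s \<omega> - H s \<omega>)\<^sup>2) (\<lambda>\<omega>. 0) \<and>
        (\<forall>t\<in>{0..T}. conv_in_prob M (\<lambda>n. simple_integral W (G n) t) (X t)))"

definition is_partition :: "real \<Rightarrow> nat \<Rightarrow> (nat \<Rightarrow> real) \<Rightarrow> bool" where
  "is_partition t m \<tau> \<longleftrightarrow> \<tau> 0 = 0 \<and> \<tau> m = t \<and> (\<forall>i<m. \<tau> i \<le> \<tau> (Suc i))"

definition is_quad_covariation ::
  "'w measure \<Rightarrow> (real \<Rightarrow> 'w measure) \<Rightarrow> real \<Rightarrow>
   (real \<Rightarrow> 'w \<Rightarrow> real) \<Rightarrow> (real \<Rightarrow> 'w \<Rightarrow> real) \<Rightarrow> (real \<Rightarrow> 'w \<Rightarrow> real) \<Rightarrow> bool" where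
  "is_quad_covariation M F T X Y A \<longleftrightarrow>
     continuous_adapted M F T A \<and>
     (\<forall>t\<in>{0..T}. \<forall>m \<tau>.
        (\<forall>n. is_partition t (m n) (\<tau> n)) \<and>
        (\<forall>\<delta>>0. \<forall>\<^sub>F n in sequentially. \<forall>i<m n. \<tau> n (Suc i) - \<tau> n i < \<delta>) \<longrightarrow>
        conv_in_prob M
          (\<lambda>n \<omega>. \<Sum>i<m n. (X (\<tau> n (Suc i)) \<omega> - X (\<tau> n i) \<omega>) * (Y (\<tau> n (Suc i)) \<omega> - Y (\<tau> n i) \<omega>))
          (A t))"


section \<open>Data\<close>

definition C2 :: "(real \<Rightarrow> real) \<Rightarrow> bool" where
  "C2 f \<longleftrightarrow> (\<forall>x. f field_differentiable at x) \<and> (\<forall>x. deriv f field_differentiable at x) \<and>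
     continuous_on UNIV (deriv (deriv f))"

definition in_Linf :: "(real \<Rightarrow> real) \<Rightarrow> bool" where
  "in_Linf f \<longleftrightarrow> f \<in> borel_measurable lebesgue \<and> (\<exists>C. AE x in lebesgue. \<bar>f x\<bar> \<le> C)"

definition in_L2 :: "(real \<Rightarrow> real) \<Rightarrow> bool" where
  "in_L2 f \<longleftrightarrow> f \<in> borel_measurable lebesgue \<and> integrable lebesgue (\<lambda>x. (f x)\<^sup>2)"


section \<open>Mesh and broken polynomial space\<close>

text \<open>The \<open>N\<close> cells are numbered \<open>0, \<dots>, N - 1\<close>, and \<open>xs 0 < \<dots> < xs N\<close> are the interfaces:
  \<open>xs j\<close> is \<open>x\<^bsub>j-1/2\<^esub>\<close> and \<open>xs (Suc j)\<close> is \<open>x\<^bsub>j+1/2\<^esub>\<close>.\<close>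

definition is_mesh :: "nat \<Rightarrow> (nat \<Rightarrow> real) \<Rightarrow> bool" where
  "is_mesh N xs \<longleftrightarrow> 1 \<le> N \<and> (\<forall>j<N. xs j < xs (Suc j))"

abbreviation cell :: "(nat \<Rightarrow> real) \<Rightarrow> nat \<Rightarrow> real set" where
  "cell xs j \<equiv> {xs j..xs (Suc j)}"

text \<open>A piecewise polynomial \<open>v\<close> is the family of its restrictions to the cells, \<open>v j\<close> being the
  polynomial on \<open>cell xs j\<close>.  It is two-valued at the interfaces, where its traces are the values of
  the two adjacent polynomials.  Indices \<open>j \<ge> N\<close> carry no meaning.\<close>

type_synonym dg = "nat \<Rightarrow> real poly"

definition DG :: "nat \<Rightarrow> nat \<Rightarrow> dg set" where
  "DG N k = {v. \<forall>j<N. degree (v j) \<le> k}"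

text \<open>At \<open>xs 0\<close> and \<open>xs N\<close> the exterior trace is the interior one.\<close>

definition trace_minus :: "nat \<Rightarrow> (nat \<Rightarrow> real) \<Rightarrow> dg \<Rightarrow> nat \<Rightarrow> real" where
  "trace_minus N xs v i = poly (v (if i = 0 then 0 else i - 1)) (xs i)"

definition trace_plus :: "nat \<Rightarrow> (nat \<Rightarrow> real) \<Rightarrow> dg \<Rightarrow> nat \<Rightarrow> real" where
  "trace_plus N xs v i = poly (v (if i = N then N - 1 else i)) (xs i)"

definition jump :: "nat \<Rightarrow> (nat \<Rightarrow> real) \<Rightarrow> dg \<Rightarrow> nat \<Rightarrow> real" where
  "jump N xs v i = trace_plus N xs v i - trace_minus N xs v i"

definition is_L2_projection ::
  "nat \<Rightarrow> (nat \<Rightarrow> real) \<Rightarrow> nat \<Rightarrow> (real \<Rightarrow> real) \<Rightarrow> dg \<Rightarrow> bool" where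
  "is_L2_projection N xs k f v \<longleftrightarrow> v \<in> DG N k \<and>
     (\<forall>\<phi>\<in>DG N k. (\<Sum>j<N. LINT x:cell xs j|lebesgue. (f x - poly (v j) x) * poly (\<phi> j) x) = 0)"


section \<open>The LDG scheme\<close>

text \<open>A numerical flux maps, at each interface \<open>i\<close>, the traces \<open>(u\<^sup>-, u\<^sup>+, q\<^sup>-, q\<^sup>+)\<close> to a single value.\<close>

type_synonym flux = "nat \<Rightarrow> real \<times> real \<times> real \<times> real \<Rightarrow> real"

definition is_numerical_flux :: "nat \<Rightarrow> flux \<Rightarrow> bool" where
  "is_numerical_flux N f \<longleftrightarrow> (\<forall>i\<le>N. continuous_on UNIV (f i))"

definition flux_at :: "nat \<Rightarrow> (nat \<Rightarrow> real) \<Rightarrow> flux \<Rightarrow> dg \<Rightarrow> dg \<Rightarrow> nat \<Rightarrow> real" where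
  "flux_at N xs f u q i =
     f i (trace_minus N xs u i, trace_plus N xs u i, trace_minus N xs q i, trace_plus N xs q i)"

text \<open>Both \<open>ldg_a\<close> and \<open>ldg_b\<close> take \<open>u\<close> and \<open>q\<close>, since a flux may depend on the traces of both.\<close>

definition ldg_a ::
  "nat \<Rightarrow> (nat \<Rightarrow> real) \<Rightarrow> (real \<Rightarrow> real) \<Rightarrow> flux \<Rightarrow> nat \<Rightarrow> dg \<Rightarrow> dg \<Rightarrow> dg \<Rightarrow> real" where
  "ldg_a N xs \<sigma> Fu j u q \<phi> =
     - 1/2 * (LINT x:cell xs j|lborel. deriv (\<lambda>y. deriv \<sigma> y * poly (\<phi> j) y) x * \<sigma> x * poly (u j) x)
     + 1/4 * (deriv (\<lambda>y. (\<sigma> y)\<^sup>2) (xs (Suc j)) * flux_at N xs Fu u q (Suc j) * trace_minus N xs \<phi> (Suc j)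
            - deriv (\<lambda>y. (\<sigma> y)\<^sup>2) (xs j) * flux_at N xs Fu u q j * trace_plus N xs \<phi> j)"

definition ldg_b ::
  "nat \<Rightarrow> (nat \<Rightarrow> real) \<Rightarrow> (real \<Rightarrow> real) \<Rightarrow> flux \<Rightarrow> nat \<Rightarrow> dg \<Rightarrow> dg \<Rightarrow> dg \<Rightarrow> real" where
  "ldg_b N xs \<sigma> Ftq j u q \<phi> =
     - 1/2 * (LINT x:cell xs j|lborel. deriv (\<lambda>y. \<sigma> y * poly (\<phi> j) y) x * poly (q j) x)
     + 1/2 * (\<sigma> (xs (Suc j)) * flux_at N xs Ftq u q (Suc j) * trace_minus N xs \<phi> (Suc j)
            - \<sigma> (xs j) * flux_at N xs Ftq u q j * trace_plus N xs \<phi> j)"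

definition ldg_q_equation ::
  "nat \<Rightarrow> (nat \<Rightarrow> real) \<Rightarrow> (real \<Rightarrow> real) \<Rightarrow> flux \<Rightarrow> nat \<Rightarrow> dg \<Rightarrow> dg \<Rightarrow> dg \<Rightarrow> bool" where
  "ldg_q_equation N xs \<sigma> Ftu j u q \<psi> \<longleftrightarrow>
     (LINT x:cell xs j|lborel. poly (\<psi> j) x * poly (q j) x) =
     - (LINT x:cell xs j|lborel. poly (pderiv (\<psi> j)) x * \<sigma> x * poly (u j) x)
     + \<sigma> (xs (Suc j)) * flux_at N xs Ftu u q (Suc j) * trace_minus N xs \<psi> (Suc j)
     - \<sigma> (xs j) * flux_at N xs Ftu u q j * trace_plus N xs \<psi> j"

definition continuous_adapted_DG ::
  "'w measure \<Rightarrow> (real \<Rightarrow> 'w measure) \<Rightarrow> real \<Rightarrow> nat \<Rightarrow> nat \<Rightarrow> (real \<Rightarrow> 'w \<Rightarrow> dg) \<Rightarrow> bool" where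
  "continuous_adapted_DG M F T N k v \<longleftrightarrow>
     (\<forall>t\<in>{0..T}. \<forall>\<omega>\<in>space M. v t \<omega> \<in> DG N k) \<and>
     (\<forall>j<N. \<forall>l\<le>k. continuous_adapted M F T (\<lambda>t \<omega>. coeff (v t \<omega> j) l))"

definition is_ldg_solution ::
  "'w measure \<Rightarrow> (real \<Rightarrow> 'w measure) \<Rightarrow> (real \<Rightarrow> 'w \<Rightarrow> real) \<Rightarrow> real \<Rightarrow>
   (real \<Rightarrow> real) \<Rightarrow> (real \<Rightarrow> real) \<Rightarrow> nat \<Rightarrow> (nat \<Rightarrow> real) \<Rightarrow> nat \<Rightarrow>
   flux \<Rightarrow> flux \<Rightarrow> flux \<Rightarrow> (real \<Rightarrow> 'w \<Rightarrow> dg) \<Rightarrow> (real \<Rightarrow> 'w \<Rightarrow> dg) \<Rightarrow> bool" where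
  "is_ldg_solution M F W T \<sigma> ubar N xs k Fu Ftu Ftq u q \<longleftrightarrow>
     continuous_adapted_DG M F T N k u \<and> continuous_adapted_DG M F T N k q \<and>
     (AE \<omega> in M. is_L2_projection N xs k ubar (u 0 \<omega>)) \<and>
     (\<forall>j<N. \<forall>\<phi>\<in>DG N k. \<exists>X.
        is_ito_integral M F W T (\<lambda>s \<omega>. LINT x:cell xs j|lborel. poly (\<phi> j) x * poly (q s \<omega> j) x) X \<and>
        (AE \<omega> in M. \<forall>t\<in>{0..T}.
           (LINT x:cell xs j|lborel. poly (\<phi> j) x * poly (u t \<omega> j) x) =
           (LINT x:cell xs j|lborel. poly (\<phi> j) x * poly (u 0 \<omega> j) x)
           + (LINT s:{0..t}|lborel. ldg_a N xs \<sigma> Fu j (u s \<omega>) (q s \<omega>) \<phi>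
                                  + ldg_b N xs \<sigma> Ftq j (u s \<omega>) (q s \<omega>) \<phi>)
           - X t \<omega>)) \<and>
     (AE \<omega> in M. \<forall>t\<in>{0..T}. \<forall>j<N. \<forall>\<psi>\<in>DG N k.
        ldg_q_equation N xs \<sigma> Ftu j (u t \<omega>) (q t \<omega>) \<psi>)"


section \<open>The terms of the identity\<close>

definition ldg_Lambda ::
  "nat \<Rightarrow> (nat \<Rightarrow> real) \<Rightarrow> (real \<Rightarrow> real) \<Rightarrow> flux \<Rightarrow> flux \<Rightarrow> dg \<Rightarrow> dg \<Rightarrow> nat \<Rightarrow> real" where
  "ldg_Lambda N xs \<sigma> Ftu Ftq u q i =
     \<sigma> (xs i) * (trace_minus N xs u i * flux_at N xs Ftq u q i
               + flux_at N xs Ftu u q i * trace_minus N xs q i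
               - trace_minus N xs u i * trace_minus N xs q i)"

definition ldg_Theta ::
  "nat \<Rightarrow> (nat \<Rightarrow> real) \<Rightarrow> (real \<Rightarrow> real) \<Rightarrow> flux \<Rightarrow> flux \<Rightarrow> dg \<Rightarrow> dg \<Rightarrow> nat \<Rightarrow> real" where
  "ldg_Theta N xs \<sigma> Ftu Ftq u q i =
     \<sigma> (xs i) * (jump N xs (\<lambda>j. u j * q j) i
               - flux_at N xs Ftu u q i * jump N xs q i
               - jump N xs u i * flux_at N xs Ftq u q i)"

text \<open>For each \<open>x\<close> the bracket \<open>\<langle>u(x), u(x)\<rangle>\<close> is unique only up to a null set depending on \<open>x\<close>.
  To integrate it over \<open>x\<close>, one needs a version \<open>A x t \<omega>\<close> that is jointly measurable in \<open>(x, \<omega>)\<close>.\<close>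

definition is_pointwise_bracket ::
  "'w measure \<Rightarrow> (real \<Rightarrow> 'w measure) \<Rightarrow> real \<Rightarrow> (nat \<Rightarrow> real) \<Rightarrow> nat \<Rightarrow>
   (real \<Rightarrow> 'w \<Rightarrow> dg) \<Rightarrow> (real \<Rightarrow> real \<Rightarrow> 'w \<Rightarrow> real) \<Rightarrow> bool" where
  "is_pointwise_bracket M F T xs j u A \<longleftrightarrow>
     (\<forall>x\<in>cell xs j. is_quad_covariation M F T
        (\<lambda>t \<omega>. poly (u t \<omega> j) x) (\<lambda>t \<omega>. poly (u t \<omega> j) x) (A x)) \<and>
     (\<forall>t\<in>{0..T}. (\<lambda>(x, \<omega>). A x t \<omega>) \<in>
        borel_measurable (restrict_space lborel (cell xs j) \<Otimes>\<^sub>M M))"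

end

theory Submission
  imports Defs
begin

text \<open>Testing the scheme on a cell with the polynomial that represents the evaluation at \<open>x\<close> in
  \<open>L\<^sup>2\<close> shows that \<open>u(x)\<close> is an Ito process with integrand \<open>- q(x)\<close> and an absolutely continuous drift.  Its
  bracket is therefore \<open>\<integral>\<^sub>0\<^sup>t q(s, x)\<^sup>2 ds\<close>, and the claim reduces, for each time and path, to
  \<open>2 b\<^sub>j(q, u) + \<integral> q\<^sup>2 dx = \<Lambda>\<^sub>+ - \<Lambda>\<^sub>- + \<Theta>\<^sub>-\<close>, which is the equation for \<open>q\<close> tested with \<open>q\<close>
  and an integration by parts.

  For the bracket of an Ito integral \<open>X\<close> of \<open>H\<close>, the increment of \<open>X\<close> over a partition interval is compared with
  \<open>H \<Delta>W\<close>, \<open>H\<close> frozen at the left end point.  The approximating simple integrands and the frozen one are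
  compared on a common grid, where a discrete Lenglart inequality bounds the sum of the squared errors in
  probability by the \<open>L\<^sup>2\<close>-distance of the integrands, without any moment assumption.  The same inequality
  gives \<open>\<Sum> H\<^sup>2 ((\<Delta>W)\<^sup>2 - \<Delta>t) \<rightarrow> 0\<close>.\<close>

section \<open>Convergence in probability\<close>

text \<open>Both clauses about \<open>X\<close> in \<open>is_ito_integral\<close> are statements in
  probability, the second one at fixed times, and nothing bounds a moment of \<open>q\<close>. This
  dictates the order of the limits. For a fixed partition the approximating sequence goes to
  infinity first, which only requires convergence at finitely many times; then the mesh goes to 0,
  where uniform continuity of each path of \<open>H\<close> takes over. The parameters of the
  Lenglart bound stay free until the end: \<open>\<delta> / \<epsilon>\<close> is made small first,
  the probability next to it afterwards.

  \<open>ldg_a\<close>, and \<open>Fu\<close> with it, enters only the drift of \<open>u(x)\<close>.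
  The drift is Lipschitz along each path, so its squared increments sum to at most a multiple of the
  mesh and leave no trace in the bracket.\<close>

context prob_space begin

lemma prob_gt_add:
  fixes X Y Z :: "'a \<Rightarrow> real"
  assumes [measurable]: "X \<in> borel_measurable M" "Y \<in> borel_measurable M"
    and le: "AE \<omega> in M. \<bar>Z \<omega>\<bar> \<le> \<bar>X \<omega>\<bar> + \<bar>Y \<omega>\<bar>"
  shows "prob {\<omega>\<in>space M. \<bar>Z \<omega>\<bar> > a + b}
    \<le> prob {\<omega>\<in>space M. \<bar>X \<omega>\<bar> > a} + prob {\<omega>\<in>space M. \<bar>Y \<omega>\<bar> > b}"
proof -
  have "prob {\<omega>\<in>space M. \<bar>Z \<omega>\<bar> > a + b}
    \<le> prob ({\<omega>\<in>space M. \<bar>X \<omega>\<bar> > a} \<union> {\<omega>\<in>space M. \<bar>Y \<omega>\<bar> > b})"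
    by (intro finite_measure_mono_AE) (use le in \<open>auto elim!: eventually_mono\<close>)
  also have "\<dots> \<le> prob {\<omega>\<in>space M. \<bar>X \<omega>\<bar> > a} + prob {\<omega>\<in>space M. \<bar>Y \<omega>\<bar> > b}"
    by (intro measure_Un_le) auto
  finally show ?thesis .
qed

lemma conv_in_prob_0I:
  fixes Z :: "nat \<Rightarrow> 'a \<Rightarrow> real"
  assumes "\<And>n. Z n \<in> borel_measurable M"
    and "\<And>\<epsilon> \<eta>. \<epsilon> > 0 \<Longrightarrow> \<eta> > 0 \<Longrightarrow>
      \<forall>\<^sub>F n in sequentially. prob {\<omega>\<in>space M. \<bar>Z n \<omega>\<bar> > \<epsilon>} < \<eta>"
  shows "conv_in_prob M Z (\<lambda>_. 0)"
  unfolding conv_in_prob_def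
  using assms by (auto simp: tendsto_iff dist_real_def)

lemma conv_in_prob_0D:
  fixes Z :: "nat \<Rightarrow> 'a \<Rightarrow> real"
  assumes "conv_in_prob M Z (\<lambda>_. 0)"
  shows "Z n \<in> borel_measurable M"
    and "\<epsilon> > 0 \<Longrightarrow> (\<lambda>n. prob {\<omega>\<in>space M. \<bar>Z n \<omega>\<bar> > \<epsilon>}) \<longlonglongrightarrow> 0"
    and "\<epsilon> > 0 \<Longrightarrow> \<eta> > 0 \<Longrightarrow> \<forall>\<^sub>F n in sequentially. prob {\<omega>\<in>space M. \<bar>Z n \<omega>\<bar> > \<epsilon>} < \<eta>"
  using assms by (auto simp: conv_in_prob_def tendsto_iff dist_real_def)

lemma conv_in_prob_diff_iff:
  fixes X :: "nat \<Rightarrow> 'a \<Rightarrow> real"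
  assumes [measurable]: "\<And>n. X n \<in> borel_measurable M" "Y \<in> borel_measurable M"
  shows "conv_in_prob M X Y \<longleftrightarrow> conv_in_prob M (\<lambda>n \<omega>. X n \<omega> - Y \<omega>) (\<lambda>_. 0)"
  by (auto simp: conv_in_prob_def)

lemma conv_in_prob_0_dominated:
  fixes Z :: "nat \<Rightarrow> 'a \<Rightarrow> real"
  assumes Z: "\<And>n. Z n \<in> borel_measurable M"
    and X: "conv_in_prob M X (\<lambda>_. 0)" and Y: "conv_in_prob M Y (\<lambda>_. 0)"
    and le: "\<And>n. AE \<omega> in M. \<bar>Z n \<omega>\<bar> \<le> \<bar>X n \<omega>\<bar> + \<bar>Y n \<omega>\<bar>"
  shows "conv_in_prob M Z (\<lambda>_. 0)"
proof (rule conv_in_prob_0I[OF Z])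
  fix \<epsilon> \<eta> :: real assume *: "\<epsilon> > 0" "\<eta> > 0"
  have "\<forall>\<^sub>F n in sequentially. prob {\<omega>\<in>space M. \<bar>X n \<omega>\<bar> > \<epsilon>/2} < \<eta>/2"
       "\<forall>\<^sub>F n in sequentially. prob {\<omega>\<in>space M. \<bar>Y n \<omega>\<bar> > \<epsilon>/2} < \<eta>/2"
    by (intro conv_in_prob_0D(3)[OF X] conv_in_prob_0D(3)[OF Y] half_gt_zero *)+
  then show "\<forall>\<^sub>F n in sequentially. prob {\<omega>\<in>space M. \<bar>Z n \<omega>\<bar> > \<epsilon>} < \<eta>"
  proof eventually_elim
    case (elim n)
    then show ?case
      using prob_gt_add[OF conv_in_prob_0D(1)[OF X, of n] conv_in_prob_0D(1)[OF Y, of n] le, of "\<epsilon>/2" "\<epsilon>/2"]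
      by auto
  qed
qed

lemma conv_in_prob_0_const: "conv_in_prob M (\<lambda>_ _. 0) (\<lambda>_. 0)"
  by (auto simp: conv_in_prob_def)

lemma conv_in_prob_0_add:
  fixes X Y :: "nat \<Rightarrow> 'a \<Rightarrow> real"
  assumes "conv_in_prob M X (\<lambda>_. 0)" "conv_in_prob M Y (\<lambda>_. 0)"
  shows "conv_in_prob M (\<lambda>n \<omega>. X n \<omega> + Y n \<omega>) (\<lambda>_. 0)"
  using conv_in_prob_0D(1)[OF assms(1)] conv_in_prob_0D(1)[OF assms(2)]
  by (intro conv_in_prob_0_dominated[OF _ assms]) auto

lemma conv_in_prob_0_sum:
  fixes X :: "'i \<Rightarrow> nat \<Rightarrow> 'a \<Rightarrow> real"
  assumes "\<And>i. i \<in> I \<Longrightarrow> conv_in_prob M (X i) (\<lambda>_. 0)"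
  shows "conv_in_prob M (\<lambda>n \<omega>. \<Sum>i\<in>I. X i n \<omega>) (\<lambda>_. 0)"
  using assms
  by (induction I rule: infinite_finite_induct)
     (auto intro!: conv_in_prob_0_const conv_in_prob_0_add)

lemma conv_in_prob_0_scale:
  fixes X :: "nat \<Rightarrow> 'a \<Rightarrow> real"
  assumes "conv_in_prob M X (\<lambda>_. 0)"
  shows "conv_in_prob M (\<lambda>n \<omega>. c * X n \<omega>) (\<lambda>_. 0)"
proof (cases "c = 0")
  case False
  have [measurable]: "X n \<in> borel_measurable M" for n by (rule conv_in_prob_0D(1)[OF assms])
  have "(\<lambda>n. prob {\<omega>\<in>space M. \<bar>c * X n \<omega>\<bar> > \<epsilon>}) \<longlonglongrightarrow> 0" if "\<epsilon> > 0" for \<epsilon>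
  proof -
    have "\<bar>c * X n \<omega>\<bar> > \<epsilon> \<longleftrightarrow> \<bar>X n \<omega>\<bar> > \<epsilon> / \<bar>c\<bar>" for n \<omega>
      using False by (simp add: abs_mult field_simps)
    then show ?thesis using conv_in_prob_0D(2)[OF assms, of "\<epsilon> / \<bar>c\<bar>"] that False by simp
  qed
  then show ?thesis by (auto simp: conv_in_prob_def)
qed (simp add: conv_in_prob_0_const)

lemma conv_in_prob_0_square:
  fixes X :: "nat \<Rightarrow> 'a \<Rightarrow> real"
  assumes "conv_in_prob M X (\<lambda>_. 0)"
  shows "conv_in_prob M (\<lambda>n \<omega>. (X n \<omega>)\<^sup>2) (\<lambda>_. 0)"
proof -
  have [measurable]: "X n \<in> borel_measurable M" for n by (rule conv_in_prob_0D(1)[OF assms])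
  have "(\<lambda>n. prob {\<omega>\<in>space M. \<bar>(X n \<omega>)\<^sup>2\<bar> > \<epsilon>}) \<longlonglongrightarrow> 0" if "\<epsilon> > 0" for \<epsilon>
  proof -
    have "\<bar>(X n \<omega>)\<^sup>2\<bar> > \<epsilon> \<longleftrightarrow> \<bar>X n \<omega>\<bar> > sqrt \<epsilon>" for n \<omega>
      using real_sqrt_less_iff[of \<epsilon> "(X n \<omega>)\<^sup>2"] by simp
    then show ?thesis using conv_in_prob_0D(2)[OF assms, of "sqrt \<epsilon>"] that by simp
  qed
  then show ?thesis by (auto simp: conv_in_prob_def)
qed

lemma AE_tendsto_imp_conv_in_prob_0:
  fixes X :: "nat \<Rightarrow> 'a \<Rightarrow> real"
  assumes [measurable]: "\<And>n. X n \<in> borel_measurable M"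
    and lim: "AE \<omega> in M. (\<lambda>n. X n \<omega>) \<longlonglongrightarrow> 0"
  shows "conv_in_prob M X (\<lambda>_. 0)"
proof -
  have "(\<lambda>n. prob {\<omega>\<in>space M. \<bar>X n \<omega>\<bar> > \<epsilon>}) \<longlonglongrightarrow> 0" if "\<epsilon> > 0" for \<epsilon>
  proof -
    let ?A = "\<lambda>n. {\<omega>\<in>space M. \<bar>X n \<omega>\<bar> > \<epsilon>}"
    have "(\<lambda>n. \<integral>\<omega>. indicat_real (?A n) \<omega> \<partial>M) \<longlonglongrightarrow> (\<integral>\<omega>. 0 \<partial>M)"
    proof (rule integral_dominated_convergence[where w="\<lambda>_. 1"])
      show "AE \<omega> in M. (\<lambda>n. indicat_real (?A n) \<omega>) \<longlonglongrightarrow> 0"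
        using lim
      proof eventually_elim
        case (elim \<omega>)
        then have "\<forall>\<^sub>F n in sequentially. \<bar>X n \<omega>\<bar> < \<epsilon>"
          using that by (auto simp: tendsto_iff dist_real_def)
        then have "\<forall>\<^sub>F n in sequentially. indicat_real (?A n) \<omega> = 0"
          by eventually_elim auto
        then show ?case by (rule tendsto_eventually)
      qed
    qed (auto simp: indicator_def)
    then show ?thesis by simp
  qed
  then show ?thesis by (auto simp: conv_in_prob_def)
qed

text \<open>Tightness of a single real random variable, read off from \<open>Q / Suc n\<close>
  tending to 0 at every point.\<close>

lemma prob_large_tendsto_0:
  fixes Q :: "'a \<Rightarrow> real"
  assumes [measurable]: "Q \<in> borel_measurable M"
  shows "(\<lambda>n. prob {\<omega>\<in>space M. \<bar>Q \<omega>\<bar> > real n}) \<longlonglongrightarrow> 0"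
proof -
  have "conv_in_prob M (\<lambda>n \<omega>. Q \<omega> / real (Suc n)) (\<lambda>_. 0)"
    by (rule AE_tendsto_imp_conv_in_prob_0)
      (auto intro!: AE_I2 LIMSEQ_Suc lim_const_over_n simp del: of_nat_Suc)
  from conv_in_prob_0D(2)[OF this, of 1]
  have "(\<lambda>n. prob {\<omega>\<in>space M. \<bar>Q \<omega>\<bar> > real (Suc n)}) \<longlonglongrightarrow> 0"
    by (simp add: field_simps)
  then show ?thesis by (rule LIMSEQ_imp_Suc)
qed

text \<open>Serves an error with a part that does not vanish but carries a factor \<theta> at one's
  disposal. A level \<open>k\<close> that \<open>Q\<close> exceeds with probability below \<eta>/2
  comes first. Then \<theta> = \<epsilon> / (2 k) turns the event that \<open>\<theta> * Q\<close>
  exceeds \<epsilon>/2 into the event that \<open>Q\<close> exceeds \<open>k\<close>, and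
  \<open>n\<close> is chosen last.\<close>

lemma conv_in_prob_0_up_to_small:
  fixes Z :: "nat \<Rightarrow> 'a \<Rightarrow> real" and Q :: "'a \<Rightarrow> real"
  assumes Z: "\<And>n. Z n \<in> borel_measurable M" and Q[measurable]: "Q \<in> borel_measurable M"
    and Y: "\<And>\<theta>. \<theta> > 0 \<Longrightarrow> conv_in_prob M (Y \<theta>) (\<lambda>_. 0)"
    and le: "\<And>\<theta> n. \<theta> > 0 \<Longrightarrow> AE \<omega> in M. \<bar>Z n \<omega>\<bar> \<le> \<bar>Y \<theta> n \<omega>\<bar> + \<bar>\<theta> * Q \<omega>\<bar>"
  shows "conv_in_prob M Z (\<lambda>_. 0)"
proof (rule conv_in_prob_0I[OF Z])
  fix \<epsilon> \<eta> :: real assume *: "\<epsilon> > 0" "\<eta> > 0"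
  have "\<forall>\<^sub>F k in sequentially. prob {\<omega>\<in>space M. \<bar>Q \<omega>\<bar> > real k} < \<eta>/2"
    using order_tendstoD(2)[OF prob_large_tendsto_0[OF Q], of "\<eta>/2"] * by simp
  then obtain k0 where k0: "\<And>k. k \<ge> k0 \<Longrightarrow> prob {\<omega>\<in>space M. \<bar>Q \<omega>\<bar> > real k} < \<eta>/2"
    by (auto simp: eventually_sequentially)
  define k where "k = Suc k0"
  have k: "prob {\<omega>\<in>space M. \<bar>Q \<omega>\<bar> > real k} < \<eta>/2" "k > 0"
    using k0[of k] by (simp_all add: k_def del: of_nat_Suc)
  define \<theta> where "\<theta> = \<epsilon> / (2 * real k)"
  have \<theta>: "\<theta> > 0" using * k by (simp add: \<theta>_def)
  have eq: "\<bar>\<theta> * Q \<omega>\<bar> > \<epsilon>/2 \<longleftrightarrow> \<bar>Q \<omega>\<bar> > real k" for \<omega>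
    using * k by (simp add: \<theta>_def abs_mult field_simps)
  have "\<forall>\<^sub>F n in sequentially. prob {\<omega>\<in>space M. \<bar>Y \<theta> n \<omega>\<bar> > \<epsilon>/2} < \<eta>/2"
    by (intro conv_in_prob_0D(3)[OF Y] half_gt_zero * \<theta>)
  then show "\<forall>\<^sub>F n in sequentially. prob {\<omega>\<in>space M. \<bar>Z n \<omega>\<bar> > \<epsilon>} < \<eta>"
  proof eventually_elim
    case (elim n)
    have [measurable]: "Y \<theta> n \<in> borel_measurable M" by (rule conv_in_prob_0D(1)[OF Y[OF \<theta>]])
    show ?case
      using prob_gt_add[of "Y \<theta> n" "\<lambda>\<omega>. \<theta> * Q \<omega>" "Z n" "\<epsilon>/2" "\<epsilon>/2"] le[OF \<theta>, of n] elim k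
      unfolding eq by auto
  qed
qed

lemma conv_in_prob_unique:
  fixes X :: "nat \<Rightarrow> 'a \<Rightarrow> real"
  assumes Y: "conv_in_prob M X Y" and Z: "conv_in_prob M X Z"
  shows "AE \<omega> in M. Y \<omega> = Z \<omega>"
proof -
  have [measurable]: "X n \<in> borel_measurable M" "Y \<in> borel_measurable M" "Z \<in> borel_measurable M" for n
    using assms by (auto simp: conv_in_prob_def)
  have *: "conv_in_prob M (\<lambda>n \<omega>. X n \<omega> - Y \<omega>) (\<lambda>_. 0)" "conv_in_prob M (\<lambda>n \<omega>. X n \<omega> - Z \<omega>) (\<lambda>_. 0)"
    using assms by (auto simp: conv_in_prob_diff_iff[symmetric])
  have c: "conv_in_prob M (\<lambda>n \<omega>. Y \<omega> - Z \<omega>) (\<lambda>_. 0)"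
    by (rule conv_in_prob_0_dominated[OF _ *]) auto
  have "AE \<omega> in M. \<not> (\<bar>Y \<omega> - Z \<omega>\<bar> > 1 / real (Suc n))" for n
  proof -
    have "(\<lambda>_::nat. prob {\<omega>\<in>space M. \<bar>Y \<omega> - Z \<omega>\<bar> > 1 / real (Suc n)}) \<longlonglongrightarrow> 0"
      using conv_in_prob_0D(2)[OF c, of "1 / real (Suc n)"] by simp
    then have "prob {\<omega>\<in>space M. \<bar>Y \<omega> - Z \<omega>\<bar> > 1 / real (Suc n)} = 0"
      by (simp add: LIMSEQ_const_iff)
    then show ?thesis
      by (subst (asm) prob_eq_0) auto
  qed
  then have "AE \<omega> in M. \<forall>n. \<not> (\<bar>Y \<omega> - Z \<omega>\<bar> > 1 / real (Suc n))"
    by (subst AE_all_countable) blast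
  then show ?thesis
  proof eventually_elim
    case (elim \<omega>)
    show ?case
    proof (rule ccontr)
      assume "Y \<omega> \<noteq> Z \<omega>"
      then obtain n where "1 / real (Suc n) < \<bar>Y \<omega> - Z \<omega>\<bar>"
        using reals_Archimedean[of "\<bar>Y \<omega> - Z \<omega>\<bar>"] by (auto simp: inverse_eq_divide)
      then show False using elim by auto
    qed
  qed
qed

text \<open>\<open>BM_indep\<close> speaks of set systems, the product rule for expectations of
  random variables. Both systems are stable under intersection, so independence passes to the
  generated sigma-algebras, and the one of \<xi> is contained in that of \<open>G\<close>.\<close>

lemma indep_set_expectation:
  fixes \<xi> D :: "'a \<Rightarrow> real"
  assumes sub: "subalgebra M G" and \<xi>: "\<xi> \<in> borel_measurable G" and D: "D \<in> borel_measurable M"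
    and ind: "indep_set (sets G) {D -` B \<inter> space M | B. B \<in> sets borel}"
    and int: "integrable M \<xi>" "integrable M D"
  shows "integrable M (\<lambda>\<omega>. \<xi> \<omega> * D \<omega>)"
    and "expectation (\<lambda>\<omega>. \<xi> \<omega> * D \<omega>) = expectation \<xi> * expectation D"
proof -
  have \<xi>M: "\<xi> \<in> borel_measurable M" using measurable_from_subalg[OF sub \<xi>] .
  have sp: "space G = space M" using sub by (simp add: subalgebra_def)
  have Gs: "\<xi> -` A \<inter> space M \<in> sets G" if "A \<in> sets borel" for A
    using measurable_sets[OF \<xi> that] sp by simp
  have "Int_stable (sets G)" by (rule sets.Int_stable)
  moreover have "Int_stable {D -` B \<inter> space M | B. B \<in> sets borel}"
  proof (rule Int_stableI)
    fix a b assume "a \<in> {D -` B \<inter> space M | B. B \<in> sets borel}" "b \<in> {D -` B \<inter> space M | B. B \<in> sets borel}"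
    then obtain A B where "a = D -` A \<inter> space M" "b = D -` B \<inter> space M" "A \<in> sets borel" "B \<in> sets borel"
      by blast
    then show "a \<inter> b \<in> {D -` B \<inter> space M | B. B \<in> sets borel}"
      by (intro CollectI exI[of _ "A \<inter> B"]) auto
  qed
  ultimately have i2: "indep_set (sigma_sets (space M) (sets G))
      (sigma_sets (space M) {D -` B \<inter> space M | B. B \<in> sets borel})"
    by (intro indep_set_sigma_sets ind)
  have sub2: "sigma_sets (space M) {\<xi> -` A \<inter> space M | A. A \<in> sets borel} \<subseteq> sigma_sets (space M) (sets G)"
    using Gs by (intro sigma_sets_mono') auto
  have "indep_var borel \<xi> borel D"
    unfolding indep_var_eq
  proof (intro conjI \<xi>M D)
    show "indep_set (sigma_sets (space M) {\<xi> -` A \<inter> space M | A. A \<in> sets borel})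
       (sigma_sets (space M) {D -` A \<inter> space M | A. A \<in> sets borel})"
      using i2 unfolding indep_set_def
      by (rule indep_sets_mono_sets) (use sub2 in \<open>auto split: bool.splits\<close>)
  qed
  from indep_var_integrable[OF this int] indep_var_lebesgue_integral[OF this int]
  show "integrable M (\<lambda>\<omega>. \<xi> \<omega> * D \<omega>)"
    and "expectation (\<lambda>\<omega>. \<xi> \<omega> * D \<omega>) = expectation \<xi> * expectation D" by auto
qed

section \<open>A discrete Lenglart inequality\<close>

text \<open>The weights are stopped as soon as their predictable quadratic sum
  exceeds \<open>\<delta>\<close>.  The stopped weights are bounded, so \<open>\<eta>\<close> need not be integrable.\<close>

lemma prob_sum_blocks_le:
  fixes G :: "nat \<Rightarrow> 'a measure" and \<eta> D :: "nat \<Rightarrow> 'a \<Rightarrow> real" and v :: "nat \<Rightarrow> real"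
    and I :: "nat \<Rightarrow> nat set"
  assumes sub: "\<And>i. i \<le> m \<Longrightarrow> subalgebra M (G i)"
    and mono: "\<And>i i'. i \<le> i' \<Longrightarrow> i' \<le> m \<Longrightarrow> sets (G i) \<subseteq> sets (G i')"
    and \<eta>: "\<And>i. i < m \<Longrightarrow> \<eta> i \<in> borel_measurable (G i)"
    and D: "\<And>i. i < m \<Longrightarrow> D i \<in> borel_measurable (G (Suc i))"
    and ind: "\<And>i. i < m \<Longrightarrow> indep_set (sets (G i)) {D i -` B \<inter> space M | B. B \<in> sets borel}"
    and D2: "\<And>i. i < m \<Longrightarrow> integrable M (\<lambda>\<omega>. (D i \<omega>)\<^sup>2)"
    and ED: "\<And>i. i < m \<Longrightarrow> expectation (D i) = 0"
    and ED2: "\<And>i. i < m \<Longrightarrow> expectation (\<lambda>\<omega>. (D i \<omega>)\<^sup>2) = v i"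
    and v0: "\<And>i \<omega>. i < m \<Longrightarrow> v i = 0 \<Longrightarrow> \<omega> \<in> space M \<Longrightarrow> D i \<omega> = 0"
    and I: "\<And>p. p < r \<Longrightarrow> I p \<subseteq> {..<m}" "disjoint_family_on I {..<r}"
    and pos: "\<epsilon> > 0" "\<delta> > 0"
  shows "prob {\<omega>\<in>space M. (\<Sum>p<r. (\<Sum>i\<in>I p. \<eta> i \<omega> * D i \<omega>)\<^sup>2) > \<epsilon>}
    \<le> prob {\<omega>\<in>space M. (\<Sum>i<m. (\<eta> i \<omega>)\<^sup>2 * v i) > \<delta>} + \<delta> / \<epsilon>"
proof -
  have sp: "space (G i) = space M" if "i \<le> m" for i
    using sub[OF that] by (simp add: subalgebra_def)
  have lift: "f \<in> borel_measurable (G i')" if "f \<in> borel_measurable (G i)" "i \<le> i'" "i' \<le> m"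
    for f :: "'a \<Rightarrow> real" and i i'
    by (rule measurable_from_subalg[OF _ that(1)])
      (use mono[OF that(2,3)] sp that in \<open>auto simp: subalgebra_def\<close>)
  have toM: "f \<in> borel_measurable M" if "f \<in> borel_measurable (G i)" "i \<le> m" for f :: "'a \<Rightarrow> real" and i
    by (rule measurable_from_subalg[OF sub[OF that(2)] that(1)])
  have v_nonneg: "v i \<ge> 0" if "i < m" for i
    using ED2[OF that] by (metis integral_nonneg_AE AE_I2 zero_le_power2)
  have \<eta>M: "\<eta> i \<in> borel_measurable M" and DM: "D i \<in> borel_measurable M" if "i < m" for i
    using that toM[OF \<eta>[OF that]] toM[OF D[OF that]] by auto
  have Dint: "integrable M (D i)" if "i < m" for i
    by (rule square_integrable_imp_integrable[OF DM[OF that] D2[OF that]])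
  \<comment> \<open>The sum includes the index \<open>i\<close> and is still known at
    \<open>G i\<close>, because the variances \<open>v\<close> are deterministic. The weight can
    thus be cut before the term that would exceed \<delta> is added.\<close>
  define S where "S i \<omega> = (\<Sum>l\<le>i. (\<eta> l \<omega>)\<^sup>2 * v l)" for i \<omega>
  \<comment> \<open>Below the threshold a weight is bounded by \<open>sqrt (\<delta> / v i)\<close>,
    which says nothing if \<open>v i = 0\<close>. Those weights are cut as well; by
    \<open>v0\<close> their increments vanish, so no block sum changes.\<close>
  define \<theta> where "\<theta> i \<omega> = (if v i = 0 \<or> S i \<omega> > \<delta> then 0 else \<eta> i \<omega>)" for i \<omega>
  have \<theta>G: "\<theta> i \<in> borel_measurable (G i)" if "i < m" for i
  proof -
    have [measurable]: "\<eta> l \<in> borel_measurable (G i)" if "l \<le> i" for l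
      using lift[OF \<eta>] that \<open>i < m\<close> by auto
    have [measurable]: "S i \<in> borel_measurable (G i)"
      unfolding S_def by measurable
    show ?thesis unfolding \<theta>_def by measurable
  qed
  have \<theta>M: "\<theta> i \<in> borel_measurable M" if "i < m" for i
    using toM[OF \<theta>G[OF that]] that by auto
  have S_mem: "(\<eta> i \<omega>)\<^sup>2 * v i \<le> S i \<omega>" if "i < m" for i \<omega>
    unfolding S_def using that v_nonneg
    by (intro member_le_sum) auto
  have \<theta>_bd: "\<exists>C. \<forall>\<omega>. \<bar>\<theta> i \<omega>\<bar> \<le> C" if "i < m" for i
  proof (cases "v i = 0")
    case False
    then have vp: "v i > 0" using v_nonneg[OF that] by auto
    have "\<bar>\<theta> i \<omega>\<bar> \<le> sqrt (\<delta> / v i)" for \<omega>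
    proof (cases "S i \<omega> > \<delta>")
      case False
      then have "(\<eta> i \<omega>)\<^sup>2 * v i \<le> \<delta>" using S_mem[OF that, of \<omega>] by simp
      then have "(\<eta> i \<omega>)\<^sup>2 \<le> \<delta> / v i" using vp by (simp add: field_simps)
      then have "\<bar>\<eta> i \<omega>\<bar> \<le> sqrt (\<delta> / v i)" by (metis real_sqrt_abs real_sqrt_le_iff)
      then show ?thesis using False \<open>v i \<noteq> 0\<close> by (simp add: \<theta>_def)
    qed (use vp pos in \<open>simp add: \<theta>_def\<close>)
    then show ?thesis by blast
  qed (auto simp: \<theta>_def)
  \<comment> \<open>The second bound feeds the first: if step \<open>n\<close> is not cut, the
    stopped sum is at most the unstopped one, and that is \<open>S n\<close>, which has not passed
    \<delta>.\<close>
  have \<theta>_sum: "(\<Sum>i<n. (\<theta> i \<omega>)\<^sup>2 * v i) \<le> \<delta> \<and> (\<Sum>i<n. (\<theta> i \<omega>)\<^sup>2 * v i) \<le> (\<Sum>i<n. (\<eta> i \<omega>)\<^sup>2 * v i)"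
    if "n \<le> m" for n \<omega>
    using that
  proof (induction n)
    case (Suc n)
    show ?case
    proof (cases "v n = 0 \<or> S n \<omega> > \<delta>")
      case True
      then show ?thesis using Suc v_nonneg[of n] by (auto simp: \<theta>_def add_increasing2)
    next
      case False
      have "(\<Sum>i<Suc n. (\<theta> i \<omega>)\<^sup>2 * v i) \<le> (\<Sum>i<Suc n. (\<eta> i \<omega>)\<^sup>2 * v i)"
        using Suc False by (auto simp: \<theta>_def)
      moreover have "(\<Sum>i<Suc n. (\<eta> i \<omega>)\<^sup>2 * v i) \<le> \<delta>"
        using False by (simp add: S_def lessThan_Suc_atMost)
      ultimately show ?thesis by auto
    qed
  qed (use pos in simp)
  have bdd_int: "integrable M (\<lambda>\<omega>. f \<omega> * X \<omega>)"
    if "f \<in> borel_measurable M" and bd: "\<exists>C. \<forall>\<omega>. \<bar>f \<omega>\<bar> \<le> C" and "integrable M X" for f X :: "'a \<Rightarrow> real"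
  proof -
    obtain C where C: "\<And>\<omega>. \<bar>f \<omega>\<bar> \<le> C" using bd by blast
    have "C \<ge> 0" using order_trans[OF abs_ge_zero C] .
    show ?thesis
    proof (rule Bochner_Integration.integrable_bound)
      show "integrable M (\<lambda>\<omega>. C * X \<omega>)" using that by simp
      show "(\<lambda>\<omega>. f \<omega> * X \<omega>) \<in> borel_measurable M" using that by measurable
      show "AE \<omega> in M. norm (f \<omega> * X \<omega>) \<le> norm (C * X \<omega>)"
        using C \<open>C \<ge> 0\<close> by (intro AE_I2) (auto simp: abs_mult intro!: mult_right_mono)
    qed
  qed
  have bdd_mult: "\<exists>C. \<forall>\<omega>. \<bar>f \<omega> * g \<omega>\<bar> \<le> C" if fg: "\<exists>C. \<forall>\<omega>. \<bar>f \<omega>\<bar> \<le> C" "\<exists>C. \<forall>\<omega>. \<bar>g \<omega>\<bar> \<le> C"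
    for f g :: "'a \<Rightarrow> real"
  proof -
    obtain C C' where C: "\<And>\<omega>. \<bar>f \<omega>\<bar> \<le> C" "\<And>\<omega>. \<bar>g \<omega>\<bar> \<le> C'" using fg by blast
    have "\<bar>f \<omega> * g \<omega>\<bar> \<le> C * C'" for \<omega>
      unfolding abs_mult by (intro mult_mono C abs_ge_zero order_trans[OF abs_ge_zero C(1)])
    then show ?thesis by blast
  qed
  have diag: "integrable M (\<lambda>\<omega>. (\<theta> i \<omega>)\<^sup>2)" "integrable M (\<lambda>\<omega>. (\<theta> i \<omega> * D i \<omega>) * (\<theta> i \<omega> * D i \<omega>))"
      "expectation (\<lambda>\<omega>. (\<theta> i \<omega> * D i \<omega>) * (\<theta> i \<omega> * D i \<omega>)) = expectation (\<lambda>\<omega>. (\<theta> i \<omega>)\<^sup>2) * v i"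
    if "i < m" for i
  proof -
    have sq: "\<exists>C. \<forall>\<omega>. \<bar>(\<theta> i \<omega>)\<^sup>2\<bar> \<le> C"
      using bdd_mult[OF \<theta>_bd \<theta>_bd, OF that that] by (simp add: power2_eq_square)
    have [measurable]: "\<theta> i \<in> borel_measurable M" "D i \<in> borel_measurable M" by (fact \<theta>M[OF that] DM[OF that])+
    show i1: "integrable M (\<lambda>\<omega>. (\<theta> i \<omega>)\<^sup>2)"
      using bdd_int[OF _ sq, of "\<lambda>_. 1"] by simp
    have indD2: "indep_set (sets (G i)) {(\<lambda>\<omega>. (D i \<omega>)\<^sup>2) -` B \<inter> space M | B. B \<in> sets borel}"
      using ind[OF that] unfolding indep_set_def
    proof (rule indep_sets_mono_sets)
      have "\<exists>B'. (\<lambda>\<omega>. (D i \<omega>)\<^sup>2) -` B \<inter> space M = D i -` B' \<inter> space M \<and> B' \<in> sets borel"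
        if "B \<in> sets borel" for B
        using measurable_sets[of "\<lambda>x::real. x\<^sup>2" borel borel B] that
        by (intro exI[of _ "(\<lambda>x. x\<^sup>2) -` B"]) auto
      then show "(case b of True \<Rightarrow> sets (G i) | False \<Rightarrow> {(\<lambda>\<omega>. (D i \<omega>)\<^sup>2) -` B \<inter> space M | B. B \<in> sets borel})
         \<subseteq> (case b of True \<Rightarrow> sets (G i) | False \<Rightarrow> {D i -` B \<inter> space M | B. B \<in> sets borel})" for b
        by (cases b) auto
    qed
    have m2: "(\<lambda>\<omega>. (\<theta> i \<omega>)\<^sup>2) \<in> borel_measurable (G i)" using \<theta>G[OF that] by simp
    note * = indep_set_expectation[OF sub m2 _ indD2 i1 D2[OF that]]
    show "integrable M (\<lambda>\<omega>. (\<theta> i \<omega> * D i \<omega>) * (\<theta> i \<omega> * D i \<omega>))"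
      "expectation (\<lambda>\<omega>. (\<theta> i \<omega> * D i \<omega>) * (\<theta> i \<omega> * D i \<omega>)) = expectation (\<lambda>\<omega>. (\<theta> i \<omega>)\<^sup>2) * v i"
      using * that ED2[OF that] by (auto simp: power2_eq_square ac_simps)
  qed
  \<comment> \<open>For \<open>i < l\<close> everything except \<open>D l\<close> is known at
    \<open>G l\<close>, and \<open>D l\<close> is independent of \<open>G l\<close> with mean
    0.\<close>
  have off_lt: "integrable M (\<lambda>\<omega>. (\<theta> i \<omega> * D i \<omega>) * (\<theta> l \<omega> * D l \<omega>)) \<and>
      expectation (\<lambda>\<omega>. (\<theta> i \<omega> * D i \<omega>) * (\<theta> l \<omega> * D l \<omega>)) = 0"
    if "i < l" "l < m" for i l
  proof -
    have im: "i < m" using that by simp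
    have [measurable]: "\<theta> i \<in> borel_measurable M" "\<theta> l \<in> borel_measurable M" using \<theta>M that im by auto
    have "integrable M (\<lambda>\<omega>. (\<theta> i \<omega> * \<theta> l \<omega>) * D i \<omega>)"
      using bdd_mult[OF \<theta>_bd[OF im] \<theta>_bd[OF that(2)]] by (intro bdd_int Dint im) auto
    moreover have "(\<lambda>\<omega>. (\<theta> i \<omega> * \<theta> l \<omega>) * D i \<omega>) \<in> borel_measurable (G l)"
    proof -
      have [measurable]: "\<theta> i \<in> borel_measurable (G l)" "\<theta> l \<in> borel_measurable (G l)" "D i \<in> borel_measurable (G l)"
        using lift[OF \<theta>G] lift[OF D] \<theta>G that im by auto
      show ?thesis by measurable
    qed
    ultimately have "integrable M (\<lambda>\<omega>. (\<theta> i \<omega> * \<theta> l \<omega>) * D i \<omega> * D l \<omega>)"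
      "expectation (\<lambda>\<omega>. (\<theta> i \<omega> * \<theta> l \<omega>) * D i \<omega> * D l \<omega>) = 0"
      using indep_set_expectation[OF sub _ DM ind _ Dint, of l "\<lambda>\<omega>. (\<theta> i \<omega> * \<theta> l \<omega>) * D i \<omega>"] that ED
      by auto
    then show ?thesis by (simp add: ac_simps)
  qed
  have off: "integrable M (\<lambda>\<omega>. (\<theta> i \<omega> * D i \<omega>) * (\<theta> l \<omega> * D l \<omega>))"
      "expectation (\<lambda>\<omega>. (\<theta> i \<omega> * D i \<omega>) * (\<theta> l \<omega> * D l \<omega>)) =
        (if i = l then expectation (\<lambda>\<omega>. (\<theta> i \<omega>)\<^sup>2) * v i else 0)"
    if "i < m" "l < m" for i l
    using diag[OF that(1)] off_lt[of i l] off_lt[of l i] that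
    by (cases i l rule: linorder_cases; simp add: ac_simps)+
  let ?B = "\<lambda>\<omega>. \<Sum>p<r. (\<Sum>i\<in>I p. \<theta> i \<omega> * D i \<omega>)\<^sup>2"
  have Iin: "i < m" if "p < r" "i \<in> I p" for p i using I(1)[OF that(1)] that by auto
  have finI: "finite (I p)" if "p < r" for p using finite_subset[OF I(1)[OF that]] by simp
  have Beq: "?B \<omega> = (\<Sum>p<r. \<Sum>i\<in>I p. \<Sum>l\<in>I p. (\<theta> i \<omega> * D i \<omega>) * (\<theta> l \<omega> * D l \<omega>))" for \<omega>
    by (simp add: power2_eq_square sum_product)
  have Bint: "integrable M ?B"
    unfolding Beq by (intro Bochner_Integration.integrable_sum off) (auto intro: Iin)
  have "expectation ?B = (\<Sum>p<r. \<Sum>i\<in>I p. \<Sum>l\<in>I p. expectation (\<lambda>\<omega>. (\<theta> i \<omega> * D i \<omega>) * (\<theta> l \<omega> * D l \<omega>)))"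
    unfolding Beq
    by (subst Bochner_Integration.integral_sum; (intro Bochner_Integration.integrable_sum off)?;
        (intro sum.cong refl)?; (subst Bochner_Integration.integral_sum)?;
        (intro Bochner_Integration.integrable_sum off)?; (intro sum.cong refl)?;
        (subst Bochner_Integration.integral_sum)?; (intro off)?) (auto intro: Iin)
  also have "\<dots> = (\<Sum>p<r. \<Sum>i\<in>I p. expectation (\<lambda>\<omega>. (\<theta> i \<omega>)\<^sup>2) * v i)"
    using Iin finI by (intro sum.cong refl) (simp add: off sum.delta)
  \<comment> \<open>Disjointness of the blocks makes each diagonal term count once, so all blocks
    together are bounded by one predictable sum.\<close>
  also have "\<dots> = (\<Sum>i\<in>(\<Union>p<r. I p). expectation (\<lambda>\<omega>. (\<theta> i \<omega>)\<^sup>2) * v i)"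
    using I(2) finI by (subst sum.UNION_disjoint) (auto simp: disjoint_family_on_def)
  also have "\<dots> \<le> (\<Sum>i<m. expectation (\<lambda>\<omega>. (\<theta> i \<omega>)\<^sup>2) * v i)"
    using Iin v_nonneg by (intro sum_mono2) (auto intro!: mult_nonneg_nonneg)
  also have "\<dots> = expectation (\<lambda>\<omega>. \<Sum>i<m. (\<theta> i \<omega>)\<^sup>2 * v i)"
    using diag(1) by (subst Bochner_Integration.integral_sum) auto
  also have "\<dots> \<le> expectation (\<lambda>_. \<delta>)"
    using \<theta>_sum[of m] diag(1) by (intro integral_mono) auto
  finally have EB: "expectation ?B \<le> \<delta>" by (simp add: prob_space)
  have B_nonneg: "?B \<omega> \<ge> 0" for \<omega> by (intro sum_nonneg) auto
  have [measurable]: "?B \<in> borel_measurable M" using Bint by auto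
  have etameas[measurable]: "(\<lambda>\<omega>. \<Sum>i<m. (\<eta> i \<omega>)\<^sup>2 * v i) \<in> borel_measurable M"
    using \<eta>M by (intro borel_measurable_sum) auto
  have "prob {\<omega>\<in>space M. (\<Sum>p<r. (\<Sum>i\<in>I p. \<eta> i \<omega> * D i \<omega>)\<^sup>2) > \<epsilon>}
     \<le> prob ({\<omega>\<in>space M. (\<Sum>i<m. (\<eta> i \<omega>)\<^sup>2 * v i) > \<delta>} \<union> {\<omega>\<in>space M. ?B \<omega> \<ge> \<epsilon>})"
  proof (rule finite_measure_mono)
    show "{\<omega>\<in>space M. (\<Sum>p<r. (\<Sum>i\<in>I p. \<eta> i \<omega> * D i \<omega>)\<^sup>2) > \<epsilon>}
      \<subseteq> {\<omega>\<in>space M. (\<Sum>i<m. (\<eta> i \<omega>)\<^sup>2 * v i) > \<delta>} \<union> {\<omega>\<in>space M. ?B \<omega> \<ge> \<epsilon>}"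
    proof
      fix \<omega> assume \<omega>: "\<omega> \<in> {\<omega>\<in>space M. (\<Sum>p<r. (\<Sum>i\<in>I p. \<eta> i \<omega> * D i \<omega>)\<^sup>2) > \<epsilon>}"
      show "\<omega> \<in> {\<omega>\<in>space M. (\<Sum>i<m. (\<eta> i \<omega>)\<^sup>2 * v i) > \<delta>} \<union> {\<omega>\<in>space M. ?B \<omega> \<ge> \<epsilon>}"
      proof (cases "(\<Sum>i<m. (\<eta> i \<omega>)\<^sup>2 * v i) > \<delta>")
        case False
        \<comment> \<open>If the full sum stays below \<delta>, so does every partial sum, and no
          weight has been cut for this \<omega>.\<close>
        have Sle: "S i \<omega> \<le> \<delta>" if "i < m" for i
        proof -
          have "S i \<omega> \<le> (\<Sum>i<m. (\<eta> i \<omega>)\<^sup>2 * v i)"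
            unfolding S_def using that v_nonneg by (intro sum_mono2) auto
          then show ?thesis using False by simp
        qed
        have "\<theta> i \<omega> * D i \<omega> = \<eta> i \<omega> * D i \<omega>" if "i < m" for i
          using Sle[OF that] v0[OF that] \<omega> by (auto simp: \<theta>_def)
        then have "?B \<omega> = (\<Sum>p<r. (\<Sum>i\<in>I p. \<eta> i \<omega> * D i \<omega>)\<^sup>2)"
          using Iin by (intro sum.cong refl arg_cong[where f="\<lambda>x. x\<^sup>2"]) auto
        then show ?thesis using \<omega> by auto
      qed (use \<omega> in auto)
    qed
  qed measurable
  also have "\<dots> \<le> prob {\<omega>\<in>space M. (\<Sum>i<m. (\<eta> i \<omega>)\<^sup>2 * v i) > \<delta>} + prob {\<omega>\<in>space M. ?B \<omega> \<ge> \<epsilon>}"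
    by (intro measure_Un_le) auto
  also have "prob {\<omega>\<in>space M. ?B \<omega> \<ge> \<epsilon>} \<le> expectation ?B / \<epsilon>"
    using B_nonneg pos Bint by (intro integral_Markov_inequality_measure[where A="{}"]) auto
  also have "\<dots> \<le> \<delta> / \<epsilon>" using EB pos by (simp add: divide_right_mono)
  finally show ?thesis by simp
qed

end

section \<open>Brownian increments and simple processes on a grid\<close>

text \<open>Sampling the path at the grid point below the current time gives a function with
  countably many time values, hence a jointly measurable one; continuity lets the grid width go to
  0. The measure space \<open>N\<close> is left open because the result is needed both for
  \<open>M\<close> and, to obtain adaptedness, for \<open>F t\<close>.\<close>

lemma joint_borel_measurable_continuous:
  fixes h :: "real \<Rightarrow> 'a \<Rightarrow> real"
  assumes meas: "\<And>s. s \<in> {a..b} \<Longrightarrow> h s \<in> borel_measurable N"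
    and cont: "\<And>\<omega>. \<omega> \<in> space N \<Longrightarrow> continuous_on {a..b} (\<lambda>s. h s \<omega>)"
  shows "(\<lambda>(\<omega>, s). indicator {a..b} s * h s \<omega>) \<in> borel_measurable (N \<Otimes>\<^sub>M lborel)"
proof (cases "a \<le> b")
  case True
  \<comment> \<open>A grid point may fall outside the interval, where \<open>h\<close> is not
    controlled; clamping moves it back.\<close>
  define cl where "cl s = max a (min b s)" for s :: real
  have cl_mem: "cl s \<in> {a..b}" for s using True by (auto simp: cl_def)
  define g where "g n z = h (cl (real_of_int \<lfloor>real (Suc n) * snd z\<rfloor> / real (Suc n))) (fst z)" for n and z :: "'a \<times> real"
  have gm: "g n \<in> borel_measurable (N \<Otimes>\<^sub>M lborel)" for n
    unfolding g_def
  proof (rule measurable_compose_countable[where f="\<lambda>i z. h (cl (real_of_int i / real (Suc n))) (fst z)"])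
    show "(\<lambda>z. h (cl (real_of_int i / real (Suc n))) (fst z)) \<in> borel_measurable (N \<Otimes>\<^sub>M lborel)" for i
      by (rule measurable_compose[OF measurable_fst meas[OF cl_mem]])
    show "(\<lambda>z. \<lfloor>real (Suc n) * snd z\<rfloor>) \<in> N \<Otimes>\<^sub>M lborel \<rightarrow>\<^sub>M count_space UNIV"
      by measurable
  qed
  have lim: "(\<lambda>n. g n z) \<longlonglongrightarrow> h (cl (snd z)) (fst z)" if "z \<in> space (N \<Otimes>\<^sub>M lborel)" for z
  proof -
    have \<omega>: "fst z \<in> space N" using that by (auto simp: space_pair_measure)
    have "(\<lambda>n. real_of_int \<lfloor>real (Suc n) * snd z\<rfloor> / real (Suc n)) \<longlonglongrightarrow> snd z"
    proof (rule tendsto_sandwich)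
      show "\<forall>\<^sub>F n in sequentially. snd z - inverse (real (Suc n)) \<le> real_of_int \<lfloor>real (Suc n) * snd z\<rfloor> / real (Suc n)"
      proof (intro always_eventually allI)
        fix n
        have "real (Suc n) * snd z - 1 \<le> real_of_int \<lfloor>real (Suc n) * snd z\<rfloor>" by linarith
        then have "(real (Suc n) * snd z - 1) / real (Suc n) \<le> real_of_int \<lfloor>real (Suc n) * snd z\<rfloor> / real (Suc n)"
          by (intro divide_right_mono) auto
        then show "snd z - inverse (real (Suc n)) \<le> real_of_int \<lfloor>real (Suc n) * snd z\<rfloor> / real (Suc n)"
          by (simp add: diff_divide_distrib inverse_eq_divide del: of_nat_Suc)
      qed
      show "\<forall>\<^sub>F n in sequentially. real_of_int \<lfloor>real (Suc n) * snd z\<rfloor> / real (Suc n) \<le> snd z"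
        by (intro always_eventually allI) (simp add: pos_divide_le_eq mult.commute del: of_nat_Suc)
      show "(\<lambda>n. snd z - inverse (real (Suc n))) \<longlonglongrightarrow> snd z"
        using tendsto_diff[OF tendsto_const LIMSEQ_inverse_real_of_nat] by simp
    qed simp
    then have "(\<lambda>n. cl (real_of_int \<lfloor>real (Suc n) * snd z\<rfloor> / real (Suc n))) \<longlonglongrightarrow> cl (snd z)"
      unfolding cl_def by (intro tendsto_max tendsto_min tendsto_const)
    then show ?thesis
      unfolding g_def
      by (rule continuous_on_tendsto_compose[OF cont[OF \<omega>] _ cl_mem]) (intro always_eventually allI cl_mem)
  qed
  have "(\<lambda>z. h (cl (snd z)) (fst z)) \<in> borel_measurable (N \<Otimes>\<^sub>M lborel)"
    by (rule borel_measurable_LIMSEQ_real[OF lim gm])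
  then have "(\<lambda>z. indicator {a..b} (snd z) * h (cl (snd z)) (fst z)) \<in> borel_measurable (N \<Otimes>\<^sub>M lborel)"
    by measurable
  also have "(\<lambda>z. indicator {a..b} (snd z) * h (cl (snd z)) (fst z)) = (\<lambda>(\<omega>, s). indicator {a..b} s * h s \<omega>)"
    by (auto simp: cl_def fun_eq_iff indicator_def)
  finally show ?thesis .
qed simp

lemma LINT_borel_measurable_continuous:
  fixes h :: "real \<Rightarrow> 'a \<Rightarrow> real"
  assumes "\<And>s. s \<in> {a..b} \<Longrightarrow> h s \<in> borel_measurable N"
    and "\<And>\<omega>. \<omega> \<in> space N \<Longrightarrow> continuous_on {a..b} (\<lambda>s. h s \<omega>)"
  shows "(\<lambda>\<omega>. LINT s:{a..b}|lborel. h s \<omega>) \<in> borel_measurable N"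
  unfolding set_lebesgue_integral_def real_scaleR_def
  by (rule lborel.borel_measurable_lebesgue_integral[OF joint_borel_measurable_continuous[OF assms]])

section \<open>Independence and moments of Brownian increments\<close>

context brownian_motion begin

lemma adapted_M: "0 \<le> t \<Longrightarrow> f \<in> borel_measurable (F t) \<Longrightarrow> f \<in> borel_measurable M" for f :: "'w \<Rightarrow> real"
  by (rule measurable_from_subalg[OF subalg])

lemma space_F: "0 \<le> t \<Longrightarrow> space (F t) = space M"
  using subalg[of t] by (simp add: subalgebra_def)

lemma adapted_mono:
  fixes f :: "'w \<Rightarrow> real"
  assumes "f \<in> borel_measurable (F s)" "0 \<le> s" "s \<le> t"
  shows "f \<in> borel_measurable (F t)"
  by (rule measurable_from_subalg[OF _ assms(1)])
    (use filtration_mono[OF assms(2,3)] space_F assms in \<open>auto simp: subalgebra_def\<close>)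

lemma BM_measurable: "0 \<le> t \<Longrightarrow> W t \<in> borel_measurable M"
  using adapted_M BM_adapted by blast

text \<open>The function \<open>f\<close> will be the identity or the centred square of the
  increment. Partitions may repeat points, hence the case \<open>s = t\<close>: a constant generates
  only the empty set and the whole space, which are independent of everything.\<close>

lemma BM_increment_indep:
  fixes f :: "real \<Rightarrow> real"
  assumes "0 \<le> s" "s \<le> t" and f: "f \<in> borel_measurable borel"
  shows "indep_set (sets (F s)) {(\<lambda>\<omega>. f (W t \<omega> - W s \<omega>)) -` B \<inter> space M | B. B \<in> sets borel}"
proof (cases "s = t")
  case False
  show ?thesis
    unfolding indep_set_def
  proof (rule indep_sets_mono_sets[where F="case_bool (sets (F s)) {(\<lambda>\<omega>. W t \<omega> - W s \<omega>) -` B \<inter> space M | B. B \<in> sets borel}"])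
    show "indep_sets (case_bool (sets (F s)) {(\<lambda>\<omega>. W t \<omega> - W s \<omega>) -` B \<inter> space M | B. B \<in> sets borel}) UNIV"
      using BM_indep[OF assms(1), of t] False assms(2) unfolding indep_set_def by simp
    have "\<exists>B'. (\<lambda>\<omega>. f (W t \<omega> - W s \<omega>)) -` B \<inter> space M = (\<lambda>\<omega>. W t \<omega> - W s \<omega>) -` B' \<inter> space M \<and> B' \<in> sets borel"
      if "B \<in> sets borel" for B
      using measurable_sets[OF f that] by (intro exI[of _ "f -` B"]) auto
    then show "(case b of True \<Rightarrow> sets (F s) | False \<Rightarrow> {(\<lambda>\<omega>. f (W t \<omega> - W s \<omega>)) -` B \<inter> space M | B. B \<in> sets borel})
       \<subseteq> (case b of True \<Rightarrow> sets (F s) | False \<Rightarrow> {(\<lambda>\<omega>. W t \<omega> - W s \<omega>) -` B \<inter> space M | B. B \<in> sets borel})" for b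
      by (cases b) auto
  qed
next
  case True
  have "sets (F s) \<subseteq> events" using subalg[OF assms(1)] by (simp add: subalgebra_def)
  moreover have "(\<lambda>\<omega>. f 0) -` B \<inter> space M = (if f 0 \<in> B then space M else {})" for B by auto
  ultimately show ?thesis
    unfolding indep_sets2_eq using True sets.sets_into_space
    by (auto simp: prob_space Int_absorb2)
qed

text \<open>The two triples are the data of the Lenglart inequality for the increment and for its
  centred square. The variance of the latter is \<open>3 * (t - s)\<^sup>2 - (t - s)\<^sup>2\<close>
  by the fourth Gaussian moment; being quadratic in the length, it sums to 0 as the mesh
  vanishes.\<close>

lemma BM_increment_moments:
  assumes "0 \<le> s" "s \<le> t"
  shows "integrable M (\<lambda>\<omega>. (W t \<omega> - W s \<omega>)\<^sup>2)"
    and "expectation (\<lambda>\<omega>. W t \<omega> - W s \<omega>) = 0"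
    and "expectation (\<lambda>\<omega>. (W t \<omega> - W s \<omega>)\<^sup>2) = t - s"
    and "integrable M (\<lambda>\<omega>. ((W t \<omega> - W s \<omega>)\<^sup>2 - (t - s))\<^sup>2)"
    and "expectation (\<lambda>\<omega>. (W t \<omega> - W s \<omega>)\<^sup>2 - (t - s)) = 0"
    and "expectation (\<lambda>\<omega>. ((W t \<omega> - W s \<omega>)\<^sup>2 - (t - s))\<^sup>2) = 2 * (t - s)\<^sup>2"
proof -
  let ?D = "\<lambda>\<omega>. W t \<omega> - W s \<omega>"
  have *: "integrable M (\<lambda>\<omega>. ?D \<omega> ^ 2) \<and> integrable M (\<lambda>\<omega>. ?D \<omega> ^ 4) \<and> expectation ?D = 0
     \<and> expectation (\<lambda>\<omega>. ?D \<omega> ^ 2) = t - s \<and> expectation (\<lambda>\<omega>. ?D \<omega> ^ 4) = 3 * (t - s)\<^sup>2"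
  proof (cases "s = t")
    case False
    define v where "v = sqrt (t - s)"
    have v: "v > 0" "v\<^sup>2 = t - s" using False assms by (auto simp: v_def)
    have d: "distributed M lborel ?D (\<lambda>x. ennreal (normal_density 0 v x))"
      using BM_normal[of s t] False assms by (simp add: v_def)
    have e: "expectation (\<lambda>\<omega>. ?D \<omega> ^ n) = (\<integral>x. normal_density 0 v x * x ^ n \<partial>lborel)" for n
      by (rule distributed_integral[OF d, symmetric]) auto
    have i: "integrable M (\<lambda>\<omega>. ?D \<omega> ^ n)" for n
      using distributed_integrable[OF d, of "\<lambda>x. x ^ n"] integrable_normal_moment[OF v(1), of 0 n] by simp
    have "expectation (\<lambda>\<omega>. ?D \<omega> ^ 1) = 0"
      unfolding e using integral_normal_moment_odd[OF v(1), of 0 0] by simp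
    moreover have "expectation (\<lambda>\<omega>. ?D \<omega> ^ 2) = t - s"
      unfolding e using integral_normal_moment_even[OF v(1), of 0 1] v by (simp add: fact_numeral)
    moreover have "expectation (\<lambda>\<omega>. ?D \<omega> ^ 4) = 3 * (t - s)\<^sup>2"
      unfolding e using integral_normal_moment_even[OF v(1), of 0 2] v
      by (simp add: fact_numeral power_divide)
    ultimately show ?thesis using i by simp
  qed simp
  have e4: "(x\<^sup>2 - c)\<^sup>2 = x ^ 4 - 2 * c * x\<^sup>2 + c\<^sup>2" for x c :: real by algebra
  show "integrable M (\<lambda>\<omega>. (?D \<omega>)\<^sup>2)" "expectation ?D = 0" "expectation (\<lambda>\<omega>. (?D \<omega>)\<^sup>2) = t - s"
    using * by auto
  show "integrable M (\<lambda>\<omega>. ((?D \<omega>)\<^sup>2 - (t - s))\<^sup>2)" using * unfolding e4 by simp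
  show "expectation (\<lambda>\<omega>. (?D \<omega>)\<^sup>2 - (t - s)) = 0" using * by (simp add: prob_space)
  define D c where "D = ?D" and "c = t - s"
  have "integrable M (\<lambda>\<omega>. D \<omega> ^ 2)" "integrable M (\<lambda>\<omega>. D \<omega> ^ 4)"
      "expectation (\<lambda>\<omega>. D \<omega> ^ 2) = c" "expectation (\<lambda>\<omega>. D \<omega> ^ 4) = 3 * c\<^sup>2"
    using * by (simp_all add: D_def c_def)
  then have "expectation (\<lambda>\<omega>. ((D \<omega>)\<^sup>2 - c)\<^sup>2) = 2 * c\<^sup>2"
    unfolding e4 by (simp add: prob_space power2_eq_square)
  then show "expectation (\<lambda>\<omega>. ((?D \<omega>)\<^sup>2 - (t - s))\<^sup>2) = 2 * (t - s)\<^sup>2"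
    by (simp add: D_def c_def)
qed

end

section \<open>Grids, step functions and common refinements\<close>

lemma ex_increasing_enumeration:
  fixes Z :: "real set"
  assumes "finite Z" "Z \<subseteq> {a..b}" "a \<in> Z" "b \<in> Z"
  obtains n :: nat and z :: "nat \<Rightarrow> real" where "z 0 = a" "z n = b" "strict_mono_on {..n} z" "z ` {..n} = Z"
proof -
  define l where "l = sorted_list_of_set Z"
  have l: "set l = Z" "sorted_wrt (<) l" using assms by (auto simp: l_def)
  have ne: "l \<noteq> []" using l assms by auto
  define n where "n = length l - 1"
  have len: "length l = Suc n" using ne by (simp add: n_def)
  have mono: "strict_mono_on {..n} (\<lambda>i. l ! i)"
    using l(2) len by (auto simp: strict_mono_on_def sorted_wrt_iff_nth_less)
  have img: "(\<lambda>i. l ! i) ` {..n} = Z"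
    unfolding l(1)[symmetric] set_conv_nth len by (auto simp: less_Suc_eq_le)
  have le: "l ! i \<le> l ! i'" if "i \<le> i'" "i' \<le> n" for i i'
    using mono that by (cases "i = i'") (auto simp: strict_mono_on_def intro!: less_imp_le)
  have ia: "\<exists>i\<le>n. l ! i = a" and ib: "\<exists>i\<le>n. l ! i = b" using img assms by blast+
  have mem: "l ! 0 \<in> Z" "l ! n \<in> Z" unfolding img[symmetric] by auto
  have "l ! 0 = a" using ia le[of 0] mem assms(2) by fastforce
  moreover have "l ! n = b" using ib le[of _ n] mem assms(2) by fastforce
  ultimately show ?thesis using mono img by (intro that[where n=n and z="\<lambda>i. l ! i"])
qed

lemma sum_increments_between:
  fixes z :: "nat \<Rightarrow> real" and f :: "real \<Rightarrow> real"
  assumes z: "strict_mono_on {..n} z" and ab: "a \<in> z ` {..n}" "b \<in> z ` {..n}" "a \<le> b"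
  shows "(\<Sum>i<n. if a < z (Suc i) \<and> z (Suc i) \<le> b then f (z (Suc i)) - f (z i) else 0) = f b - f a"
proof -
  obtain p r where pr: "a = z p" "b = z r" "p \<le> n" "r \<le> n" using ab by auto
  have lt: "z i < z i' \<longleftrightarrow> i < i'" if "i \<le> n" "i' \<le> n" for i i'
    using strict_mono_on_less[OF z] that by auto
  have le: "z i \<le> z i' \<longleftrightarrow> i \<le> i'" if "i \<le> n" "i' \<le> n" for i i'
    using strict_mono_on_less_eq[OF z] that by auto
  have "p \<le> r" using ab pr le by auto
  have "(\<Sum>i<n. if a < z (Suc i) \<and> z (Suc i) \<le> b then f (z (Suc i)) - f (z i) else 0)
     = (\<Sum>i\<in>{..<n} \<inter> {i. a < z (Suc i) \<and> z (Suc i) \<le> b}. f (z (Suc i)) - f (z i))"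
    by (simp add: sum.inter_restrict)
  also have "{..<n} \<inter> {i. a < z (Suc i) \<and> z (Suc i) \<le> b} = {p..<r}"
    using pr by (auto simp: lt le)
  also have "(\<Sum>i\<in>{p..<r}. f (z (Suc i)) - f (z i)) = f (z r) - f (z p)"
    using sum_Suc_diff'[OF \<open>p \<le> r\<close>, of "\<lambda>i. f (z i)"] .
  finally show ?thesis using pr by simp
qed

lemma sum_step_function:
  fixes z :: "nat \<Rightarrow> real"
  assumes z: "strict_mono_on {..n} z"
    and f: "\<And>i s. i < n \<Longrightarrow> z i < s \<Longrightarrow> s \<le> z (Suc i) \<Longrightarrow> f s = (c i :: real)"
  shows "(\<Sum>i<n. c i * indicator {z i<..z (Suc i)} s) = (if z 0 < s \<and> s \<le> z n then f s else 0)"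
  using assms
proof (induction n)
  case (Suc n)
  have "(\<Sum>i<n. c i * indicator {z i<..z (Suc i)} s) = (if z 0 < s \<and> s \<le> z n then f s else 0)"
    using Suc.prems by (intro Suc.IH) (auto simp: strict_mono_on_def)
  moreover have "z 0 \<le> z n" "z n < z (Suc n)"
    using strict_mono_on_leD[OF Suc.prems(1), of 0 n] strict_mono_onD[OF Suc.prems(1), of n "Suc n"] by auto
  ultimately show ?case using Suc.prems(2)[of n s] by (auto simp: indicator_def)
qed simp

lemma is_partition_le:
  assumes "is_partition t m s" "i \<le> i'" "i' \<le> m"
  shows "s i \<le> s i'"
  using assms(2,3)
proof (induction i' rule: dec_induct)
  case (step n)
  then have "s n \<le> s (Suc n)" using assms(1) by (simp add: is_partition_def)
  then show ?case using step by simp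
qed simp

lemma is_partition_mem:
  assumes "is_partition t m s" "i \<le> m"
  shows "s i \<in> {0..t}"
  using is_partition_le[OF assms(1), of 0 i] is_partition_le[OF assms(1), of i m] assms
  by (auto simp: is_partition_def)

text \<open>Two simple processes are compared on a common refinement of their grids.\<close>

definition refines :: "real \<Rightarrow> 'w simple_proc \<Rightarrow> nat \<Rightarrow> (nat \<Rightarrow> real) \<Rightarrow> bool" where
  "refines t = (\<lambda>(m, \<tau>, \<xi>) n z. strict_mono_on {..n} z \<and> z n = t \<and>
     (\<forall>i<m. \<tau> i \<le> \<tau> (Suc i)) \<and> (\<forall>l\<le>m. min (\<tau> l) t \<in> z ` {..n}))"

text \<open>A jump time below \<open>t\<close> is a grid point, so if it precedes the right end of a
  grid interval, it cannot lie strictly inside. Consequently the process is constant on each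
  left-open grid interval, with a value determined by weights known at its left end.\<close>

lemma refines_jump:
  assumes z: "refines t (m, \<tau>, \<xi>) n z" and "l \<le> m" "\<kappa> < n" "\<tau> l < z (Suc \<kappa>)"
  shows "\<tau> l \<le> z \<kappa>" "\<tau> l \<in> z ` {..n}"
proof -
  have mono: "strict_mono_on {..n} z" and zn: "z n = t" and mem: "min (\<tau> l) t \<in> z ` {..n}"
    using assms by (auto simp: refines_def)
  have "z (Suc \<kappa>) \<le> t" using strict_mono_on_leD[OF mono, of "Suc \<kappa>" n] assms zn by auto
  then have "min (\<tau> l) t = \<tau> l" using assms by auto
  then show "\<tau> l \<in> z ` {..n}" using mem by simp
  then obtain i where i: "i \<le> n" "\<tau> l = z i" by auto
  then have "i < Suc \<kappa>" using strict_mono_on_less[OF mono, of i "Suc \<kappa>"] assms by auto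
  then show "\<tau> l \<le> z \<kappa>" using strict_mono_on_leD[OF mono, of i \<kappa>] i assms by auto
qed

text \<open>Simple processes live on left-open, right-closed intervals, so the right end point
  represents its grid interval.\<close>

lemma simple_value_refines:
  assumes z: "refines t G n z" and "\<kappa> < n" "z \<kappa> < s" "s \<le> z (Suc \<kappa>)"
  shows "simple_value G s \<omega> = simple_value G (z (Suc \<kappa>)) \<omega>"
proof -
  obtain m \<tau> \<xi> where G: "G = (m, \<tau>, \<xi>)" by (cases G)
  have *: "\<tau> l < s \<longleftrightarrow> \<tau> l < z (Suc \<kappa>)" if "l \<le> m" for l
    using refines_jump(1)[OF z[unfolded G] that assms(2)] assms by auto
  have "indicator {\<tau> i<..\<tau> (Suc i)} s = (indicator {\<tau> i<..\<tau> (Suc i)} (z (Suc \<kappa>)) :: real)" if "i < m" for i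
    using *[of i] *[of "Suc i"] that by (auto simp: indicator_def not_less)
  then show ?thesis
    unfolding G simple_value_def prod.case by (intro sum.cong refl) (simp only: lessThan_iff)
qed

text \<open>Each Brownian increment over a jump interval telescopes over the grid; exchanging the
  two sums collects, for every grid increment, the weights active there, which is the value of the
  process.\<close>

lemma simple_integral_refines:
  assumes z: "refines t G n z" and a: "a \<in> z ` {..n}"
  shows "simple_integral W G a \<omega> =
    (\<Sum>\<kappa><n. if z (Suc \<kappa>) \<le> a then simple_value G (z (Suc \<kappa>)) \<omega> * (W (z (Suc \<kappa>)) \<omega> - W (z \<kappa>) \<omega>) else 0)"
proof -
  obtain m \<tau> \<xi> where G: "G = (m, \<tau>, \<xi>)" by (cases G)
  have mono: "strict_mono_on {..n} z" and zn: "z n = t" and \<tau>: "\<And>i. i < m \<Longrightarrow> \<tau> i \<le> \<tau> (Suc i)"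
    and mem: "\<And>l. l \<le> m \<Longrightarrow> min (\<tau> l) t \<in> z ` {..n}"
    using z by (auto simp: refines_def G)
  have "a \<le> t" using a strict_mono_on_leD[OF mono, of _ n] zn by auto
  have mem': "min (\<tau> l) a \<in> z ` {..n}" if "l \<le> m" for l
    using mem[OF that] a \<open>a \<le> t\<close> by (cases "\<tau> l \<le> a") (auto simp: min_def)
  let ?d = "\<lambda>\<kappa>. W (z (Suc \<kappa>)) \<omega> - W (z \<kappa>) \<omega>"
  have "W (min (\<tau> (Suc i)) a) \<omega> - W (min (\<tau> i) a) \<omega>
      = (\<Sum>\<kappa><n. if z (Suc \<kappa>) \<le> a then indicator {\<tau> i<..\<tau> (Suc i)} (z (Suc \<kappa>)) * ?d \<kappa> else 0)"
    if "i < m" for i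
  proof -
    have "W (min (\<tau> (Suc i)) a) \<omega> - W (min (\<tau> i) a) \<omega>
      = (\<Sum>\<kappa><n. if min (\<tau> i) a < z (Suc \<kappa>) \<and> z (Suc \<kappa>) \<le> min (\<tau> (Suc i)) a then ?d \<kappa> else 0)"
      using mem'[of i] mem'[of "Suc i"] that \<tau>[OF that]
      by (intro sum_increments_between[OF mono, of _ _ "\<lambda>s. W s \<omega>", symmetric]) auto
    also have "\<dots> = (\<Sum>\<kappa><n. if z (Suc \<kappa>) \<le> a then indicator {\<tau> i<..\<tau> (Suc i)} (z (Suc \<kappa>)) * ?d \<kappa> else 0)"
      by (intro sum.cong refl) (auto simp: indicator_def)
    finally show ?thesis .
  qed
  then have "simple_integral W G a \<omega> = (\<Sum>i<m. \<xi> i \<omega> *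
     (\<Sum>\<kappa><n. if z (Suc \<kappa>) \<le> a then indicator {\<tau> i<..\<tau> (Suc i)} (z (Suc \<kappa>)) * ?d \<kappa> else 0))"
    by (simp add: G simple_integral_def)
  also have "\<dots> = (\<Sum>\<kappa><n. \<Sum>i<m. \<xi> i \<omega> *
     (if z (Suc \<kappa>) \<le> a then indicator {\<tau> i<..\<tau> (Suc i)} (z (Suc \<kappa>)) * ?d \<kappa> else 0))"
    unfolding sum_distrib_left by (rule sum.swap)
  also have "\<dots> = (\<Sum>\<kappa><n. if z (Suc \<kappa>) \<le> a then simple_value G (z (Suc \<kappa>)) \<omega> * ?d \<kappa> else 0)"
  proof (intro sum.cong refl)
    show "(\<Sum>i<m. \<xi> i \<omega> * (if z (Suc \<kappa>) \<le> a then indicator {\<tau> i<..\<tau> (Suc i)} (z (Suc \<kappa>)) * ?d \<kappa> else 0))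
       = (if z (Suc \<kappa>) \<le> a then simple_value G (z (Suc \<kappa>)) \<omega> * ?d \<kappa> else 0)" for \<kappa>
      by (cases "z (Suc \<kappa>) \<le> a")
        (simp_all only: G simple_value_def prod.case sum_distrib_right mult.assoc if_True if_False
          mult_zero_right sum.neutral_const)
  qed
  finally show ?thesis .
qed

lemma simple_integral_diff_refines:
  assumes z: "refines t G n z" and ab: "a \<in> z ` {..n}" "b \<in> z ` {..n}" "a \<le> b"
  shows "simple_integral W G b \<omega> - simple_integral W G a \<omega> =
    (\<Sum>\<kappa>\<in>{\<kappa>. \<kappa> < n \<and> a < z (Suc \<kappa>) \<and> z (Suc \<kappa>) \<le> b}.
       simple_value G (z (Suc \<kappa>)) \<omega> * (W (z (Suc \<kappa>)) \<omega> - W (z \<kappa>) \<omega>))"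
proof -
  have eq: "{\<kappa>. \<kappa> < n \<and> a < z (Suc \<kappa>) \<and> z (Suc \<kappa>) \<le> b} = {..<n} \<inter> {\<kappa>. a < z (Suc \<kappa>) \<and> z (Suc \<kappa>) \<le> b}"
    by auto
  show ?thesis
    unfolding simple_integral_refines[OF z ab(1)] simple_integral_refines[OF z ab(2)] eq
    by (subst sum.inter_restrict, simp, subst sum_subtractf[symmetric], intro sum.cong refl) (use ab(3) in auto)
qed

text \<open>The left-point approximation of \<open>H\<close>. Its weights may be unbounded, so it
  need not be a \<open>simple_process\<close>. It has the same encoding nevertheless, so that the
  lemmas on refinements, which concern only the algebra and the adaptedness, cover it too.\<close>

definition freeze :: "nat \<Rightarrow> (nat \<Rightarrow> real) \<Rightarrow> (real \<Rightarrow> 'w \<Rightarrow> real) \<Rightarrow> 'w simple_proc" where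
  "freeze m s H = (m, s, \<lambda>i. H (s i))"

lemma simple_integral_freeze_diff:
  assumes s: "is_partition t m s" and p: "p < m"
  shows "simple_integral W (freeze m s H) (s (Suc p)) \<omega> - simple_integral W (freeze m s H) (s p) \<omega>
    = H (s p) \<omega> * (W (s (Suc p)) \<omega> - W (s p) \<omega>)"
proof -
  have "simple_integral W (freeze m s H) (s (Suc p)) \<omega> - simple_integral W (freeze m s H) (s p) \<omega>
    = (\<Sum>i<m. H (s i) \<omega> * (W (min (s (Suc i)) (s (Suc p))) \<omega> - W (min (s i) (s (Suc p))) \<omega>)
        - H (s i) \<omega> * (W (min (s (Suc i)) (s p)) \<omega> - W (min (s i) (s p)) \<omega>))"
    by (simp add: freeze_def simple_integral_def sum_subtractf)
  also have "\<dots> = (\<Sum>i<m. if i = p then H (s p) \<omega> * (W (s (Suc p)) \<omega> - W (s p) \<omega>) else 0)"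
  proof (intro sum.cong refl)
    fix i assume "i \<in> {..<m}"
    then have i: "i < m" by simp
    note le = is_partition_le[OF s]
    show "H (s i) \<omega> * (W (min (s (Suc i)) (s (Suc p))) \<omega> - W (min (s i) (s (Suc p))) \<omega>)
        - H (s i) \<omega> * (W (min (s (Suc i)) (s p)) \<omega> - W (min (s i) (s p)) \<omega>)
       = (if i = p then H (s p) \<omega> * (W (s (Suc p)) \<omega> - W (s p) \<omega>) else 0)"
    proof (cases i p rule: linorder_cases)
      case less
      then show ?thesis using le[of "Suc i" p] le[of "Suc i" "Suc p"] le[of i p] le[of i "Suc p"] i p
        by (simp add: min_absorb1)
    next
      case equal
      then show ?thesis using le[of p "Suc p"] p by (simp add: min_absorb1 min_absorb2)
    next
      case greater
      then show ?thesis using le[of p "Suc i"] le[of "Suc p" "Suc i"] le[of p i] le[of "Suc p" i] i p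
        by (simp add: min_absorb2)
    qed
  qed
  also have "\<dots> = H (s p) \<omega> * (W (s (Suc p)) \<omega> - W (s p) \<omega>)" using p by simp
  finally show ?thesis .
qed

section \<open>Square integrability of the approximation error along a path\<close>

lemma continuous_on_indicator_borel_measurable:
  fixes h :: "real \<Rightarrow> real"
  assumes "continuous_on {a..b} h"
  shows "(\<lambda>s. indicator {a..b} s * h s) \<in> borel_measurable lborel"
  using borel_integrable_atLeastAtMost'[OF assms] by (auto simp: set_integrable_def dest: borel_measurable_integrable)

lemma bounded_square_set_integrable:
  fixes f :: "real \<Rightarrow> real"
  assumes m: "(\<lambda>s. indicator {a..b} s * f s) \<in> borel_measurable lborel"
    and C: "\<And>s. s \<in> {a..b} \<Longrightarrow> \<bar>f s\<bar> \<le> C"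
  shows "set_integrable lborel {a..b} (\<lambda>s. (f s)\<^sup>2)"
  unfolding set_integrable_def
proof (rule Bochner_Integration.integrable_bound)
  show "integrable lborel (\<lambda>s::real. C\<^sup>2 * indicator {a..b} s)" by (simp add: emeasure_lborel_Icc_eq)
  have "(\<lambda>s. (indicator {a..b} s * f s)\<^sup>2) \<in> borel_measurable lborel" using m by measurable
  also have "(\<lambda>s. (indicator {a..b} s * f s)\<^sup>2) = (\<lambda>s. indicator {a..b} s *\<^sub>R (f s)\<^sup>2)"
    by (auto simp: indicator_def)
  finally show "(\<lambda>s. indicator {a..b} s *\<^sub>R (f s)\<^sup>2) \<in> borel_measurable lborel" .
  have "(f s)\<^sup>2 \<le> C\<^sup>2" if "s \<in> {a..b}" for s
    using power_mono[OF C[OF that], of 2] by simp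
  then show "AE s in lborel. norm (indicator {a..b} s *\<^sub>R (f s)\<^sup>2) \<le> norm (C\<^sup>2 * indicator {a..b} s)"
    by (intro AE_I2) (auto simp: indicator_def)
qed

lemma continuous_on_Icc_bounded:
  fixes h :: "real \<Rightarrow> real"
  assumes "continuous_on {a..b} h"
  obtains C where "C \<ge> 0" "\<And>s. s \<in> {a..b} \<Longrightarrow> \<bar>h s\<bar> \<le> C"
proof -
  have "bounded (h ` {a..b})"
    by (intro compact_imp_bounded compact_continuous_image assms compact_Icc)
  then obtain C where "C > 0" "\<And>x. x \<in> h ` {a..b} \<Longrightarrow> norm x \<le> C" by (auto simp: bounded_pos)
  then show ?thesis using that[of C] by auto
qed

lemma simple_value_borel_measurable: "(\<lambda>s. simple_value G s \<omega>) \<in> borel_measurable lborel"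
proof -
  obtain m \<tau> \<xi> where G: "G = (m, \<tau>, \<xi>)" by (cases G)
  show ?thesis unfolding G simple_value_def prod.case by measurable
qed

lemma simple_value_bounded: "\<exists>C\<ge>0. \<forall>s. \<bar>simple_value G s \<omega>\<bar> \<le> C"
proof -
  obtain m \<tau> \<xi> where G: "G = (m, \<tau>, \<xi>)" by (cases G)
  have "\<bar>simple_value G s \<omega>\<bar> \<le> (\<Sum>i<m. \<bar>\<xi> i \<omega>\<bar>)" for s
    unfolding G simple_value_def prod.case
    by (intro order_trans[OF sum_abs] sum_mono) (auto simp: indicator_def)
  then show ?thesis by (intro exI[of _ "\<Sum>i<m. \<bar>\<xi> i \<omega>\<bar>"]) (auto intro: sum_nonneg)
qed

lemma simple_value_diff_square_integrable:
  assumes h: "continuous_on {a..b} (h :: real \<Rightarrow> real)"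
  shows "set_integrable lborel {a..b} (\<lambda>s. (simple_value G s \<omega> - h s)\<^sup>2)"
proof -
  obtain C where C: "\<And>s. s \<in> {a..b} \<Longrightarrow> \<bar>h s\<bar> \<le> C" using continuous_on_Icc_bounded[OF h] by blast
  obtain C' where C': "\<And>s. \<bar>simple_value G s \<omega>\<bar> \<le> C'" using simple_value_bounded[of G \<omega>] by blast
  have "(\<lambda>s. indicator {a..b} s * simple_value G s \<omega> - indicator {a..b} s * h s) \<in> borel_measurable lborel"
    using simple_value_borel_measurable continuous_on_indicator_borel_measurable[OF h] by measurable
  then have m: "(\<lambda>s. indicator {a..b} s * (simple_value G s \<omega> - h s)) \<in> borel_measurable lborel"
    by (simp add: right_diff_distrib)
  show ?thesis
  proof (rule bounded_square_set_integrable[OF m])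
    show "\<bar>simple_value G s \<omega> - h s\<bar> \<le> C' + C" if "s \<in> {a..b}" for s
      using C[OF that] C'[of s] by linarith
  qed
qed

section \<open>Error bounds on a fixed partition, for simple processes and for Ito integrals\<close>

context brownian_motion begin

lemma continuous_adaptedD:
  assumes "continuous_adapted M F T H" "t \<in> {0..T}"
  shows "H t \<in> borel_measurable (F t)" "H t \<in> borel_measurable M"
proof -
  show "H t \<in> borel_measurable (F t)" using assms unfolding continuous_adapted_def by blast
  from adapted_M[OF _ this] show "H t \<in> borel_measurable M" using assms(2) by simp
qed

lemma continuous_adapted_path:
  assumes "continuous_adapted M F T H" "\<omega> \<in> space M" "t \<le> T"
  shows "continuous_on {0..t} (\<lambda>s. H s \<omega>)"
proof (rule continuous_on_subset)
  show "continuous_on {0..T} (\<lambda>s. H s \<omega>)" using assms unfolding continuous_adapted_def by blast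
qed (use assms(3) in auto)

text \<open>Predictability on the grid: a weight enters the value on an interval only if its jump
  time is at most the left end; for all others the indicator is 0.\<close>

lemma simple_value_refines_adapted:
  assumes z: "refines t (m, \<tau>, \<xi>) n z" and \<kappa>: "\<kappa> < n"
    and \<tau>0: "\<And>i. i < m \<Longrightarrow> 0 \<le> \<tau> i" and \<xi>: "\<And>i. i < m \<Longrightarrow> \<xi> i \<in> borel_measurable (F (\<tau> i))"
  shows "simple_value (m, \<tau>, \<xi>) (z (Suc \<kappa>)) \<in> borel_measurable (F (z \<kappa>))"
proof -
  have "(\<lambda>\<omega>. \<xi> i \<omega> * indicator {\<tau> i<..\<tau> (Suc i)} (z (Suc \<kappa>))) \<in> borel_measurable (F (z \<kappa>))" if "i < m" for i
  proof (cases "\<tau> i < z (Suc \<kappa>)")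
    case True
    then have "\<tau> i \<le> z \<kappa>" using refines_jump(1)[OF z _ \<kappa>] that by simp
    then have "\<xi> i \<in> borel_measurable (F (z \<kappa>))" using adapted_mono[OF \<xi> \<tau>0] that by auto
    then show ?thesis by measurable
  qed simp
  then show ?thesis
    unfolding simple_value_def prod.case by (intro borel_measurable_sum) auto
qed

text \<open>On a grid containing the partition and the jumps, both increments are sums over the same
  Brownian increments, and the difference of the weights is predictable. The partition intervals are
  the blocks. The predictable sum is the squared \<open>L\<^sup>2\<close> distance of the two step
  functions, at most twice the sum of their squared distances to \<open>H\<close>. The threshold
  \<delta> is halved between these two and the factor 2 halves it again, whence
  \<open>\<delta>/4\<close>.\<close>

lemma simple_process_block_bound:
  assumes G: "simple_process M F G" and H: "continuous_adapted M F T H" and t: "t \<in> {0..T}"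
    and s: "is_partition t m s" and pos: "\<epsilon> > 0" "\<delta> > 0"
    and A[measurable]: "(\<lambda>\<omega>. LINT r:{0..T}|lborel. (simple_value G r \<omega> - H r \<omega>)\<^sup>2) \<in> borel_measurable M"
    and V[measurable]: "(\<lambda>\<omega>. LINT r:{0..t}|lborel. (simple_value (freeze m s H) r \<omega> - H r \<omega>)\<^sup>2) \<in> borel_measurable M"
  shows "prob {\<omega>\<in>space M. (\<Sum>p<m. (simple_integral W G (s (Suc p)) \<omega> - simple_integral W G (s p) \<omega>
            - H (s p) \<omega> * (W (s (Suc p)) \<omega> - W (s p) \<omega>))\<^sup>2) > \<epsilon>}
    \<le> prob {\<omega>\<in>space M. \<bar>LINT r:{0..T}|lborel. (simple_value G r \<omega> - H r \<omega>)\<^sup>2\<bar> > \<delta>/4}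
      + prob {\<omega>\<in>space M. \<bar>LINT r:{0..t}|lborel. (simple_value (freeze m s H) r \<omega> - H r \<omega>)\<^sup>2\<bar> > \<delta>/4}
      + \<delta> / \<epsilon>"
proof -
  obtain mG \<tau> \<xi> where Ge: "G = (mG, \<tau>, \<xi>)" by (cases G)
  let ?St = "freeze m s H"
  have \<tau>: "0 \<le> \<tau> 0" "\<And>i. i < mG \<Longrightarrow> \<tau> i \<le> \<tau> (Suc i)"
    and \<xi>: "\<And>i. i < mG \<Longrightarrow> \<xi> i \<in> borel_measurable (F (\<tau> i))"
    using G by (auto simp: simple_process_def Ge)
  have \<tau>0: "0 \<le> \<tau> i" if "i \<le> mG" for i
    using that
  proof (induction i)
    case (Suc i)
    then show ?case using \<tau>(2)[of i] by simp
  qed (use \<tau> in simp)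
  have smem: "s p \<in> {0..t}" if "p \<le> m" for p using is_partition_mem[OF s that] .
  note sle = is_partition_le[OF s]
  have sT: "s p \<in> {0..T}" if "p \<le> m" for p using smem[OF that] t by auto
  \<comment> \<open>Jumps after \<open>t\<close> are moved to \<open>t\<close>, the last grid
    point.\<close>
  define Z where "Z = s ` {..m} \<union> (\<lambda>l. min (\<tau> l) t) ` {..mG}"
  have Z: "finite Z" "Z \<subseteq> {0..t}" "0 \<in> Z" "t \<in> Z"
  proof -
    show "Z \<subseteq> {0..t}" using smem \<tau>0 t by (auto simp: Z_def)
    have "s 0 = 0" "s m = t" using s by (simp_all add: is_partition_def)
    moreover have "s 0 \<in> Z" "s m \<in> Z" by (simp_all add: Z_def)
    ultimately show "0 \<in> Z" "t \<in> Z" by simp_all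
  qed (simp add: Z_def)
  \<comment> \<open>Jump times and partition points may repeat or coincide; in the strictly
    increasing enumeration every grid interval has positive length.\<close>
  obtain n :: nat and z :: "nat \<Rightarrow> real" where z: "z 0 = 0" "z n = t" "strict_mono_on {..n} z" "z ` {..n} = Z"
    by (rule ex_increasing_enumeration[OF Z])
  have zle: "z i \<le> z i'" if "i \<le> i'" "i' \<le> n" for i i' using strict_mono_on_leD[OF z(3)] that by auto
  have z0: "0 \<le> z i" if "i \<le> n" for i using zle[of 0 i] z(1) that by simp
  have zt: "z i \<le> t" if "i \<le> n" for i using zle[of i n] z(2) that by simp
  have zlt: "z i < z (Suc i)" if "i < n" for i using strict_mono_onD[OF z(3), of i "Suc i"] that by simp
  have refG: "refines t G n z"
    using z \<tau> by (auto simp: refines_def Ge Z_def)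
  have refS: "refines t ?St n z"
    using z s smem by (auto simp: refines_def freeze_def Z_def is_partition_def min_absorb1)
  define \<eta> where "\<eta> \<kappa> \<omega> = simple_value G (z (Suc \<kappa>)) \<omega> - simple_value ?St (z (Suc \<kappa>)) \<omega>" for \<kappa> \<omega>
  define D where "D \<kappa> \<omega> = W (z (Suc \<kappa>)) \<omega> - W (z \<kappa>) \<omega>" for \<kappa> \<omega>
  \<comment> \<open>The grid intervals inside the partition interval \<open>p\<close>, selected by
    their right ends; there are none if the partition point is repeated.\<close>
  define I where "I p = {\<kappa>. \<kappa> < n \<and> s p < z (Suc \<kappa>) \<and> z (Suc \<kappa>) \<le> s (Suc p)}" for p
  have block: "simple_integral W G (s (Suc p)) \<omega> - simple_integral W G (s p) \<omega>
            - H (s p) \<omega> * (W (s (Suc p)) \<omega> - W (s p) \<omega>) = (\<Sum>\<kappa>\<in>I p. \<eta> \<kappa> \<omega> * D \<kappa> \<omega>)"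
    if "p < m" for p \<omega>
  proof -
    have mem: "s p \<in> z ` {..n}" "s (Suc p) \<in> z ` {..n}" "s p \<le> s (Suc p)"
      using that sle[of p "Suc p"] by (auto simp: z(4) Z_def)
    show ?thesis
      unfolding simple_integral_freeze_diff[OF s that, symmetric]
        simple_integral_diff_refines[OF refG mem] simple_integral_diff_refines[OF refS mem]
      by (simp add: \<eta>_def D_def I_def sum_subtractf left_diff_distrib)
  qed
  have "prob {\<omega>\<in>space M. (\<Sum>p<m. (simple_integral W G (s (Suc p)) \<omega> - simple_integral W G (s p) \<omega>
            - H (s p) \<omega> * (W (s (Suc p)) \<omega> - W (s p) \<omega>))\<^sup>2) > \<epsilon>}
     = prob {\<omega>\<in>space M. (\<Sum>p<m. (\<Sum>\<kappa>\<in>I p. \<eta> \<kappa> \<omega> * D \<kappa> \<omega>)\<^sup>2) > \<epsilon>}"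
    by (simp add: block)
  also have "\<dots> \<le> prob {\<omega>\<in>space M. (\<Sum>\<kappa><n. (\<eta> \<kappa> \<omega>)\<^sup>2 * (z (Suc \<kappa>) - z \<kappa>)) > \<delta>} + \<delta> / \<epsilon>"
  proof (rule prob_sum_blocks_le[where G="\<lambda>\<kappa>. F (z \<kappa>)"])
    show "subalgebra M (F (z \<kappa>))" if "\<kappa> \<le> n" for \<kappa> using subalg[OF z0[OF that]] .
    show "sets (F (z i)) \<subseteq> sets (F (z i'))" if "i \<le> i'" "i' \<le> n" for i i'
      using filtration_mono[OF z0 zle] that by auto
    show "\<eta> \<kappa> \<in> borel_measurable (F (z \<kappa>))" if "\<kappa> < n" for \<kappa>
    proof -
      have "simple_value G (z (Suc \<kappa>)) \<in> borel_measurable (F (z \<kappa>))"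
        unfolding Ge by (rule simple_value_refines_adapted[OF refG[unfolded Ge] that \<tau>0 \<xi>]) auto
      moreover have "simple_value ?St (z (Suc \<kappa>)) \<in> borel_measurable (F (z \<kappa>))"
        unfolding freeze_def
        by (rule simple_value_refines_adapted[OF refS[unfolded freeze_def] that])
          (use sT in \<open>auto intro!: continuous_adaptedD(1)[OF H]\<close>)
      ultimately show ?thesis unfolding \<eta>_def by measurable
    qed
    show "D \<kappa> \<in> borel_measurable (F (z (Suc \<kappa>)))" if "\<kappa> < n" for \<kappa>
    proof -
      have "0 \<le> z \<kappa>" "0 \<le> z (Suc \<kappa>)" using that z0 by auto
      then have "W (z (Suc \<kappa>)) \<in> borel_measurable (F (z (Suc \<kappa>)))" "W (z \<kappa>) \<in> borel_measurable (F (z (Suc \<kappa>)))"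
        using BM_adapted adapted_mono[OF BM_adapted _ less_imp_le[OF zlt[OF that]]] by blast+
      then show ?thesis unfolding D_def by measurable
    qed
    show "indep_set (sets (F (z \<kappa>))) {D \<kappa> -` B \<inter> space M |B. B \<in> sets borel}" if "\<kappa> < n" for \<kappa>
      using BM_increment_indep[of "z \<kappa>" "z (Suc \<kappa>)" "\<lambda>x. x"] z0[of \<kappa>] zlt[OF that] that by (simp add: D_def[abs_def])
    show "integrable M (\<lambda>\<omega>. (D \<kappa> \<omega>)\<^sup>2)" "expectation (D \<kappa>) = 0"
       "expectation (\<lambda>\<omega>. (D \<kappa> \<omega>)\<^sup>2) = z (Suc \<kappa>) - z \<kappa>" if "\<kappa> < n" for \<kappa>
      using BM_increment_moments[of "z \<kappa>" "z (Suc \<kappa>)"] z0[of \<kappa>] zlt[OF that] that by (simp_all add: D_def[abs_def])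
    show "D \<kappa> \<omega> = 0" if "\<kappa> < n" "z (Suc \<kappa>) - z \<kappa> = 0" for \<kappa> \<omega> using zlt[OF that(1)] that by simp
    show "I p \<subseteq> {..<n}" if "p < m" for p by (auto simp: I_def)
    show "disjoint_family_on I {..<m}"
    proof -
      have "I p \<inter> I p' = {}" if "p < p'" "p' < m" for p p'
        using sle[of "Suc p" p'] that by (auto simp: I_def)
      then show ?thesis unfolding disjoint_family_on_def by (metis Int_commute lessThan_iff linorder_neqE_nat)
    qed
  qed (use pos in auto)
  also have "prob {\<omega>\<in>space M. (\<Sum>\<kappa><n. (\<eta> \<kappa> \<omega>)\<^sup>2 * (z (Suc \<kappa>) - z \<kappa>)) > \<delta>}
     \<le> prob {\<omega>\<in>space M. \<bar>\<Sum>\<kappa><n. (\<eta> \<kappa> \<omega>)\<^sup>2 * (z (Suc \<kappa>) - z \<kappa>)\<bar> > \<delta>/2 + \<delta>/2}"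
  proof -
    have "(\<Sum>\<kappa><n. (\<eta> \<kappa> \<omega>)\<^sup>2 * (z (Suc \<kappa>) - z \<kappa>)) \<ge> 0" for \<omega>
      using zlt by (intro sum_nonneg mult_nonneg_nonneg) (auto intro: less_imp_le)
    then show ?thesis by (simp add: abs_of_nonneg)
  qed
  also have "\<dots> \<le> prob {\<omega>\<in>space M. \<bar>2 * (LINT r:{0..T}|lborel. (simple_value G r \<omega> - H r \<omega>)\<^sup>2)\<bar> > \<delta>/2}
      + prob {\<omega>\<in>space M. \<bar>2 * (LINT r:{0..t}|lborel. (simple_value ?St r \<omega> - H r \<omega>)\<^sup>2)\<bar> > \<delta>/2}"
  proof (rule prob_gt_add)
    show "AE \<omega> in M. \<bar>\<Sum>\<kappa><n. (\<eta> \<kappa> \<omega>)\<^sup>2 * (z (Suc \<kappa>) - z \<kappa>)\<bar>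
       \<le> \<bar>2 * (LINT r:{0..T}|lborel. (simple_value G r \<omega> - H r \<omega>)\<^sup>2)\<bar>
        + \<bar>2 * (LINT r:{0..t}|lborel. (simple_value ?St r \<omega> - H r \<omega>)\<^sup>2)\<bar>"
    proof (rule AE_I2)
      fix \<omega> assume \<omega>: "\<omega> \<in> space M"
      have HT: "continuous_on {0..T} (\<lambda>r. H r \<omega>)" by (rule continuous_adapted_path[OF H \<omega> order_refl])
      have Ht: "continuous_on {0..t} (\<lambda>r. H r \<omega>)" by (rule continuous_adapted_path[OF H \<omega>]) (use t in auto)
      have iA: "set_integrable lborel {0..T} (\<lambda>r. (simple_value G r \<omega> - H r \<omega>)\<^sup>2)"
        and iV: "set_integrable lborel {0..t} (\<lambda>r. (simple_value ?St r \<omega> - H r \<omega>)\<^sup>2)"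
        by (rule simple_value_diff_square_integrable[OF HT] simple_value_diff_square_integrable[OF Ht])+
      \<comment> \<open>The predictable sum is the integral of this step function, which on
        \<open>(0, t]\<close> is the squared difference of the two processes and vanishes elsewhere.
        The comparison with \<open>H\<close> can then be made pointwise.\<close>
      let ?step = "\<lambda>r. \<Sum>\<kappa><n. (\<eta> \<kappa> \<omega>)\<^sup>2 * indicator {z \<kappa><..z (Suc \<kappa>)} r"
      have step: "?step r = (if z 0 < r \<and> r \<le> z n then (simple_value G r \<omega> - simple_value ?St r \<omega>)\<^sup>2 else 0)" for r
      proof (rule sum_step_function[OF z(3)])
        show "(simple_value G r \<omega> - simple_value ?St r \<omega>)\<^sup>2 = (\<eta> i \<omega>)\<^sup>2"
          if "i < n" "z i < r" "r \<le> z (Suc i)" for i r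
          unfolding \<eta>_def simple_value_refines[OF refG that] simple_value_refines[OF refS that] ..
      qed
      have int1: "integrable lborel (\<lambda>r. (\<eta> \<kappa> \<omega>)\<^sup>2 * indicator {z \<kappa><..z (Suc \<kappa>)} r)" if "\<kappa> < n" for \<kappa>
        using zlt[OF that] by (simp add: emeasure_lborel_Ioc)
      have sq: "(a - b)\<^sup>2 \<le> 2 * (a - c)\<^sup>2 + 2 * (b - c)\<^sup>2" for a b c :: real
        using zero_le_power2[of "(a - c) + (b - c)"] by (simp add: power2_eq_square algebra_simps)
      have "(\<Sum>\<kappa><n. (\<eta> \<kappa> \<omega>)\<^sup>2 * (z (Suc \<kappa>) - z \<kappa>)) = (\<integral>r. ?step r \<partial>lborel)"
        using zlt int1 by (subst Bochner_Integration.integral_sum) (auto simp: less_imp_le intro!: sum.cong)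
      also have "\<dots> \<le> (\<integral>r. 2 * (indicator {0..T} r *\<^sub>R (simple_value G r \<omega> - H r \<omega>)\<^sup>2)
          + 2 * (indicator {0..t} r *\<^sub>R (simple_value ?St r \<omega> - H r \<omega>)\<^sup>2) \<partial>lborel)"
      proof (rule integral_mono)
        show "integrable lborel ?step" using int1 by (intro Bochner_Integration.integrable_sum) auto
        show "integrable lborel (\<lambda>r. 2 * (indicator {0..T} r *\<^sub>R (simple_value G r \<omega> - H r \<omega>)\<^sup>2)
          + 2 * (indicator {0..t} r *\<^sub>R (simple_value ?St r \<omega> - H r \<omega>)\<^sup>2))"
          using iA iV unfolding set_integrable_def
          by (intro Bochner_Integration.integrable_add integrable_mult_right) auto
        show "?step r \<le> 2 * (indicator {0..T} r *\<^sub>R (simple_value G r \<omega> - H r \<omega>)\<^sup>2)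
          + 2 * (indicator {0..t} r *\<^sub>R (simple_value ?St r \<omega> - H r \<omega>)\<^sup>2)" for r
          unfolding step using t z(1,2) sq[of "simple_value G r \<omega>" "simple_value ?St r \<omega>" "H r \<omega>"] by auto
      qed
      also have "\<dots> = 2 * (LINT r:{0..T}|lborel. (simple_value G r \<omega> - H r \<omega>)\<^sup>2)
        + 2 * (LINT r:{0..t}|lborel. (simple_value ?St r \<omega> - H r \<omega>)\<^sup>2)"
        using iA iV unfolding set_integrable_def set_lebesgue_integral_def
        by (subst Bochner_Integration.integral_add) auto
      finally have le: "(\<Sum>\<kappa><n. (\<eta> \<kappa> \<omega>)\<^sup>2 * (z (Suc \<kappa>) - z \<kappa>)) \<le> 2 * (LINT r:{0..T}|lborel. (simple_value G r \<omega> - H r \<omega>)\<^sup>2)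
        + 2 * (LINT r:{0..t}|lborel. (simple_value ?St r \<omega> - H r \<omega>)\<^sup>2)" .
      have "(\<Sum>\<kappa><n. (\<eta> \<kappa> \<omega>)\<^sup>2 * (z (Suc \<kappa>) - z \<kappa>)) \<ge> 0"
        using zlt by (intro sum_nonneg mult_nonneg_nonneg) (auto intro: less_imp_le)
      with le show "\<bar>\<Sum>\<kappa><n. (\<eta> \<kappa> \<omega>)\<^sup>2 * (z (Suc \<kappa>) - z \<kappa>)\<bar>
       \<le> \<bar>2 * (LINT r:{0..T}|lborel. (simple_value G r \<omega> - H r \<omega>)\<^sup>2)\<bar>
        + \<bar>2 * (LINT r:{0..t}|lborel. (simple_value ?St r \<omega> - H r \<omega>)\<^sup>2)\<bar>"
        by linarith
    qed
  qed measurable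
  finally show ?thesis by (simp add: abs_mult field_simps)
qed

lemma freeze_error_measurable:
  assumes H: "continuous_adapted M F T H" and t: "t \<in> {0..T}" and s: "is_partition t m s"
  shows "(\<lambda>\<omega>. LINT r:{0..t}|lborel. (simple_value (freeze m s H) r \<omega> - H r \<omega>)\<^sup>2) \<in> borel_measurable M"
proof -
  have HM: "H r \<in> borel_measurable M" if "r \<in> {0..t}" for r
    by (rule continuous_adaptedD(2)[OF H]) (use that t in auto)
  have Hc: "continuous_on {0..t} (\<lambda>r. H r \<omega>)" if "\<omega> \<in> space M" for \<omega>
    by (rule continuous_adapted_path[OF H that]) (use t in auto)
  have [measurable]: "H (s i) \<in> borel_measurable M" if "i < m" for i
    by (rule HM) (use is_partition_mem[OF s, of i] that in auto)
  have "(\<lambda>(\<omega>, r). simple_value (freeze m s H) r \<omega>) \<in> borel_measurable (M \<Otimes>\<^sub>M lborel)"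
    unfolding simple_value_def freeze_def prod.case split_beta
    by (intro borel_measurable_sum borel_measurable_times measurable_compose[OF measurable_fst]
        measurable_compose[OF measurable_snd]) auto
  then have "(\<lambda>(\<omega>, r). (indicator {0..t} r * simple_value (freeze m s H) r \<omega> - indicator {0..t} r * H r \<omega>)\<^sup>2)
      \<in> borel_measurable (M \<Otimes>\<^sub>M lborel)"
    using joint_borel_measurable_continuous[of 0 t H M, OF HM Hc] unfolding split_beta by measurable
  also have "(\<lambda>(\<omega>, r). (indicator {0..t} r * simple_value (freeze m s H) r \<omega> - indicator {0..t} r * H r \<omega>)\<^sup>2)
     = (\<lambda>(\<omega>, r). indicator {0..t} r *\<^sub>R (simple_value (freeze m s H) r \<omega> - H r \<omega>)\<^sup>2)"
    by (auto simp: indicator_def fun_eq_iff)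
  finally show ?thesis
    unfolding set_lebesgue_integral_def by (rule lborel.borel_measurable_lebesgue_integral)
qed

text \<open>At a fixed partition, \<open>X\<close> is replaced by an approximating elementary
  integral at finitely many times. The replacement error \<open>E n\<close> and the
  \<open>L\<^sup>2\<close> distance of the approximation to \<open>H\<close> both tend to 0 in
  probability, so that only the error of freezing survives. The inequality for the square of a sum
  costs a factor 2, and splitting the threshold in two equal parts another one, whence
  \<open>4 * \<epsilon>\<close>.\<close>

lemma ito_integral_block_bound:
  assumes ito: "is_ito_integral M F W T H X" and t: "t \<in> {0..T}"
    and s: "is_partition t m s" and pos: "\<epsilon> > 0" "\<delta> > 0"
  shows "prob {\<omega>\<in>space M. \<bar>\<Sum>p<m. (X (s (Suc p)) \<omega> - X (s p) \<omega>
            - H (s p) \<omega> * (W (s (Suc p)) \<omega> - W (s p) \<omega>))\<^sup>2\<bar> > 4 * \<epsilon>}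
    \<le> prob {\<omega>\<in>space M. \<bar>LINT r:{0..t}|lborel. (simple_value (freeze m s H) r \<omega> - H r \<omega>)\<^sup>2\<bar> > \<delta>/4}
      + \<delta> / \<epsilon>"
proof -
  have H: "continuous_adapted M F T H" and X: "continuous_adapted M F T X" using ito by (simp_all add: is_ito_integral_def)
  obtain G where *: "\<forall>n. simple_process M F (G n)"
      "conv_in_prob M (\<lambda>n \<omega>. LINT r:{0..T}|lborel. (simple_value (G n) r \<omega> - H r \<omega>)\<^sup>2) (\<lambda>\<omega>. 0)"
      "\<forall>t\<in>{0..T}. conv_in_prob M (\<lambda>n. simple_integral W (G n) t) (X t)"
    using ito unfolding is_ito_integral_def by (elim conjE exE) (rule that; assumption)
  note G = *(1)[rule_format] and A = *(2) and SI = *(3)[rule_format]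
  have sT: "s p \<in> {0..T}" if "p \<le> m" for p using is_partition_mem[OF s that] t by auto
  have [measurable]: "simple_integral W (G n) (s p) \<in> borel_measurable M" "X (s p) \<in> borel_measurable M"
      "H (s p) \<in> borel_measurable M" "W (s p) \<in> borel_measurable M" if "p \<le> m" for n p
  proof -
    show "simple_integral W (G n) (s p) \<in> borel_measurable M"
      using SI[OF sT[OF that]] unfolding conv_in_prob_def by blast
    show "X (s p) \<in> borel_measurable M" "H (s p) \<in> borel_measurable M"
      by (rule continuous_adaptedD(2)[OF X sT[OF that]] continuous_adaptedD(2)[OF H sT[OF that]])+
    show "W (s p) \<in> borel_measurable M" by (rule BM_measurable) (use sT[OF that] in auto)
  qed
  have 0: "conv_in_prob M (\<lambda>n \<omega>. simple_integral W (G n) (s p) \<omega> - X (s p) \<omega>) (\<lambda>_. 0)" if "p \<le> m" for p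
    using SI[OF sT[OF that]] that by (subst conv_in_prob_diff_iff[symmetric]) auto
  define E where "E n \<omega> = (\<Sum>p<m. ((simple_integral W (G n) (s (Suc p)) \<omega> - X (s (Suc p)) \<omega>)
        + (-1) * (simple_integral W (G n) (s p) \<omega> - X (s p) \<omega>))\<^sup>2)" for n \<omega>
  have E: "conv_in_prob M E (\<lambda>_. 0)"
    unfolding E_def[abs_def]
    by (intro conv_in_prob_0_sum conv_in_prob_0_square conv_in_prob_0_add conv_in_prob_0_scale 0) auto
  have [measurable]: "E n \<in> borel_measurable M" for n using conv_in_prob_0D(1)[OF E] .
  define S where "S n \<omega> = (\<Sum>p<m. (simple_integral W (G n) (s (Suc p)) \<omega> - simple_integral W (G n) (s p) \<omega>
            - H (s p) \<omega> * (W (s (Suc p)) \<omega> - W (s p) \<omega>))\<^sup>2)" for n \<omega>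
  have [measurable]: "S n \<in> borel_measurable M" for n unfolding S_def by measurable
  let ?A = "\<lambda>n. prob {\<omega>\<in>space M. \<bar>LINT r:{0..T}|lborel. (simple_value (G n) r \<omega> - H r \<omega>)\<^sup>2\<bar> > \<delta>/4}"
  let ?V = "prob {\<omega>\<in>space M. \<bar>LINT r:{0..t}|lborel. (simple_value (freeze m s H) r \<omega> - H r \<omega>)\<^sup>2\<bar> > \<delta>/4}"
  let ?E = "\<lambda>n. prob {\<omega>\<in>space M. \<bar>E n \<omega>\<bar> > \<epsilon>}"
  let ?L = "prob {\<omega>\<in>space M. \<bar>\<Sum>p<m. (X (s (Suc p)) \<omega> - X (s p) \<omega>
            - H (s p) \<omega> * (W (s (Suc p)) \<omega> - W (s p) \<omega>))\<^sup>2\<bar> > 4 * \<epsilon>}"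
  have "?L \<le> ?E n + (?A n + ?V + \<delta> / \<epsilon>)" for n
  proof -
    have "?L = prob {\<omega>\<in>space M. \<bar>\<Sum>p<m. (X (s (Suc p)) \<omega> - X (s p) \<omega>
            - H (s p) \<omega> * (W (s (Suc p)) \<omega> - W (s p) \<omega>))\<^sup>2\<bar> > 2 * \<epsilon> + 2 * \<epsilon>}" by simp
    also have "\<dots> \<le> prob {\<omega>\<in>space M. \<bar>2 * E n \<omega>\<bar> > 2 * \<epsilon>} + prob {\<omega>\<in>space M. \<bar>2 * S n \<omega>\<bar> > 2 * \<epsilon>}"
    proof (rule prob_gt_add)
      have sq: "(x - x' - w)\<^sup>2 \<le> 2 * ((i - x) + (-1) * (i' - x'))\<^sup>2 + 2 * (i - i' - w)\<^sup>2" for x x' i i' w :: real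
        using zero_le_power2[of "((i - x) + (-1) * (i' - x')) + (i - i' - w)"]
        by (simp add: power2_eq_square algebra_simps)
      let ?e = "\<lambda>\<omega>. \<Sum>p<m. (X (s (Suc p)) \<omega> - X (s p) \<omega> - H (s p) \<omega> * (W (s (Suc p)) \<omega> - W (s p) \<omega>))\<^sup>2"
      have le: "?e \<omega> \<le> 2 * E n \<omega> + 2 * S n \<omega>" for \<omega>
        unfolding E_def S_def sum_distrib_left sum.distrib[symmetric] by (rule sum_mono) (rule sq)
      have nn: "?e \<omega> \<ge> 0" for \<omega> by (intro sum_nonneg) auto
      show "AE \<omega> in M. \<bar>?e \<omega>\<bar> \<le> \<bar>2 * E n \<omega>\<bar> + \<bar>2 * S n \<omega>\<bar>"
      proof (rule AE_I2)
        show "\<bar>?e \<omega>\<bar> \<le> \<bar>2 * E n \<omega>\<bar> + \<bar>2 * S n \<omega>\<bar>" for \<omega>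
          using le[of \<omega>] nn[of \<omega>] by linarith
      qed
    qed measurable
    also have "prob {\<omega>\<in>space M. \<bar>2 * E n \<omega>\<bar> > 2 * \<epsilon>} = ?E n" by (simp add: abs_mult)
    also have "prob {\<omega>\<in>space M. \<bar>2 * S n \<omega>\<bar> > 2 * \<epsilon>} = prob {\<omega>\<in>space M. S n \<omega> > \<epsilon>}"
    proof -
      have "S n \<omega> \<ge> 0" for \<omega> unfolding S_def by (intro sum_nonneg) auto
      then show ?thesis by (simp add: abs_mult abs_of_nonneg)
    qed
    also have "\<dots> \<le> ?A n + ?V + \<delta> / \<epsilon>"
      unfolding S_def
      by (rule simple_process_block_bound[OF G H t s pos conv_in_prob_0D(1)[OF A] freeze_error_measurable[OF H t s]])
    finally show ?thesis by simp
  qed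
  \<comment> \<open>The left-hand side \<open>?L\<close> and the freezing term \<open>?V\<close> do
    not depend on \<open>n\<close>, so the limit can be taken in the inequality.\<close>
  moreover have "(\<lambda>n. ?E n + (?A n + ?V + \<delta> / \<epsilon>)) \<longlonglongrightarrow> 0 + (0 + ?V + \<delta> / \<epsilon>)"
    using pos by (intro tendsto_add tendsto_const conv_in_prob_0D(2)[OF E] conv_in_prob_0D(2)[OF A]) auto
  ultimately have "?L \<le> 0 + (0 + ?V + \<delta> / \<epsilon>)" by (intro LIMSEQ_le_const) auto
  then show ?thesis by simp
qed

end

section \<open>Quadratic variation of Ito processes\<close>

lemma is_partition_cell:
  assumes s: "is_partition t m s" and r: "0 < r" "r \<le> t"
  obtains p where "p < m" "s p < r" "r \<le> s (Suc p)"
proof -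
  have s0: "s 0 = 0" and sm: "s m = t" using s by (simp_all add: is_partition_def)
  define k where "k = (LEAST k. r \<le> s k)"
  have k: "r \<le> s k" unfolding k_def by (rule LeastI[of _ m]) (simp add: sm r)
  have "k \<le> m" unfolding k_def by (rule Least_le) (simp add: sm r)
  obtain p where p: "k = Suc p" using k s0 r by (cases k) auto
  have "\<not> r \<le> s p" using not_less_Least[of p "\<lambda>k. r \<le> s k"] p by (simp add: k_def)
  then show ?thesis using that[of p] k \<open>k \<le> m\<close> p by simp
qed

lemma simple_value_freeze:
  assumes s: "is_partition t m s" and p: "p < m" "s p < r" "r \<le> s (Suc p)"
  shows "simple_value (freeze m s H) r \<omega> = H (s p) \<omega>"
proof -
  have "simple_value (freeze m s H) r \<omega> = (\<Sum>i<m. if i = p then H (s p) \<omega> else 0)"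
    unfolding simple_value_def freeze_def prod.case
  proof (intro sum.cong refl)
    fix i assume "i \<in> {..<m}"
    then show "H (s i) \<omega> * indicator {s i<..s (Suc i)} r = (if i = p then H (s p) \<omega> else 0)"
      using is_partition_le[OF s, of "Suc i" p] is_partition_le[OF s, of "Suc p" i] p
      by (cases i p rule: linorder_cases) (auto simp: indicator_def)
  qed
  then show ?thesis using p(1) by simp
qed

lemma freeze_uniformly_close:
  assumes H: "continuous_on {0..t} (\<lambda>r. H r \<omega>)"
    and sP: "\<forall>n. is_partition t (m n) (s n)"
    and mesh: "\<forall>\<delta>>0. \<forall>\<^sub>F n in sequentially. \<forall>i<m n. s n (Suc i) - s n i < \<delta>"
    and e: "e > 0"
  shows "\<forall>\<^sub>F n in sequentially. \<forall>r. 0 < r \<and> r \<le> t \<longrightarrow> \<bar>simple_value (freeze (m n) (s n) H) r \<omega> - H r \<omega>\<bar> < e"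
proof -
  note s = sP[rule_format]
  have "uniformly_continuous_on {0..t} (\<lambda>r. H r \<omega>)"
    by (rule compact_uniformly_continuous[OF H compact_Icc])
  then obtain d where d: "d > 0"
      "\<And>x x'. x \<in> {0..t} \<Longrightarrow> x' \<in> {0..t} \<Longrightarrow> dist x' x < d \<Longrightarrow> dist (H x' \<omega>) (H x \<omega>) < e"
    unfolding uniformly_continuous_on_def using e by meson
  from mesh[rule_format, OF d(1)] show ?thesis
  proof eventually_elim
    case (elim n)
    show ?case
    proof (intro allI impI, elim conjE)
      fix r assume r: "0 < r" "r \<le> t"
      obtain p where p: "p < m n" "s n p < r" "r \<le> s n (Suc p)"
        by (rule is_partition_cell[OF s r])
      have "s n p \<in> {0..t}" using is_partition_mem[OF s, of p n] p by simp
      moreover have "dist (s n p) r < d" using elim[rule_format, OF p(1)] p by (simp add: dist_real_def)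
      ultimately have "dist (H (s n p) \<omega>) (H r \<omega>) < e" using r by (intro d(2)) auto
      then show "\<bar>simple_value (freeze (m n) (s n) H) r \<omega> - H r \<omega>\<bar> < e"
        by (simp add: simple_value_freeze[OF s p] dist_real_def)
    qed
  qed
qed

lemma integral_le_const_Icc:
  fixes f :: "real \<Rightarrow> real"
  assumes f: "set_integrable lborel {0..t} f" and le: "\<And>r. 0 < r \<Longrightarrow> r \<le> t \<Longrightarrow> f r \<le> c" and t: "0 \<le> t"
  shows "(LINT r:{0..t}|lborel. f r) \<le> c * t"
proof -
  have "(\<integral>r. indicator {0..t} r *\<^sub>R f r \<partial>lborel) \<le> (\<integral>r. c * indicator {0..t} r \<partial>lborel)"
  proof (rule integral_mono_AE)
    show "integrable lborel (\<lambda>r. indicator {0..t} r *\<^sub>R f r)" using f by (simp add: set_integrable_def)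
    show "AE r in lborel. indicator {0..t} r *\<^sub>R f r \<le> c * indicator {0..t} r"
      using AE_lborel_singleton[of 0] by eventually_elim (use le in \<open>auto simp: indicator_def\<close>)
  qed (simp add: emeasure_lborel_Icc_eq)
  then show ?thesis using t by (simp add: set_lebesgue_integral_def)
qed

lemma freeze_error_tendsto_0:
  assumes H: "continuous_on {0..t} (\<lambda>r. H r \<omega>)"
    and sP: "\<forall>n. is_partition t (m n) (s n)"
    and mesh: "\<forall>\<delta>>0. \<forall>\<^sub>F n in sequentially. \<forall>i<m n. s n (Suc i) - s n i < \<delta>"
    and t: "0 \<le> t"
  shows "(\<lambda>n. LINT r:{0..t}|lborel. (simple_value (freeze (m n) (s n) H) r \<omega> - H r \<omega>)\<^sup>2) \<longlonglongrightarrow> 0"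
proof (rule tendstoI)
  note s = sP[rule_format]
  fix e :: real assume e: "e > 0"
  \<comment> \<open>The summand 1 covers \<open>t = 0\<close> and makes the final inequality
    \<open>e'\<^sup>2 * t < e\<close> strict.\<close>
  define e' where "e' = sqrt (e / (t + 1))"
  have e': "e' > 0" "e'\<^sup>2 = e / (t + 1)" using e t by (simp_all add: e'_def)
  from freeze_uniformly_close[where H=H and s=s and m=m and t=t and \<omega>=\<omega>, OF H sP mesh e'(1)]
  show "\<forall>\<^sub>F n in sequentially. dist (LINT r:{0..t}|lborel. (simple_value (freeze (m n) (s n) H) r \<omega> - H r \<omega>)\<^sup>2) 0 < e"
  proof eventually_elim
    case (elim n)
    let ?V = "LINT r:{0..t}|lborel. (simple_value (freeze (m n) (s n) H) r \<omega> - H r \<omega>)\<^sup>2"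
    have "?V \<le> e'\<^sup>2 * t"
    proof (rule integral_le_const_Icc[OF simple_value_diff_square_integrable[OF H] _ t])
      fix r assume "0 < r" "r \<le> t"
      then have "\<bar>simple_value (freeze (m n) (s n) H) r \<omega> - H r \<omega>\<bar> \<le> e'" using elim by (simp add: less_imp_le)
      from power_mono[OF this, of 2] show "(simple_value (freeze (m n) (s n) H) r \<omega> - H r \<omega>)\<^sup>2 \<le> e'\<^sup>2" by simp
    qed
    also have "\<dots> < e" using e t by (simp add: e'(2) field_simps)
    finally have "?V < e" .
    moreover have "?V \<ge> 0" unfolding set_lebesgue_integral_def by (intro integral_nonneg_AE AE_I2) auto
    ultimately show ?case by simp
  qed
qed

lemma riemann_sum_tendsto:
  fixes h :: "real \<Rightarrow> real"
  assumes h: "continuous_on {0..t} h"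
    and sP: "\<forall>n. is_partition t (m n) (s n)"
    and mesh: "\<forall>\<delta>>0. \<forall>\<^sub>F n in sequentially. \<forall>i<m n. s n (Suc i) - s n i < \<delta>"
    and t: "0 \<le> t"
  shows "(\<lambda>n. \<Sum>i<m n. h (s n i) * (s n (Suc i) - s n i)) \<longlonglongrightarrow> (LINT r:{0..t}|lborel. h r)"
proof (rule tendstoI)
  note s = sP[rule_format]
  fix e :: real assume e: "e > 0"
  define e' where "e' = e / (t + 1)"
  have e': "e' > 0" using e t by (simp add: e'_def)
  define H where "H r = (\<lambda>_::unit. h r)" for r
  have "continuous_on {0..t} (\<lambda>r. H r ())" using h by (simp add: H_def)
  from freeze_uniformly_close[where H=H and s=s and m=m and t=t and \<omega>="()", OF this sP mesh e']
  show "\<forall>\<^sub>F n in sequentially. dist (\<Sum>i<m n. h (s n i) * (s n (Suc i) - s n i)) (LINT r:{0..t}|lborel. h r) < e"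
  proof eventually_elim
    case (elim n)
    let ?v = "\<lambda>r. simple_value (freeze (m n) (s n) H) r ()"
    have sle: "s n i \<le> s n (Suc i)" if "i < m n" for i using is_partition_le[OF s, of i "Suc i" n] that by simp
    have mem: "s n i \<in> {0..t}" if "i \<le> m n" for i by (rule is_partition_mem[OF s that])
    have hi: "set_integrable lborel {0..t} h" by (rule borel_integrable_atLeastAtMost'[OF h])
    have ind: "integrable lborel (\<lambda>r. h (s n i) * indicator {s n i<..s n (Suc i)} r)" if "i < m n" for i
      using sle[OF that] by (simp add: emeasure_lborel_Ioc)
    have vi: "indicator {0..t} r *\<^sub>R ?v r = (\<Sum>i<m n. h (s n i) * indicator {s n i<..s n (Suc i)} r)" for r
    proof (cases "r \<in> {0..t}")
      case False
      then have "r \<notin> {s n i<..s n (Suc i)}" if "i < m n" for i using mem[of i] mem[of "Suc i"] that by auto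
      then show ?thesis using False by (auto intro!: sum.neutral[symmetric])
    qed (simp add: simple_value_def freeze_def H_def)
    have vint: "set_integrable lborel {0..t} ?v"
      unfolding set_integrable_def vi using ind by (intro Bochner_Integration.integrable_sum) auto
    have sum_eq: "(LINT r:{0..t}|lborel. ?v r) = (\<Sum>i<m n. h (s n i) * (s n (Suc i) - s n i))"
      unfolding set_lebesgue_integral_def vi
      using ind sle by (subst Bochner_Integration.integral_sum) (auto intro!: sum.cong)
    have d: "set_integrable lborel {0..t} (\<lambda>r. ?v r - h r)" "set_integrable lborel {0..t} (\<lambda>r. h r - ?v r)"
      using set_integral_diff(1)[OF vint hi] set_integral_diff(1)[OF hi vint] by auto
    have "\<bar>?v r - h r\<bar> < e'" if "0 < r" "r \<le> t" for r
      using elim that by (simp add: H_def)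
    then have b: "?v r - h r \<le> e'" "h r - ?v r \<le> e'" if "0 < r" "r \<le> t" for r
      using that by (fastforce simp: abs_less_iff)+
    have "(LINT r:{0..t}|lborel. ?v r - h r) \<le> e' * t" "(LINT r:{0..t}|lborel. h r - ?v r) \<le> e' * t"
      by (rule integral_le_const_Icc[OF d(1) b(1) t] integral_le_const_Icc[OF d(2) b(2) t]; assumption)+
    then have "\<bar>(LINT r:{0..t}|lborel. ?v r) - (LINT r:{0..t}|lborel. h r)\<bar> \<le> e' * t"
      using set_integral_diff(2)[OF vint hi] set_integral_diff(2)[OF hi vint] by (simp add: abs_le_iff)
    also have "\<dots> < e" using e t by (simp add: e'_def field_simps)
    finally show ?case by (simp add: sum_eq dist_real_def)
  qed
qed

lemma abs_less_square_iff: "\<bar>x\<bar> < \<bar>y\<bar> \<longleftrightarrow> x\<^sup>2 < y\<^sup>2" for x y :: real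
  by (meson abs_le_square_iff not_le)

context brownian_motion begin

text \<open>The centred squares of the increments are orthogonal. With the weights
  \<open>H\<^sup>2\<close> their predictable sum is \<open>U\<close>, and along a path with
  \<open>H\<close> bounded by \<open>C\<close> it is at most \<open>2 * C ^ 4 * t\<close> times the
  mesh. The Lenglart inequality converts this pathwise smallness into smallness in
  probability.\<close>

lemma sum_weighted_squares_conv:
  assumes H: "continuous_adapted M F T H" and t: "t \<in> {0..T}"
    and sP: "\<forall>n. is_partition t (m n) (s n)"
    and mesh: "\<forall>\<delta>>0. \<forall>\<^sub>F n in sequentially. \<forall>i<m n. s n (Suc i) - s n i < \<delta>"
  shows "conv_in_prob M (\<lambda>n \<omega>. \<Sum>i<m n. (H (s n i) \<omega>)\<^sup>2 *
     ((W (s n (Suc i)) \<omega> - W (s n i) \<omega>)\<^sup>2 - (s n (Suc i) - s n i))) (\<lambda>_. 0)"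
proof (rule conv_in_prob_0I)
  note s = sP[rule_format]
  have mem: "s n i \<in> {0..t}" if "i \<le> m n" for n i by (rule is_partition_mem[OF s that])
  have memT: "s n i \<in> {0..T}" if "i \<le> m n" for n i using mem[OF that] t by auto
  have sle: "s n i \<le> s n i'" if "i \<le> i'" "i' \<le> m n" for n i i' by (rule is_partition_le[OF s that])
  have s0: "0 \<le> s n i" if "i \<le> m n" for n i using mem[OF that] by simp
  have [measurable]: "H (s n i) \<in> borel_measurable M" "W (s n i) \<in> borel_measurable M" if "i \<le> m n" for n i
    by (rule continuous_adaptedD(2)[OF H memT[OF that]] BM_measurable[OF s0[OF that]])+
  show "(\<lambda>\<omega>. \<Sum>i<m n. (H (s n i) \<omega>)\<^sup>2 *
     ((W (s n (Suc i)) \<omega> - W (s n i) \<omega>)\<^sup>2 - (s n (Suc i) - s n i))) \<in> borel_measurable M" for n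
    by measurable
  define U where "U n \<omega> = (\<Sum>i<m n. ((H (s n i) \<omega>)\<^sup>2)\<^sup>2 * (2 * (s n (Suc i) - s n i)\<^sup>2))" for n \<omega>
  have U: "conv_in_prob M U (\<lambda>_. 0)"
  proof (rule AE_tendsto_imp_conv_in_prob_0)
    show "U n \<in> borel_measurable M" for n unfolding U_def[abs_def] by measurable
    show "AE \<omega> in M. (\<lambda>n. U n \<omega>) \<longlonglongrightarrow> 0"
    proof (rule AE_I2)
      fix \<omega> assume \<omega>: "\<omega> \<in> space M"
      obtain C where C: "C \<ge> 0" "\<And>r. r \<in> {0..t} \<Longrightarrow> \<bar>H r \<omega>\<bar> \<le> C"
        by (rule continuous_on_Icc_bounded[OF continuous_adapted_path[OF H \<omega>, of t]]) (use t in auto)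
      show "(\<lambda>n. U n \<omega>) \<longlonglongrightarrow> 0"
      proof (rule tendstoI)
        fix e :: real assume e: "e > 0"
        define d where "d = e / (2 * C ^ 4 * t + 1)"
        have den: "2 * C ^ 4 * t + 1 > 0" using C t by (intro add_nonneg_pos mult_nonneg_nonneg) auto
        have d: "d > 0" using e den by (simp add: d_def)
        from mesh[rule_format, OF d] show "\<forall>\<^sub>F n in sequentially. dist (U n \<omega>) 0 < e"
        proof eventually_elim
          case (elim n)
          have "U n \<omega> \<le> (\<Sum>i<m n. 2 * C ^ 4 * d * (s n (Suc i) - s n i))"
            unfolding U_def
          proof (rule sum_mono)
            fix i assume "i \<in> {..<m n}"
            then have i: "i < m n" by simp
            have "((H (s n i) \<omega>)\<^sup>2)\<^sup>2 = \<bar>H (s n i) \<omega>\<bar> ^ 4" by simp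
            also have "\<dots> \<le> C ^ 4" using C(2)[OF mem] i by (intro power_mono) auto
            finally have 1: "((H (s n i) \<omega>)\<^sup>2)\<^sup>2 \<le> C ^ 4" .
            have 2: "2 * (s n (Suc i) - s n i)\<^sup>2 \<le> 2 * (d * (s n (Suc i) - s n i))"
              unfolding power2_eq_square using elim[rule_format, OF i] sle[of i "Suc i" n] i
              by (intro mult_left_mono mult_right_mono) auto
            have "((H (s n i) \<omega>)\<^sup>2)\<^sup>2 * (2 * (s n (Suc i) - s n i)\<^sup>2) \<le> C ^ 4 * (2 * (d * (s n (Suc i) - s n i)))"
              using 1 2 C by (intro mult_mono) auto
            then show "((H (s n i) \<omega>)\<^sup>2)\<^sup>2 * (2 * (s n (Suc i) - s n i)\<^sup>2) \<le> 2 * C ^ 4 * d * (s n (Suc i) - s n i)"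
              by (simp only: mult.assoc mult.left_commute[of "C ^ 4" 2])
          qed
          also have "\<dots> = 2 * C ^ 4 * d * (\<Sum>i<m n. s n (Suc i) - s n i)" by (simp add: sum_distrib_left)
          also have "(\<Sum>i<m n. s n (Suc i) - s n i) = t"
            using s[of n] by (simp add: sum_lessThan_telescope is_partition_def)
          also have "2 * C ^ 4 * d * t = d * (2 * C ^ 4 * t)" by simp
          also have "\<dots> < d * (2 * C ^ 4 * t + 1)" using d by (intro mult_strict_left_mono) auto
          also have "\<dots> = e" using den by (simp add: d_def)
          finally have "U n \<omega> < e" .
          moreover have "U n \<omega> \<ge> 0" unfolding U_def by (intro sum_nonneg) auto
          ultimately show ?case by simp
        qed
      qed
    qed
  qed
  fix \<epsilon> \<eta> :: real assume pos: "\<epsilon> > 0" "\<eta> > 0"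
  \<comment> \<open>The sum itself, not its terms, is squared in the Lenglart bound, so the
    threshold there is \<open>\<epsilon>\<^sup>2\<close>; this \<delta> spends half of \<eta> on the
    quotient.\<close>
  define \<delta> where "\<delta> = \<epsilon>\<^sup>2 * (\<eta> / 2)"
  have \<delta>: "\<delta> > 0" "\<delta> / \<epsilon>\<^sup>2 = \<eta> / 2" using pos by (simp_all add: \<delta>_def)
  have "\<forall>\<^sub>F n in sequentially. prob {\<omega>\<in>space M. \<bar>U n \<omega>\<bar> > \<delta>} < \<eta> / 2"
    by (rule conv_in_prob_0D(3)[OF U \<delta>(1)]) (use pos in auto)
  then show "\<forall>\<^sub>F n in sequentially. prob {\<omega>\<in>space M. \<bar>\<Sum>i<m n. (H (s n i) \<omega>)\<^sup>2 *
     ((W (s n (Suc i)) \<omega> - W (s n i) \<omega>)\<^sup>2 - (s n (Suc i) - s n i))\<bar> > \<epsilon>} < \<eta>"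
  proof eventually_elim
    case (elim n)
    define D where "D i \<omega> = (W (s n (Suc i)) \<omega> - W (s n i) \<omega>)\<^sup>2 - (s n (Suc i) - s n i)" for i \<omega>
    \<comment> \<open>One block containing the whole partition.\<close>
    have le: "prob {\<omega>\<in>space M. (\<Sum>p<1::nat. (\<Sum>i\<in>{..<m n}. (H (s n i) \<omega>)\<^sup>2 * D i \<omega>)\<^sup>2) > \<epsilon>\<^sup>2}
      \<le> prob {\<omega>\<in>space M. (\<Sum>i<m n. ((H (s n i) \<omega>)\<^sup>2)\<^sup>2 * (2 * (s n (Suc i) - s n i)\<^sup>2)) > \<delta>} + \<delta> / \<epsilon>\<^sup>2"
    proof (rule prob_sum_blocks_le[where G="\<lambda>i. F (s n i)" and I="\<lambda>_. {..<m n}"])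
      show "subalgebra M (F (s n i))" if "i \<le> m n" for i by (rule subalg[OF s0[OF that]])
      show "sets (F (s n i)) \<subseteq> sets (F (s n i'))" if "i \<le> i'" "i' \<le> m n" for i i'
        using filtration_mono[OF s0 sle] that by auto
      show "(\<lambda>\<omega>. (H (s n i) \<omega>)\<^sup>2) \<in> borel_measurable (F (s n i))" if "i < m n" for i
      proof -
        have [measurable]: "H (s n i) \<in> borel_measurable (F (s n i))"
          by (rule continuous_adaptedD(1)[OF H memT]) (use that in auto)
        show ?thesis by measurable
      qed
      have W: "W (s n i) \<in> borel_measurable (F (s n (Suc i)))" "W (s n (Suc i)) \<in> borel_measurable (F (s n (Suc i)))"
        if "i < m n" for i
      proof -
        have *: "0 \<le> s n i" "0 \<le> s n (Suc i)" "s n i \<le> s n (Suc i)"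
          using s0[of i n] s0[of "Suc i" n] sle[of i "Suc i" n] that by auto
        show "W (s n i) \<in> borel_measurable (F (s n (Suc i)))" by (rule adapted_mono[OF BM_adapted[OF *(1)] *(1,3)])
        show "W (s n (Suc i)) \<in> borel_measurable (F (s n (Suc i)))" by (rule BM_adapted[OF *(2)])
      qed
      show "D i \<in> borel_measurable (F (s n (Suc i)))" if "i < m n" for i
        using W[OF that] unfolding D_def[abs_def] by measurable
      show "indep_set (sets (F (s n i))) {D i -` B \<inter> space M |B. B \<in> sets borel}" if "i < m n" for i
        using BM_increment_indep[of "s n i" "s n (Suc i)" "\<lambda>x. x\<^sup>2 - (s n (Suc i) - s n i)"]
          s0[of i n] sle[of i "Suc i" n] that by (simp add: D_def[abs_def])
      show "integrable M (\<lambda>\<omega>. (D i \<omega>)\<^sup>2)" "expectation (D i) = 0"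
        "expectation (\<lambda>\<omega>. (D i \<omega>)\<^sup>2) = 2 * (s n (Suc i) - s n i)\<^sup>2" if "i < m n" for i
        unfolding D_def[abs_def] using s0[of i n] sle[of i "Suc i" n] that
        by (intro BM_increment_moments(4-6); simp)+
      show "D i \<omega> = 0" if "i < m n" "2 * (s n (Suc i) - s n i)\<^sup>2 = 0" for i \<omega>
        using that by (simp add: D_def)
    qed (use pos \<delta> in \<open>auto simp: disjoint_family_on_def\<close>)
    have eq: "(\<Sum>p<1::nat. (\<Sum>i\<in>{..<m n}. (H (s n i) \<omega>)\<^sup>2 * D i \<omega>)\<^sup>2) > \<epsilon>\<^sup>2 \<longleftrightarrow>
        \<bar>\<Sum>i<m n. (H (s n i) \<omega>)\<^sup>2 * D i \<omega>\<bar> > \<epsilon>" for \<omega>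
      using abs_less_square_iff[of \<epsilon> "\<Sum>i<m n. (H (s n i) \<omega>)\<^sup>2 * D i \<omega>"] pos by simp
    have "prob {\<omega>\<in>space M. (\<Sum>i<m n. ((H (s n i) \<omega>)\<^sup>2)\<^sup>2 * (2 * (s n (Suc i) - s n i)\<^sup>2)) > \<delta>}
        = prob {\<omega>\<in>space M. \<bar>U n \<omega>\<bar> > \<delta>}"
    proof -
      have "U n \<omega> \<ge> 0" for \<omega> unfolding U_def by (intro sum_nonneg) auto
      then show ?thesis unfolding U_def[symmetric] by (simp only: abs_of_nonneg)
    qed
    then have "prob {\<omega>\<in>space M. \<bar>\<Sum>i<m n. (H (s n i) \<omega>)\<^sup>2 * D i \<omega>\<bar> > \<epsilon>} < \<eta>"
      using le elim \<delta>(2) unfolding eq by linarith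
    then show ?case by (simp add: D_def)
  qed
qed

text \<open>The block bound is applied with \<open>\<epsilon> / 4\<close>. The parameter \<delta> is
  fixed so that the quotient equals \<open>\<eta> / 2\<close>; the mesh is refined afterwards, until
  the freezing error exceeds \<open>\<delta> / 4\<close> with probability below
  \<open>\<eta> / 2\<close>.\<close>

lemma ito_integral_blocks_conv:
  assumes ito: "is_ito_integral M F W T H X" and t: "t \<in> {0..T}"
    and sP: "\<forall>n. is_partition t (m n) (s n)"
    and mesh: "\<forall>\<delta>>0. \<forall>\<^sub>F n in sequentially. \<forall>i<m n. s n (Suc i) - s n i < \<delta>"
  shows "conv_in_prob M (\<lambda>n \<omega>. \<Sum>p<m n. (X (s n (Suc p)) \<omega> - X (s n p) \<omega>
            - H (s n p) \<omega> * (W (s n (Suc p)) \<omega> - W (s n p) \<omega>))\<^sup>2) (\<lambda>_. 0)"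
proof (rule conv_in_prob_0I)
  note s = sP[rule_format]
  have H: "continuous_adapted M F T H" and X: "continuous_adapted M F T X"
    using ito by (simp_all add: is_ito_integral_def)
  have mem: "s n i \<in> {0..T}" if "i \<le> m n" for n i using is_partition_mem[OF s that] t by auto
  have [measurable]: "H (s n i) \<in> borel_measurable M" "X (s n i) \<in> borel_measurable M"
      "W (s n i) \<in> borel_measurable M" if "i \<le> m n" for n i
  proof -
    show "H (s n i) \<in> borel_measurable M" "X (s n i) \<in> borel_measurable M"
      by (rule continuous_adaptedD(2)[OF H mem[OF that]] continuous_adaptedD(2)[OF X mem[OF that]])+
    show "W (s n i) \<in> borel_measurable M" by (rule BM_measurable) (use mem[OF that] in simp)
  qed
  show "(\<lambda>\<omega>. \<Sum>p<m n. (X (s n (Suc p)) \<omega> - X (s n p) \<omega>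
            - H (s n p) \<omega> * (W (s n (Suc p)) \<omega> - W (s n p) \<omega>))\<^sup>2) \<in> borel_measurable M" for n
    by measurable
  let ?V = "\<lambda>n \<omega>. LINT r:{0..t}|lborel. (simple_value (freeze (m n) (s n) H) r \<omega> - H r \<omega>)\<^sup>2"
  have V: "conv_in_prob M ?V (\<lambda>_. 0)"
  proof (rule AE_tendsto_imp_conv_in_prob_0)
    show "?V n \<in> borel_measurable M" for n by (rule freeze_error_measurable[OF H t s])
    show "AE \<omega> in M. (\<lambda>n. ?V n \<omega>) \<longlonglongrightarrow> 0"
    proof (rule AE_I2)
      show "(\<lambda>n. ?V n \<omega>) \<longlonglongrightarrow> 0" if "\<omega> \<in> space M" for \<omega>
        by (rule freeze_error_tendsto_0[where H=H and s=s and m=m and t=t and \<omega>=\<omega>, OF continuous_adapted_path[OF H that] sP mesh]) (use t in auto)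
    qed
  qed
  fix \<epsilon> \<eta> :: real assume pos: "\<epsilon> > 0" "\<eta> > 0"
  define \<delta> where "\<delta> = (\<epsilon> / 4) * (\<eta> / 2)"
  have \<delta>: "\<delta> > 0" "\<delta> / (\<epsilon> / 4) = \<eta> / 2" using pos by (simp_all add: \<delta>_def)
  have "\<forall>\<^sub>F n in sequentially. prob {\<omega>\<in>space M. \<bar>?V n \<omega>\<bar> > \<delta> / 4} < \<eta> / 2"
    by (rule conv_in_prob_0D(3)[OF V]) (use pos \<delta> in auto)
  then show "\<forall>\<^sub>F n in sequentially. prob {\<omega>\<in>space M. \<bar>\<Sum>p<m n. (X (s n (Suc p)) \<omega> - X (s n p) \<omega>
            - H (s n p) \<omega> * (W (s n (Suc p)) \<omega> - W (s n p) \<omega>))\<^sup>2\<bar> > \<epsilon>} < \<eta>"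
  proof eventually_elim
    case (elim n)
    have "\<epsilon> / 4 > 0" using pos by simp
    from ito_integral_block_bound[OF ito t s this \<delta>(1), of n] elim show ?case
      unfolding \<delta>(2) by simp
  qed
qed

text \<open>The cross term between the martingale part and the small remainder is split by
  \<open>2 f c w \<le> f\<^sup>2 / \<theta> + \<theta> (c w)\<^sup>2\<close> with an arbitrarily small \<open>\<theta>\<close>.\<close>

lemma ito_process_quadratic_variation:
  assumes ito: "is_ito_integral M F W T H X" and t: "t \<in> {0..T}"
    and Y: "\<And>t. t \<in> {0..T} \<Longrightarrow> Y t \<in> borel_measurable M"
    and dec: "AE \<omega> in M. \<forall>t\<in>{0..T}. Y t \<omega> = Y 0 \<omega> + D t \<omega> - X t \<omega>"
    and lip: "\<And>\<omega>. \<omega> \<in> space M \<Longrightarrow> \<exists>L. \<forall>a\<in>{0..T}. \<forall>b\<in>{a..T}. \<bar>D b \<omega> - D a \<omega>\<bar> \<le> L * (b - a)"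
    and sP: "\<forall>n. is_partition t (m n) (s n)"
    and mesh: "\<forall>\<delta>>0. \<forall>\<^sub>F n in sequentially. \<forall>i<m n. s n (Suc i) - s n i < \<delta>"
  shows "conv_in_prob M (\<lambda>n \<omega>. \<Sum>i<m n. (Y (s n (Suc i)) \<omega> - Y (s n i) \<omega>)\<^sup>2)
    (\<lambda>\<omega>. LINT r:{0..t}|lborel. (H r \<omega>)\<^sup>2)"
proof -
  note s = sP[rule_format]
  have H: "continuous_adapted M F T H" and X: "continuous_adapted M F T X"
    using ito by (simp_all add: is_ito_integral_def)
  have mem: "s n i \<in> {0..T}" if "i \<le> m n" for n i using is_partition_mem[OF s that] t by auto
  have sle: "s n i \<le> s n i'" if "i \<le> i'" "i' \<le> m n" for n i i' by (rule is_partition_le[OF s that])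
  have [measurable]: "H (s n i) \<in> borel_measurable M" "X (s n i) \<in> borel_measurable M"
      "Y (s n i) \<in> borel_measurable M" "W (s n i) \<in> borel_measurable M" if "i \<le> m n" for n i
  proof -
    show "H (s n i) \<in> borel_measurable M" "X (s n i) \<in> borel_measurable M" "Y (s n i) \<in> borel_measurable M"
      by (rule continuous_adaptedD(2)[OF H mem[OF that]] continuous_adaptedD(2)[OF X mem[OF that]] Y[OF mem[OF that]])+
    show "W (s n i) \<in> borel_measurable M" by (rule BM_measurable) (use mem[OF that] in simp)
  qed
  have Hc: "continuous_on {0..t} (\<lambda>r. (H r \<omega>)\<^sup>2)" if "\<omega> \<in> space M" for \<omega>
    by (intro continuous_intros continuous_adapted_path[OF H that]) (use t in auto)
  have HM: "(\<lambda>\<omega>. (H r \<omega>)\<^sup>2) \<in> borel_measurable M" if "r \<in> {0..t}" for r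
  proof -
    have [measurable]: "H r \<in> borel_measurable M" by (rule continuous_adaptedD(2)[OF H]) (use that t in auto)
    show ?thesis by measurable
  qed
  define Q where "Q \<omega> = (LINT r:{0..t}|lborel. (H r \<omega>)\<^sup>2)" for \<omega>
  have Q[measurable]: "Q \<in> borel_measurable M"
    unfolding Q_def[abs_def] by (rule LINT_borel_measurable_continuous[OF HM Hc])
  \<comment> \<open>\<open>X\<close> enters \<open>Y\<close> with a minus sign, so
    \<open>Y + X\<close> is the drift up to a constant. Its squared increments sum to at most
    \<open>L\<^sup>2 * t\<close> times the mesh.\<close>
  define K where "K n \<omega> = (\<Sum>i<m n. ((Y (s n (Suc i)) \<omega> - Y (s n i) \<omega>) + (X (s n (Suc i)) \<omega> - X (s n i) \<omega>))\<^sup>2)" for n \<omega>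
  have [measurable]: "K n \<in> borel_measurable M" for n unfolding K_def[abs_def] by measurable
  have K: "conv_in_prob M K (\<lambda>_. 0)"
  proof (rule AE_tendsto_imp_conv_in_prob_0)
    show "AE \<omega> in M. (\<lambda>n. K n \<omega>) \<longlonglongrightarrow> 0"
      using dec AE_space
    proof eventually_elim
      case (elim \<omega>)
      obtain L where L: "\<And>a b. a \<in> {0..T} \<Longrightarrow> b \<in> {a..T} \<Longrightarrow> \<bar>D b \<omega> - D a \<omega>\<bar> \<le> L * (b - a)"
        using lip[OF elim(2)] by blast
      show ?case
      proof (rule tendstoI)
        fix e :: real assume e: "e > 0"
        define d where "d = e / (L\<^sup>2 * t + 1)"
        have den: "L\<^sup>2 * t + 1 > 0" using t by (intro add_nonneg_pos mult_nonneg_nonneg) auto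
        have d: "d > 0" using e den by (simp add: d_def)
        from mesh[rule_format, OF d] show "\<forall>\<^sub>F n in sequentially. dist (K n \<omega>) 0 < e"
        proof eventually_elim
          fix n assume small: "\<forall>i<m n. s n (Suc i) - s n i < d"
          have "K n \<omega> \<le> (\<Sum>i<m n. L\<^sup>2 * d * (s n (Suc i) - s n i))"
            unfolding K_def
          proof (rule sum_mono)
            fix i assume "i \<in> {..<m n}"
            then have i: "i < m n" by simp
            have "(Y (s n (Suc i)) \<omega> - Y (s n i) \<omega>) + (X (s n (Suc i)) \<omega> - X (s n i) \<omega>) = D (s n (Suc i)) \<omega> - D (s n i) \<omega>"
              using bspec[OF elim(1) mem[of i n]] bspec[OF elim(1) mem[of "Suc i" n]] i by linarith
            also have "\<bar>\<dots>\<bar> \<le> L * (s n (Suc i) - s n i)"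
              by (rule L) (use mem[of i n] mem[of "Suc i" n] sle[of i "Suc i" n] i in auto)
            finally have "((Y (s n (Suc i)) \<omega> - Y (s n i) \<omega>) + (X (s n (Suc i)) \<omega> - X (s n i) \<omega>))\<^sup>2
                \<le> (L * (s n (Suc i) - s n i))\<^sup>2"
              by (subst power2_abs[symmetric]) (rule power_mono[OF _ abs_ge_zero])
            also have "\<dots> = L\<^sup>2 * ((s n (Suc i) - s n i) * (s n (Suc i) - s n i))"
              by (simp add: power2_eq_square ac_simps)
            also have "\<dots> \<le> L\<^sup>2 * (d * (s n (Suc i) - s n i))"
              using small[rule_format, OF i] sle[of i "Suc i" n] i by (intro mult_left_mono mult_right_mono) auto
            finally show "((Y (s n (Suc i)) \<omega> - Y (s n i) \<omega>) + (X (s n (Suc i)) \<omega> - X (s n i) \<omega>))\<^sup>2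
                \<le> L\<^sup>2 * d * (s n (Suc i) - s n i)" by (simp add: ac_simps)
          qed
          also have "\<dots> = L\<^sup>2 * d * (\<Sum>i<m n. s n (Suc i) - s n i)" by (simp add: sum_distrib_left)
          also have "(\<Sum>i<m n. s n (Suc i) - s n i) = t"
            using s[of n] by (simp add: sum_lessThan_telescope is_partition_def)
          also have "L\<^sup>2 * d * t = d * (L\<^sup>2 * t)" by simp
          also have "\<dots> < d * (L\<^sup>2 * t + 1)" using d by (intro mult_strict_left_mono) auto
          also have "\<dots> = e" using den by (simp add: d_def)
          finally have "K n \<omega> < e" .
          moreover have "K n \<omega> \<ge> 0" unfolding K_def by (intro sum_nonneg) auto
          ultimately show "dist (K n \<omega>) 0 < e" by simp
        qed
      qed
    qed
  qed simp
  define E where "E n \<omega> = (\<Sum>p<m n. (X (s n (Suc p)) \<omega> - X (s n p) \<omega>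
            - H (s n p) \<omega> * (W (s n (Suc p)) \<omega> - W (s n p) \<omega>))\<^sup>2)" for n \<omega>
  have E: "conv_in_prob M E (\<lambda>_. 0)"
    unfolding E_def[abs_def] by (rule ito_integral_blocks_conv[OF ito t sP mesh])
  define B where "B n \<omega> = (\<Sum>i<m n. (H (s n i) \<omega>)\<^sup>2 *
     ((W (s n (Suc i)) \<omega> - W (s n i) \<omega>)\<^sup>2 - (s n (Suc i) - s n i)))" for n \<omega>
  have B: "conv_in_prob M B (\<lambda>_. 0)"
    unfolding B_def[abs_def] by (rule sum_weighted_squares_conv[OF H t sP mesh])
  define R where "R n \<omega> = (\<Sum>i<m n. (H (s n i) \<omega>)\<^sup>2 * (s n (Suc i) - s n i)) - Q \<omega>" for n \<omega>
  have R: "conv_in_prob M R (\<lambda>_. 0)"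
  proof (rule AE_tendsto_imp_conv_in_prob_0)
    show "R n \<in> borel_measurable M" for n unfolding R_def[abs_def] by measurable
    show "AE \<omega> in M. (\<lambda>n. R n \<omega>) \<longlonglongrightarrow> 0"
    proof (rule AE_I2)
      show "(\<lambda>n. R n \<omega>) \<longlonglongrightarrow> 0" if "\<omega> \<in> space M" for \<omega>
        unfolding R_def Q_def
        using riemann_sum_tendsto[OF Hc[OF that] sP mesh] t by (intro LIM_zero) auto
    qed
  qed
  have abs: "conv_in_prob M (\<lambda>n \<omega>. \<bar>Z n \<omega>\<bar>) (\<lambda>_. 0)" if "conv_in_prob M Z (\<lambda>_. 0)" for Z
    using that by (auto simp: conv_in_prob_def intro: borel_measurable_abs)
  define Z where "Z n \<omega> = (\<Sum>i<m n. (Y (s n (Suc i)) \<omega> - Y (s n i) \<omega>)\<^sup>2) - Q \<omega>" for n \<omega>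
  \<comment> \<open>\<open>Z\<close> differs from the sum of \<open>y\<^sup>2 - c\<^sup>2\<close> by
    \<open>B + R\<close>. The Young inequality contributes \<open>1 + 1 / \<theta>\<close> times the
    sum of the \<open>f\<^sup>2\<close>, which \<open>2 * K + 2 * E\<close> bounds, and \<theta>
    times the sum of the \<open>c\<^sup>2\<close>, which is \<open>B + R + Q\<close>. The part
    \<open>\<theta> * Q\<close> is kept apart because it does not vanish with the mesh.\<close>
  define P where "P \<theta> n \<omega> = (1 + 1 / \<theta>) * (2 * K n \<omega> + 2 * E n \<omega>) + (1 + \<theta>) * (\<bar>B n \<omega>\<bar> + \<bar>R n \<omega>\<bar>)" for \<theta> n \<omega>
  have "conv_in_prob M Z (\<lambda>_. 0)"
  proof (rule conv_in_prob_0_up_to_small)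
    show "Z n \<in> borel_measurable M" for n unfolding Z_def[abs_def] by measurable
    show "Q \<in> borel_measurable M" by simp
    show "conv_in_prob M (P \<theta>) (\<lambda>_. 0)" for \<theta>
      unfolding P_def[abs_def]
      by (intro conv_in_prob_0_add[OF conv_in_prob_0_scale[OF conv_in_prob_0_add[OF conv_in_prob_0_scale[OF K] conv_in_prob_0_scale[OF E]]]
         conv_in_prob_0_scale[OF conv_in_prob_0_add[OF abs[OF B] abs[OF R]]]])
    fix \<theta> :: real and n assume \<theta>: "\<theta> > 0"
    show "AE \<omega> in M. \<bar>Z n \<omega>\<bar> \<le> \<bar>P \<theta> n \<omega>\<bar> + \<bar>\<theta> * Q \<omega>\<bar>"
    proof (rule AE_I2)
      fix \<omega>
      define y where "y i = Y (s n (Suc i)) \<omega> - Y (s n i) \<omega>" for i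
      define x where "x i = X (s n (Suc i)) \<omega> - X (s n i) \<omega>" for i
      define c where "c i = H (s n i) \<omega> * (W (s n (Suc i)) \<omega> - W (s n i) \<omega>)" for i
      define f where "f i = y i + c i" for i
      define Ff where "Ff = (\<Sum>i<m n. (f i)\<^sup>2)"
      define S where "S = (\<Sum>i<m n. (c i)\<^sup>2)"
      have F0: "Ff \<ge> 0" unfolding Ff_def by (intro sum_nonneg) auto
      have "(f i)\<^sup>2 \<le> 2 * (y i + x i)\<^sup>2 + 2 * (x i - c i)\<^sup>2" for i
        using zero_le_power2[of "(y i + x i) + (x i - c i)"]
        unfolding f_def by (simp add: power2_eq_square algebra_simps)
      then have FKE: "Ff \<le> 2 * K n \<omega> + 2 * E n \<omega>"
        unfolding Ff_def K_def E_def sum_distrib_left sum.distrib[symmetric] y_def x_def c_def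
        by (intro sum_mono) simp
      have "B n \<omega> + (\<Sum>i<m n. (H (s n i) \<omega>)\<^sup>2 * (s n (Suc i) - s n i)) = S"
        unfolding B_def S_def c_def sum.distrib[symmetric]
        unfolding power_mult_distrib by (intro sum.cong refl) (simp add: right_diff_distrib)
      then have S: "S = B n \<omega> + R n \<omega> + Q \<omega>" by (simp add: R_def)
      have pt: "\<bar>(y i)\<^sup>2 - (c i)\<^sup>2\<bar> \<le> (1 + 1 / \<theta>) * (f i)\<^sup>2 + \<theta> * (c i)\<^sup>2" for i
      proof -
        have y: "(y i)\<^sup>2 - (c i)\<^sup>2 = (f i)\<^sup>2 - 2 * f i * c i" unfolding f_def by (simp add: power2_eq_square algebra_simps)
        \<comment> \<open>Completing squares with the weights \<open>1 / a\<close> and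
          \<open>a\<close> bounds the cross term from both sides.\<close>
        define a where "a = sqrt \<theta>"
        have a: "a > 0" "a\<^sup>2 = \<theta>" using \<theta> by (auto simp: a_def)
        have "0 \<le> (f i / a + a * c i)\<^sup>2" "0 \<le> (f i / a - a * c i)\<^sup>2" by auto
        then have "0 \<le> (f i)\<^sup>2 / \<theta> + \<theta> * (c i)\<^sup>2 + 2 * f i * c i" "0 \<le> (f i)\<^sup>2 / \<theta> + \<theta> * (c i)\<^sup>2 - 2 * f i * c i"
          using a(1) by (simp_all add: power2_sum power2_diff power_divide power_mult_distrib a(2) mult.assoc)
        then have "\<bar>2 * f i * c i\<bar> \<le> (f i)\<^sup>2 / \<theta> + \<theta> * (c i)\<^sup>2" by linarith
        then have "\<bar>(f i)\<^sup>2 - 2 * f i * c i\<bar> \<le> (f i)\<^sup>2 + ((f i)\<^sup>2 / \<theta> + \<theta> * (c i)\<^sup>2)"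
          using zero_le_power2[of "f i"] by linarith
        then show ?thesis unfolding y by (simp add: algebra_simps)
      qed
      have "\<bar>(\<Sum>i<m n. (y i)\<^sup>2) - S\<bar> = \<bar>\<Sum>i<m n. (y i)\<^sup>2 - (c i)\<^sup>2\<bar>" by (simp add: S_def sum_subtractf)
      also have "\<dots> \<le> (\<Sum>i<m n. (1 + 1 / \<theta>) * (f i)\<^sup>2 + \<theta> * (c i)\<^sup>2)"
        by (intro order_trans[OF sum_abs] sum_mono pt)
      also have "\<dots> = (1 + 1 / \<theta>) * Ff + \<theta> * S" by (simp add: Ff_def S_def sum.distrib sum_distrib_left)
      also have "\<dots> \<le> (1 + 1 / \<theta>) * (2 * K n \<omega> + 2 * E n \<omega>) + \<theta> * S"
        using FKE \<theta> by (intro add_right_mono mult_left_mono) auto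
      finally have 1: "\<bar>(\<Sum>i<m n. (y i)\<^sup>2) - S\<bar> \<le> (1 + 1 / \<theta>) * (2 * K n \<omega> + 2 * E n \<omega>) + \<theta> * S" .
      have "\<theta> * S \<le> \<theta> * (\<bar>B n \<omega>\<bar> + \<bar>R n \<omega>\<bar>) + \<theta> * Q \<omega>"
        unfolding S distrib_left[symmetric] using \<theta> by (intro mult_left_mono) auto
      moreover have "Z n \<omega> = ((\<Sum>i<m n. (y i)\<^sup>2) - S) + B n \<omega> + R n \<omega>"
        unfolding Z_def S y_def by simp
      moreover have "P \<theta> n \<omega> = (1 + 1 / \<theta>) * (2 * K n \<omega> + 2 * E n \<omega>) + \<theta> * (\<bar>B n \<omega>\<bar> + \<bar>R n \<omega>\<bar>) + \<bar>B n \<omega>\<bar> + \<bar>R n \<omega>\<bar>"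
        unfolding P_def by (simp add: algebra_simps)
      ultimately show "\<bar>Z n \<omega>\<bar> \<le> \<bar>P \<theta> n \<omega>\<bar> + \<bar>\<theta> * Q \<omega>\<bar>"
        using 1 by linarith
    qed
  qed
  then show ?thesis
    by (subst conv_in_prob_diff_iff) (auto simp: Z_def[abs_def] Q_def[symmetric] intro!: borel_measurable_sum)
qed

end

section \<open>Time integrals as functions of the upper limit\<close>

lemma integral_indefinite_Lipschitz:
  fixes d :: "real \<Rightarrow> real"
  assumes d: "continuous_on {0..T} d"
  shows "\<exists>L\<ge>0. \<forall>a\<in>{0..T}. \<forall>b\<in>{a..T}.
    \<bar>(LINT s:{0..b}|lborel. d s) - (LINT s:{0..a}|lborel. d s)\<bar> \<le> L * (b - a)"
proof -
  have "bounded (d ` {0..T})" by (intro compact_imp_bounded compact_continuous_image d compact_Icc)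
  then obtain L where L: "L > 0" "\<And>s. s \<in> {0..T} \<Longrightarrow> \<bar>d s\<bar> \<le> L" by (auto simp: bounded_pos)
  have "\<bar>(LINT s:{0..b}|lborel. d s) - (LINT s:{0..a}|lborel. d s)\<bar> \<le> L * (b - a)"
    if a: "a \<in> {0..T}" and b: "b \<in> {a..T}" for a b
  proof -
    have int: "set_integrable lborel {0..b} d" "set_integrable lborel {0..a} d"
      using a b by (auto intro!: borel_integrable_atLeastAtMost' continuous_on_subset[OF d])
    have eq: "indicator {0..b} s *\<^sub>R d s - indicator {0..a} s *\<^sub>R d s = indicator {a<..b} s *\<^sub>R d s" for s
      using a b by (auto simp: indicator_def)
    have i3: "integrable lborel (\<lambda>s. indicator {a<..b} s *\<^sub>R d s)"
      using Bochner_Integration.integrable_diff[OF int[unfolded set_integrable_def]] unfolding eq .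
    have "(LINT s:{0..b}|lborel. d s) - (LINT s:{0..a}|lborel. d s) = (\<integral>s. indicator {a<..b} s *\<^sub>R d s \<partial>lborel)"
      unfolding set_lebesgue_integral_def
      by (subst Bochner_Integration.integral_diff[OF int[unfolded set_integrable_def], symmetric]) (simp only: eq)
    also have "\<bar>\<dots>\<bar> \<le> (\<integral>s. \<bar>indicator {a<..b} s *\<^sub>R d s\<bar> \<partial>lborel)" by (rule integral_abs_bound)
    also have "\<dots> \<le> (\<integral>s. L * indicator {a<..b} s \<partial>lborel)"
    proof (rule integral_mono)
      show "integrable lborel (\<lambda>s. \<bar>indicator {a<..b} s *\<^sub>R d s\<bar>)" using i3 by (rule integrable_abs)
      show "integrable lborel (\<lambda>s. L * indicator {a<..b} s)" using b by (simp add: emeasure_lborel_Ioc)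
      show "\<bar>indicator {a<..b} s *\<^sub>R d s\<bar> \<le> L * indicator {a<..b} s" for s
        using L(2)[of s] a b by (auto simp: indicator_def)
    qed
    also have "\<dots> = L * (b - a)" using b by simp
    finally show ?thesis .
  qed
  then show ?thesis using L(1) by (intro exI[of _ L]) auto
qed

lemma integral_indefinite_continuous:
  fixes d :: "real \<Rightarrow> real"
  assumes d: "continuous_on {0..T} d"
  shows "continuous_on {0..T} (\<lambda>t. LINT s:{0..t}|lborel. d s)"
proof -
  obtain L where L: "L \<ge> 0" "\<And>a b. a \<in> {0..T} \<Longrightarrow> b \<in> {a..T} \<Longrightarrow>
    \<bar>(LINT s:{0..b}|lborel. d s) - (LINT s:{0..a}|lborel. d s)\<bar> \<le> L * (b - a)"
    using integral_indefinite_Lipschitz[OF d] by blast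
  have "L-lipschitz_on {0..T} (\<lambda>t. LINT s:{0..t}|lborel. d s)"
  proof (rule lipschitz_onI)
    fix x y assume xy: "x \<in> {0..T}" "y \<in> {0..T}"
    show "dist (LINT s:{0..x}|lborel. d s) (LINT s:{0..y}|lborel. d s) \<le> L * dist x y"
      using L(2)[of x y] L(2)[of y x] xy
      by (cases "x \<le> y") (auto simp: dist_real_def abs_minus_commute)
  qed (rule L(1))
  then show ?thesis by (rule lipschitz_on_continuous_on)
qed

section \<open>Broken polynomials\<close>

lemma poly_eq_sum_le:
  fixes p :: "'a :: comm_ring_1 poly"
  assumes "degree p \<le> k"
  shows "poly p x = (\<Sum>l\<le>k. coeff p l * x ^ l)"
  unfolding poly_altdef using assms
  by (intro sum.mono_neutral_left) (auto simp: coeff_eq_0)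

lemma poly_square_eq_sum:
  fixes p :: "real poly"
  assumes "degree p \<le> k"
  shows "(poly p x)\<^sup>2 = (\<Sum>l\<le>k. \<Sum>l'\<le>k. x ^ (l + l') * (coeff p l * coeff p l'))"
  unfolding poly_eq_sum_le[OF assms] power2_eq_square sum_product
  by (intro sum.cong refl) (simp add: power_add ac_simps)

lemma LINT_mult_poly_eq_sum:
  fixes w :: "real \<Rightarrow> real"
  assumes w: "continuous_on {a..b} w" and p: "degree p \<le> k"
  shows "(LINT x:{a..b}|lborel. w x * poly p x) = (\<Sum>l\<le>k. coeff p l * (LINT x:{a..b}|lborel. w x * x ^ l))"
proof -
  have i: "set_integrable lborel {a..b} (\<lambda>x. coeff p l * (w x * x ^ l))" for l
    by (intro borel_integrable_atLeastAtMost' continuous_intros w)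
  have "(LINT x:{a..b}|lborel. w x * poly p x) = (LINT x:{a..b}|lborel. (\<Sum>l\<le>k. coeff p l * (w x * x ^ l)))"
    unfolding poly_eq_sum_le[OF p] by (simp add: sum_distrib_left ac_simps)
  also have "\<dots> = (\<Sum>l\<le>k. LINT x:{a..b}|lborel. coeff p l * (w x * x ^ l))"
    unfolding set_lebesgue_integral_def scaleR_sum_right
    using i[unfolded set_integrable_def] by (intro Bochner_Integration.integral_sum) auto
  also have "\<dots> = (\<Sum>l\<le>k. coeff p l * (LINT x:{a..b}|lborel. w x * x ^ l))"
    by (simp add: set_integral_mult_right)
  finally show ?thesis .
qed

text \<open>A zero integral would make the polynomial vanish almost everywhere on the interval; its
  finitely many roots form a null set, the interval does not.\<close>

lemma LINT_poly_square_pos: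
  fixes p :: "real poly"
  assumes "a < b" "p \<noteq> 0"
  shows "(LINT x:{a..b}|lborel. poly p x * poly p x) > 0"
proof -
  have i: "integrable lborel (\<lambda>x. indicator {a..b} x *\<^sub>R (poly p x * poly p x))"
    unfolding set_integrable_def[symmetric] by (intro borel_integrable_atLeastAtMost' continuous_intros)
  have nn: "AE x in lborel. 0 \<le> indicator {a..b} x *\<^sub>R (poly p x * poly p x)" by (intro AE_I2) auto
  have "(LINT x:{a..b}|lborel. poly p x * poly p x) \<noteq> 0"
  proof
    assume "(LINT x:{a..b}|lborel. poly p x * poly p x) = 0"
    then have "AE x in lborel. indicator {a..b} x *\<^sub>R (poly p x * poly p x) = 0"
      unfolding set_lebesgue_integral_def using integral_nonneg_eq_0_iff_AE[OF i nn] by simp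
    moreover have "AE x in lborel. x \<notin> {x. poly p x = 0}"
      by (intro AE_not_in finite_imp_null_set_lborel poly_roots_finite assms)
    ultimately have "AE x in lborel. x \<notin> {a..b}" by eventually_elim (auto simp: indicator_def)
    then have "{a..b} \<in> null_sets lborel" by (subst AE_iff_null_sets) auto
    then show False using assms(1) by (simp add: null_sets_def)
  qed
  moreover have "(LINT x:{a..b}|lborel. poly p x * poly p x) \<ge> 0"
    unfolding set_lebesgue_integral_def by (rule integral_nonneg_AE[OF nn])
  ultimately show ?thesis by simp
qed

text \<open>Gram-Schmidt: the monomial of degree \<open>n\<close> is made orthogonal to all polynomials of smaller degree, by
  applying the induction hypothesis to the functional that it represents.\<close>

lemma polynomial_Riesz_representation:
  fixes L :: "real poly \<Rightarrow> real"
  assumes ab: "a < b" and add: "\<And>p q. L (p + q) = L p + L q" and scale: "\<And>c p. L (smult c p) = c * L p"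
  shows "\<exists>r. degree r \<le> k \<and> (\<forall>p. degree p \<le> k \<longrightarrow> (LINT x:{a..b}|lborel. poly r x * poly p x) = L p)"
proof -
  define B where "B r p = (LINT x:{a..b}|lborel. poly r x * poly p x)" for r p :: "real poly"
  have i: "set_integrable lborel {a..b} (\<lambda>x. poly r x * poly p x)" for r p :: "real poly"
    by (intro borel_integrable_atLeastAtMost' continuous_intros)
  have B_comm: "B r p = B p r" for r p by (simp add: B_def mult.commute)
  have B_add: "B (r + r') p = B r p + B r' p" for r r' p
    using set_integral_add(2)[OF i[of r p] i[of r' p]] by (simp add: B_def distrib_right)
  have B_scale: "B (smult c r) p = c * B r p" for c r p
    by (simp add: B_def mult.assoc set_integral_mult_right)
  \<comment> \<open>Vanishing coefficients from \<open>n\<close> on replace the degree bound, so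
    that \<open>n = 0\<close> describes the zero space and starts the induction. \<open>L\<close> is
    generalized because the induction hypothesis is also applied to the functional
    \<open>B e0\<close>.\<close>
  have *: "\<exists>r. (\<forall>i\<ge>n. coeff r i = 0) \<and> (\<forall>p. (\<forall>i\<ge>n. coeff p i = 0) \<longrightarrow> B r p = L p)"
    if "\<And>p q. L (p + q) = L p + L q" "\<And>c p. L (smult c p) = c * L p" for n and L :: "real poly \<Rightarrow> real"
    using that
  proof (induction n arbitrary: L)
    case 0
    have "p = 0" if "\<forall>i\<ge>0. coeff p i = 0" for p :: "real poly" using that by (auto simp: poly_eq_iff)
    moreover have "L 0 = 0" using 0(2)[of 0 0] by simp
    ultimately show ?case by (intro exI[of _ 0]) (auto simp: B_def)
  next
    case (Suc n)
    define e0 where "e0 = monom (1::real) n"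
    have B_lin: "B e0 (p + q) = B e0 p + B e0 q" "B e0 (smult c p) = c * B e0 p" for p q c
      using B_add B_scale B_comm by metis+
    obtain r0 where r0: "\<forall>i\<ge>n. coeff r0 i = 0" "\<And>p. (\<forall>i\<ge>n. coeff p i = 0) \<Longrightarrow> B r0 p = B e0 p"
      using Suc.IH[of "B e0"] B_lin by blast
    obtain r1 where r1: "\<forall>i\<ge>n. coeff r1 i = 0" "\<And>p. (\<forall>i\<ge>n. coeff p i = 0) \<Longrightarrow> B r1 p = L p"
      using Suc.IH[of L] Suc.prems by blast
    define e where "e = e0 + smult (-1) r0"
    have en: "coeff e n = 1" "\<And>i. i > n \<Longrightarrow> coeff e i = 0" using r0(1) by (auto simp: e_def e0_def)
    have e_orth: "B e p = 0" if "\<forall>i\<ge>n. coeff p i = 0" for p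
      unfolding e_def B_add B_scale r0(2)[OF that] by simp
    have "e \<noteq> 0" using en by auto
    then have Bee: "B e e \<noteq> 0" using LINT_poly_square_pos[OF ab, of e] by (simp add: B_def)
    \<comment> \<open>Since \<open>e\<close> is orthogonal to lower degrees, adding a multiple of it
      leaves the pairings of \<open>r1\<close> with them unchanged; as \<open>r1\<close> pairs to 0
      with \<open>e\<close>, the coefficient must be \<open>L e / B e e\<close>.\<close>
    define r where "r = r1 + smult (L e / B e e) e"
    have "B r p = L p" if p: "\<forall>i\<ge>Suc n. coeff p i = 0" for p
    proof -
      define \<alpha> where "\<alpha> = coeff p n"
      define p' where "p' = p + smult (-\<alpha>) e"
      have p': "\<forall>i\<ge>n. coeff p' i = 0"
      proof (intro allI impI)
        show "coeff p' i = 0" if "n \<le> i" for i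
          using p[rule_format, of i] en that by (cases "i = n") (auto simp: p'_def \<alpha>_def)
      qed
      have pp: "p = p' + smult \<alpha> e" by (simp add: p'_def)
      have "B r p = B r p' + \<alpha> * B r e"
        unfolding pp B_comm[of r] B_add B_scale ..
      also have "B r p' = L p'" unfolding r_def B_add B_scale by (simp add: r1(2)[OF p'] e_orth[OF p'])
      also have "B r e = L e" unfolding r_def B_add B_scale using Bee e_orth[OF r1(1)] by (simp add: B_comm[of r1])
      also have "L p' + \<alpha> * L e = L p" unfolding pp Suc.prems ..
      finally show ?thesis .
    qed
    moreover have "\<forall>i\<ge>Suc n. coeff r i = 0" using r1(1) en by (auto simp: r_def)
    ultimately show ?case by blast
  qed
  obtain r where r: "\<forall>i\<ge>Suc k. coeff r i = 0" "\<And>p. (\<forall>i\<ge>Suc k. coeff p i = 0) \<Longrightarrow> B r p = L p"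
    using *[OF add scale, of "Suc k"] by blast
  have "degree r \<le> k" using r(1) by (intro degree_le) auto
  then show ?thesis using r(2) by (intro exI[of _ r]) (auto simp: B_def coeff_eq_0)
qed

lemma point_evaluation_representer:
  assumes "a < (b :: real)"
  shows "\<exists>r. degree r \<le> k \<and> (\<forall>p. degree p \<le> k \<longrightarrow> (LINT y:{a..b}|lborel. poly r y * poly p y) = poly p x)"
  by (rule polynomial_Riesz_representation[OF assms]) auto

section \<open>Regularity in time along one path of the scheme\<close>

definition continuous_DG_path :: "real \<Rightarrow> nat \<Rightarrow> nat \<Rightarrow> (real \<Rightarrow> dg) \<Rightarrow> bool" where
  "continuous_DG_path T N k v \<longleftrightarrow> (\<forall>s\<in>{0..T}. v s \<in> DG N k) \<and>
     (\<forall>j<N. \<forall>l\<le>k. continuous_on {0..T} (\<lambda>s. coeff (v s j) l))"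

lemma continuous_DG_path_degree:
  "continuous_DG_path T N k v \<Longrightarrow> s \<in> {0..T} \<Longrightarrow> j < N \<Longrightarrow> degree (v s j) \<le> k"
  by (auto simp: continuous_DG_path_def DG_def)

text \<open>Expanding in monomials puts the time dependence into finitely many continuous
  coefficients and leaves fixed moments of \<open>w\<close> in space.\<close>

lemma continuous_on_LINT_mult_DG:
  assumes v: "continuous_DG_path T N k v" "j < N" and w: "continuous_on {a..b} w"
  shows "continuous_on {0..T} (\<lambda>s. LINT x:{a..b}|lborel. w x * poly (v s j) x)"
proof -
  have "continuous_on {0..T} (\<lambda>s. \<Sum>l\<le>k. coeff (v s j) l * (LINT x:{a..b}|lborel. w x * x ^ l))"
    using v by (intro continuous_intros) (auto simp: continuous_DG_path_def)
  then show ?thesis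
    by (subst continuous_on_cong[OF refl LINT_mult_poly_eq_sum[OF w continuous_DG_path_degree[OF v(1) _ v(2)]]])
qed

lemma continuous_on_LINT_square_DG:
  assumes v: "continuous_DG_path T N k v" "j < N"
  shows "continuous_on {0..T} (\<lambda>s. LINT x:{a..b}|lborel. (poly (v s j) x)\<^sup>2)"
proof -
  have eq: "(LINT x:{a..b}|lborel. (poly (v s j) x)\<^sup>2)
      = (\<Sum>l\<le>k. coeff (v s j) l * (\<Sum>l'\<le>k. coeff (v s j) l' * (LINT x:{a..b}|lborel. x ^ l * x ^ l')))"
    if s: "s \<in> {0..T}" for s
  proof -
    note d = continuous_DG_path_degree[OF v(1) s v(2)]
    have c: "continuous_on {a..b} (\<lambda>x. x ^ l)" "continuous_on {a..b} (\<lambda>x. poly (v s j) x)" for l :: nat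
      by (intro continuous_intros)+
    show ?thesis
      unfolding power2_eq_square LINT_mult_poly_eq_sum[OF c(2) d]
      by (intro sum.cong refl arg_cong2[where f="(*)"])
        (simp add: LINT_mult_poly_eq_sum[OF c(1) d, symmetric] mult.commute)
  qed
  have "continuous_on {0..T} (\<lambda>s. \<Sum>l\<le>k. coeff (v s j) l * (\<Sum>l'\<le>k. coeff (v s j) l' * (LINT x:{a..b}|lborel. x ^ l * x ^ l')))"
    using v by (intro continuous_intros) (auto simp: continuous_DG_path_def)
  then show ?thesis by (subst continuous_on_cong[OF refl eq])
qed

lemma continuous_on_poly_DG:
  assumes v: "continuous_DG_path T N k v" "j < N"
  shows "continuous_on {0..T} (\<lambda>s. poly (v s j) x)"
proof -
  have "continuous_on {0..T} (\<lambda>s. \<Sum>l\<le>k. coeff (v s j) l * x ^ l)"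
    using v by (intro continuous_intros) (auto simp: continuous_DG_path_def)
  then show ?thesis
    by (subst continuous_on_cong[OF refl poly_eq_sum_le[OF continuous_DG_path_degree[OF v(1) _ v(2)]]])
qed

lemma continuous_on_traces:
  assumes v: "continuous_DG_path T N k v" and i: "i \<le> N" "1 \<le> N"
  shows "continuous_on {0..T} (\<lambda>s. trace_minus N xs (v s) i)"
    and "continuous_on {0..T} (\<lambda>s. trace_plus N xs (v s) i)"
  unfolding trace_minus_def trace_plus_def by (rule continuous_on_poly_DG[OF v]; use i in auto)+

lemma continuous_on_flux_at:
  assumes u: "continuous_DG_path T N k u" and q: "continuous_DG_path T N k q"
    and f: "is_numerical_flux N f" and i: "i \<le> N" "1 \<le> N"
  shows "continuous_on {0..T} (\<lambda>s. flux_at N xs f (u s) (q s) i)"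
proof -
  have "continuous_on UNIV (f i)" using f i by (simp add: is_numerical_flux_def)
  then show ?thesis
    unfolding flux_at_def
    by (rule continuous_on_compose2) (auto intro!: continuous_intros continuous_on_traces[OF u i] continuous_on_traces[OF q i])
qed

lemma C2_derivatives:
  assumes "C2 \<sigma>"
  shows "(\<sigma> has_field_derivative deriv \<sigma> x) (at x)"
    and "(deriv \<sigma> has_field_derivative deriv (deriv \<sigma>) x) (at x)"
    and "continuous_on S \<sigma>" "continuous_on S (deriv \<sigma>)" "continuous_on S (deriv (deriv \<sigma>))"
proof -
  show 1: "(\<sigma> has_field_derivative deriv \<sigma> x) (at x)"
    "(deriv \<sigma> has_field_derivative deriv (deriv \<sigma>) x) (at x)" for x
    using assms by (auto simp: C2_def field_differentiable_derivI)
  show "continuous_on S \<sigma>" "continuous_on S (deriv \<sigma>)"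
    by (intro continuous_at_imp_continuous_on ballI DERIV_isCont[OF 1(1)] DERIV_isCont[OF 1(2)])+
  show "continuous_on S (deriv (deriv \<sigma>))"
    using assms by (auto simp: C2_def intro: continuous_on_subset)
qed

lemma deriv_mult_poly:
  assumes "\<And>x. (f has_field_derivative f' x) (at x)"
  shows "deriv (\<lambda>y. f y * poly p y) x = f' x * poly p x + f x * poly (pderiv p) x"
  by (rule DERIV_imp_deriv) (auto intro!: derivative_eq_intros assms poly_DERIV)

text \<open>For a fixed test function both volume terms integrate a spatial weight against
  \<open>u\<close> or \<open>q\<close>. The weight in \<open>ldg_a\<close> contains the second
  derivative of \<sigma>, and \<open>C2\<close> makes it continuous.\<close>

lemma continuous_on_ldg_drift:
  assumes u: "continuous_DG_path T N k u" and q: "continuous_DG_path T N k q"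
    and f: "is_numerical_flux N Fu" "is_numerical_flux N Ftq" and \<sigma>: "C2 \<sigma>" and j: "j < N"
  shows "continuous_on {0..T} (\<lambda>s. ldg_a N xs \<sigma> Fu j (u s) (q s) \<phi> + ldg_b N xs \<sigma> Ftq j (u s) (q s) \<phi>)"
proof -
  note d = C2_derivatives[OF \<sigma>]
  have "continuous_on {xs j..xs (Suc j)} (\<lambda>x. deriv (\<lambda>y. deriv \<sigma> y * poly (\<phi> j) y) x * \<sigma> x)"
    unfolding deriv_mult_poly[OF d(2)] by (intro continuous_intros d)
  note a = continuous_on_LINT_mult_DG[OF u j this]
  have "continuous_on {xs j..xs (Suc j)} (\<lambda>x. deriv (\<lambda>y. \<sigma> y * poly (\<phi> j) y) x)"
    unfolding deriv_mult_poly[OF d(1)] by (intro continuous_intros d)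
  note b = continuous_on_LINT_mult_DG[OF q j this]
  show ?thesis
    unfolding ldg_a_def ldg_b_def
    using j by (intro continuous_intros a b continuous_on_flux_at[OF u q f(1)] continuous_on_flux_at[OF u q f(2)]) auto
qed

lemma continuous_on_ldg_flux_terms:
  assumes u: "continuous_DG_path T N k u" and q: "continuous_DG_path T N k q"
    and f: "is_numerical_flux N Ftu" "is_numerical_flux N Ftq" and i: "i \<le> N" "1 \<le> N"
  shows "continuous_on {0..T} (\<lambda>s. ldg_Lambda N xs \<sigma> Ftu Ftq (u s) (q s) i)"
    and "continuous_on {0..T} (\<lambda>s. ldg_Theta N xs \<sigma> Ftu Ftq (u s) (q s) i)"
proof -
  note c = continuous_on_traces[OF u i] continuous_on_traces[OF q i]
    continuous_on_flux_at[OF u q f(1) i] continuous_on_flux_at[OF u q f(2) i]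
  show "continuous_on {0..T} (\<lambda>s. ldg_Lambda N xs \<sigma> Ftu Ftq (u s) (q s) i)"
    unfolding ldg_Lambda_def by (intro continuous_intros c)
  have t: "trace_minus N xs (\<lambda>j. u s j * q s j) i = trace_minus N xs (u s) i * trace_minus N xs (q s) i"
    "trace_plus N xs (\<lambda>j. u s j * q s j) i = trace_plus N xs (u s) i * trace_plus N xs (q s) i" for s
    by (simp_all add: trace_minus_def trace_plus_def)
  show "continuous_on {0..T} (\<lambda>s. ldg_Theta N xs \<sigma> Ftu Ftq (u s) (q s) i)"
    unfolding ldg_Theta_def jump_def t by (intro continuous_intros c)
qed

text \<open>The equation for \<open>q\<close> is tested with \<open>\<psi> = q\<close>; the volume terms combine to the integral of
  \<open>(\<sigma> u q)'\<close>.\<close>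

lemma ldg_cell_identity:
  assumes \<sigma>: "C2 \<sigma>" and mesh: "is_mesh N xs" and j: "j < N" and q: "ldg_q_equation N xs \<sigma> Ftu j u q q"
  shows "2 * ldg_b N xs \<sigma> Ftq j u q u + (LINT x:cell xs j|lborel. (poly (q j) x)\<^sup>2)
    = ldg_Lambda N xs \<sigma> Ftu Ftq u q (Suc j) - ldg_Lambda N xs \<sigma> Ftu Ftq u q j + ldg_Theta N xs \<sigma> Ftu Ftq u q j"
proof -
  note d = C2_derivatives[OF \<sigma>]
  let ?a = "xs j" and ?b = "xs (Suc j)"
  have ab: "?a \<le> ?b" using mesh j by (auto simp: is_mesh_def less_imp_le)
  let ?f = "\<lambda>x. deriv (\<lambda>y. \<sigma> y * poly (u j) y) x * poly (q j) x"
  let ?g = "\<lambda>x. poly (pderiv (q j)) x * \<sigma> x * poly (u j) x"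
  have cf: "continuous_on {?a..?b} ?f"
    unfolding deriv_mult_poly[OF d(1)] by (intro continuous_intros d)
  have cg: "continuous_on {?a..?b} ?g" by (intro continuous_intros d)
  have D: "((\<lambda>x. \<sigma> x * poly (u j) x * poly (q j) x) has_real_derivative ?f x + ?g x) (at x)" for x
    unfolding deriv_mult_poly[OF d(1)]
    by (auto intro!: derivative_eq_intros d poly_DERIV simp: algebra_simps)
  have "(\<integral>x. (?f x + ?g x) * indicator {?a..?b} x \<partial>lborel)
    = \<sigma> ?b * poly (u j) ?b * poly (q j) ?b - \<sigma> ?a * poly (u j) ?a * poly (q j) ?a"
  proof (rule integral_FTC_Icc_real[OF ab D])
    have "continuous_on UNIV (\<lambda>x. ?f x + ?g x)"
      unfolding deriv_mult_poly[OF d(1)] by (intro continuous_intros d)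
    then show "isCont (\<lambda>x. ?f x + ?g x) x" for x by (simp add: continuous_on_eq_continuous_at)
  qed
  then have FTC: "(LINT x:{?a..?b}|lborel. ?f x) + (LINT x:{?a..?b}|lborel. ?g x)
    = \<sigma> ?b * poly (u j) ?b * poly (q j) ?b - \<sigma> ?a * poly (u j) ?a * poly (q j) ?a"
    unfolding set_integral_add(2)[OF borel_integrable_atLeastAtMost'[OF cf] borel_integrable_atLeastAtMost'[OF cg], symmetric]
    unfolding set_lebesgue_integral_def by (simp add: mult.commute)
  have tr: "trace_minus N xs v (Suc j) = poly (v j) ?b" "trace_plus N xs v j = poly (v j) ?a" for v
    using j by (auto simp: trace_minus_def trace_plus_def)
  \<comment> \<open>The traces from the left neighbour cancel in \<open>\<Theta> - \<Lambda>\<close>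
    at the left interface. What remains is \<sigma> times \<open>u\<^sup>+ q\<^sup>+\<close> minus
    the two products of an interior trace with a flux, as integration by parts on this cell
    produces; this holds at the ends of the domain too.\<close>
  have tm: "trace_minus N xs (\<lambda>j. u j * q j) j = trace_minus N xs u j * trace_minus N xs q j"
    by (simp add: trace_minus_def)
  have q2: "(LINT x:cell xs j|lborel. (poly (q j) x)\<^sup>2) =
     - (LINT x:{?a..?b}|lborel. ?g x)
     + \<sigma> ?b * flux_at N xs Ftu u q (Suc j) * poly (q j) ?b - \<sigma> ?a * flux_at N xs Ftu u q j * poly (q j) ?a"
    using q unfolding ldg_q_equation_def tr power2_eq_square .
  show ?thesis
    unfolding q2 ldg_b_def ldg_Lambda_def ldg_Theta_def jump_def tr tm
    using FTC by (simp add: algebra_simps)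
qed

section \<open>The bracket of the scheme\<close>

text \<open>As \<open>T > 0\<close>, every neighbourhood of a point of the interval, an end point
  included, meets the open interval and hence contains a rational time in it.\<close>

lemma continuous_on_eq_if_eq_on_Rats:
  fixes f g :: "real \<Rightarrow> real"
  assumes f: "continuous_on {0..T} f" and g: "continuous_on {0..T} g" and T: "T > 0"
    and eq: "\<And>t. t \<in> \<rat> \<inter> {0..T} \<Longrightarrow> f t = g t" and t: "t \<in> {0..T}"
  shows "f t = g t"
proof (rule ccontr)
  assume ne: "f t \<noteq> g t"
  have "continuous_on {0..T} (\<lambda>t. f t - g t)" by (intro continuous_intros f g)
  then obtain d where d: "d > 0" "\<And>s. s \<in> {0..T} \<Longrightarrow> dist s t < d \<Longrightarrow> dist (f s - g s) (f t - g t) < \<bar>f t - g t\<bar>"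
    unfolding continuous_on_iff using t ne by (metis right_minus_eq zero_less_abs_iff)
  have "max 0 (t - d) < min T (t + d)" using t T d(1) by auto
  then obtain r where r: "r \<in> \<rat>" "max 0 (t - d) < r" "r < min T (t + d)" using Rats_dense_in_real by blast
  then have "dist (f r - g r) (f t - g t) < \<bar>f t - g t\<bar>" by (intro d(2)) (auto simp: dist_real_def)
  moreover have "f r = g r" using r by (intro eq) auto
  ultimately show False by (simp add: dist_real_def)
qed

context brownian_motion begin

text \<open>Adaptedness results from applying the measurability of time integrals over
  \<open>F t\<close> itself: the integral up to \<open>t\<close> involves only earlier times, and
  those values are measurable there.\<close>

lemma continuous_adapted_integral_square:
  assumes h: "continuous_adapted M F T h"
  shows "continuous_adapted M F T (\<lambda>t \<omega>. LINT s:{0..t}|lborel. (h s \<omega>)\<^sup>2)"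
  unfolding continuous_adapted_def
proof (intro conjI ballI)
  fix t assume t: "t \<in> {0..T}"
  show "(\<lambda>\<omega>. LINT s:{0..t}|lborel. (h s \<omega>)\<^sup>2) \<in> borel_measurable (F t)"
  proof (rule LINT_borel_measurable_continuous)
    fix s assume s: "s \<in> {0..t}"
    have [measurable]: "h s \<in> borel_measurable (F t)"
      by (rule adapted_mono[OF continuous_adaptedD(1)[OF h]]) (use s t in auto)
    show "(\<lambda>\<omega>. (h s \<omega>)\<^sup>2) \<in> borel_measurable (F t)" by measurable
  next
    fix \<omega> assume "\<omega> \<in> space (F t)"
    then have "\<omega> \<in> space M" using space_F t by auto
    then show "continuous_on {0..t} (\<lambda>s. (h s \<omega>)\<^sup>2)"
      by (intro continuous_intros continuous_adapted_path[OF h]) (use t in auto)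
  qed
next
  fix \<omega> assume "\<omega> \<in> space M"
  then show "continuous_on {0..T} (\<lambda>t. LINT s:{0..t}|lborel. (h s \<omega>)\<^sup>2)"
    by (intro integral_indefinite_continuous continuous_intros continuous_adapted_path[OF h]) auto
qed

lemma continuous_adapted_DG_path:
  assumes "continuous_adapted_DG M F T N k v" "\<omega> \<in> space M"
  shows "continuous_DG_path T N k (\<lambda>s. v s \<omega>)"
  using assms by (auto simp: continuous_adapted_DG_def continuous_DG_path_def continuous_adapted_def)

lemma continuous_adapted_poly:
  assumes v: "continuous_adapted_DG M F T N k v" and j: "j < N"
  shows "continuous_adapted M F T (\<lambda>t \<omega>. poly (v t \<omega> j) x)"
  unfolding continuous_adapted_def
proof (intro conjI ballI)
  fix t assume t: "t \<in> {0..T}"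
  have [measurable]: "(\<lambda>\<omega>. coeff (v t \<omega> j) l) \<in> borel_measurable (F t)" if "l \<le> k" for l
    using v j t that by (auto simp: continuous_adapted_DG_def continuous_adapted_def)
  have "(\<lambda>\<omega>. \<Sum>l\<le>k. coeff (v t \<omega> j) l * x ^ l) \<in> borel_measurable (F t)" by measurable
  moreover have "poly (v t \<omega> j) x = (\<Sum>l\<le>k. coeff (v t \<omega> j) l * x ^ l)" if "\<omega> \<in> space (F t)" for \<omega>
    using continuous_DG_path_degree[OF continuous_adapted_DG_path[OF v] t j] that space_F[of t] t
    by (intro poly_eq_sum_le) auto
  ultimately show "(\<lambda>\<omega>. poly (v t \<omega> j) x) \<in> borel_measurable (F t)"
    by (simp cong: measurable_cong)
next
  fix \<omega> assume "\<omega> \<in> space M"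
  then show "continuous_on {0..T} (\<lambda>t. poly (v t \<omega> j) x)"
    by (rule continuous_on_poly_DG[OF continuous_adapted_DG_path[OF v] j])
qed

text \<open>Testing the scheme on the cell with the polynomial that represents the evaluation at \<open>x\<close> shows
  that \<open>u(x)\<close> is an Ito process with integrand \<open>q(x)\<close>.\<close>

lemma ldg_quad_covariation:
  assumes \<sigma>: "C2 \<sigma>" and mesh: "is_mesh N xs"
    and f: "is_numerical_flux N Fu" "is_numerical_flux N Ftq"
    and sol: "is_ldg_solution M F W T \<sigma> ubar N xs k Fu Ftu Ftq u q" and j: "j < N"
  shows "is_quad_covariation M F T (\<lambda>t \<omega>. poly (u t \<omega> j) x) (\<lambda>t \<omega>. poly (u t \<omega> j) x)
    (\<lambda>t \<omega>. LINT s:{0..t}|lborel. (poly (q s \<omega> j) x)\<^sup>2)"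
proof -
  have u: "continuous_adapted_DG M F T N k u" and q: "continuous_adapted_DG M F T N k q"
    using sol unfolding is_ldg_solution_def by blast+
  have "xs j < xs (Suc j)" using mesh j by (simp add: is_mesh_def)
  from point_evaluation_representer[OF this, of k x]
  obtain r where r: "degree r \<le> k"
      "\<And>p. degree p \<le> k \<Longrightarrow> (LINT y:cell xs j|lborel. poly r y * poly p y) = poly p x"
    by blast
  \<comment> \<open>The same polynomial on every cell; the equation on cell \<open>j\<close> sees
    only \<open>\<phi> j\<close>.\<close>
  define \<phi> :: dg where "\<phi> = (\<lambda>_. r)"
  have "\<phi> \<in> DG N k" using r(1) by (simp add: DG_def \<phi>_def)
  define d where "d s \<omega> = ldg_a N xs \<sigma> Fu j (u s \<omega>) (q s \<omega>) \<phi> + ldg_b N xs \<sigma> Ftq j (u s \<omega>) (q s \<omega>) \<phi>" for s \<omega>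
  define H where "H s \<omega> = (LINT x:cell xs j|lborel. poly (\<phi> j) x * poly (q s \<omega> j) x)" for s \<omega>
  define Y where "Y s \<omega> = (LINT x:cell xs j|lborel. poly (\<phi> j) x * poly (u s \<omega> j) x)" for s \<omega>
  have "\<forall>j<N. \<forall>\<phi>\<in>DG N k. \<exists>X.
        is_ito_integral M F W T (\<lambda>s \<omega>. LINT x:cell xs j|lborel. poly (\<phi> j) x * poly (q s \<omega> j) x) X \<and>
        (AE \<omega> in M. \<forall>t\<in>{0..T}.
           (LINT x:cell xs j|lborel. poly (\<phi> j) x * poly (u t \<omega> j) x) =
           (LINT x:cell xs j|lborel. poly (\<phi> j) x * poly (u 0 \<omega> j) x)
           + (LINT s:{0..t}|lborel. ldg_a N xs \<sigma> Fu j (u s \<omega>) (q s \<omega>) \<phi>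
                                  + ldg_b N xs \<sigma> Ftq j (u s \<omega>) (q s \<omega>) \<phi>)
           - X t \<omega>)"
    using sol unfolding is_ldg_solution_def by (elim conjE)
  from this[rule_format, OF j \<open>\<phi> \<in> DG N k\<close>]
  obtain X where X: "is_ito_integral M F W T H X"
      "AE \<omega> in M. \<forall>t\<in>{0..T}. Y t \<omega> = Y 0 \<omega> + (LINT s:{0..t}|lborel. d s \<omega>) - X t \<omega>"
    unfolding H_def[symmetric, abs_def] Y_def[symmetric, abs_def] d_def[symmetric] by blast
  \<comment> \<open>The representer reproduces only polynomials of degree at most \<open>k\<close>,
    which \<open>u\<close> and \<open>q\<close> are guaranteed to be for times up to
    \<open>T\<close> and \<omega> in the space. The tested equation then becomes one for the point
    values.\<close>
  have HY: "H s \<omega> = poly (q s \<omega> j) x" "Y s \<omega> = poly (u s \<omega> j) x" if "s \<in> {0..T}" "\<omega> \<in> space M" for s \<omega>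
    unfolding H_def Y_def \<phi>_def
    using continuous_DG_path_degree[OF continuous_adapted_DG_path[OF q that(2)] that(1) j]
      continuous_DG_path_degree[OF continuous_adapted_DG_path[OF u that(2)] that(1) j] r(2) by auto
  have YM: "Y t \<in> borel_measurable M" if "t \<in> {0..T}" for t
    using continuous_adaptedD(2)[OF continuous_adapted_poly[OF u j] that, of x] HY(2)[OF that]
    by (simp cong: measurable_cong)
  have lip: "\<exists>L. \<forall>a\<in>{0..T}. \<forall>b\<in>{a..T}. \<bar>(LINT s:{0..b}|lborel. d s \<omega>) - (LINT s:{0..a}|lborel. d s \<omega>)\<bar> \<le> L * (b - a)"
    if "\<omega> \<in> space M" for \<omega>
  proof -
    have "continuous_on {0..T} (\<lambda>s. d s \<omega>)"
      unfolding d_def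
      by (rule continuous_on_ldg_drift[OF continuous_adapted_DG_path[OF u that] continuous_adapted_DG_path[OF q that] f \<sigma> j])
    from integral_indefinite_Lipschitz[OF this] show ?thesis by blast
  qed
  show ?thesis
    unfolding is_quad_covariation_def
  proof (intro conjI ballI allI impI)
    show "continuous_adapted M F T (\<lambda>t \<omega>. LINT s:{0..t}|lborel. (poly (q s \<omega> j) x)\<^sup>2)"
      by (rule continuous_adapted_integral_square[OF continuous_adapted_poly[OF q j]])
    fix t m \<tau>
    assume t: "t \<in> {0..T}" and part: "(\<forall>n. is_partition t (m n) (\<tau> n)) \<and>
      (\<forall>\<delta>>0. \<forall>\<^sub>F n in sequentially. \<forall>i<m n. \<tau> n (Suc i) - \<tau> n i < \<delta>)"
    note \<tau> = conjunct1[OF part] and small = conjunct2[OF part]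
    have mem: "\<tau> n i \<in> {0..T}" if "i \<le> m n" for n i
      using is_partition_mem[OF \<tau>[rule_format] that] t by auto
    have c: "conv_in_prob M (\<lambda>n \<omega>. \<Sum>i<m n. (Y (\<tau> n (Suc i)) \<omega> - Y (\<tau> n i) \<omega>)\<^sup>2) (\<lambda>\<omega>. LINT s:{0..t}|lborel. (H s \<omega>)\<^sup>2)"
      by (rule ito_process_quadratic_variation[OF X(1) t YM X(2) lip \<tau> small])
    have e1: "(\<Sum>i<m n. (Y (\<tau> n (Suc i)) \<omega> - Y (\<tau> n i) \<omega>)\<^sup>2)
       = (\<Sum>i<m n. (poly (u (\<tau> n (Suc i)) \<omega> j) x - poly (u (\<tau> n i) \<omega> j) x) *
           (poly (u (\<tau> n (Suc i)) \<omega> j) x - poly (u (\<tau> n i) \<omega> j) x))" if "\<omega> \<in> space M" for n \<omega>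
      using mem HY(2)[OF _ that] by (intro sum.cong refl) (simp add: power2_eq_square Suc_le_eq)
    have e2: "(LINT s:{0..t}|lborel. (H s \<omega>)\<^sup>2) = (LINT s:{0..t}|lborel. (poly (q s \<omega> j) x)\<^sup>2)" if "\<omega> \<in> space M" for \<omega>
      using t HY(1)[OF _ that] by (intro set_lebesgue_integral_cong) auto
    show "conv_in_prob M (\<lambda>n \<omega>. \<Sum>i<m n. (poly (u (\<tau> n (Suc i)) \<omega> j) x - poly (u (\<tau> n i) \<omega> j) x) *
           (poly (u (\<tau> n (Suc i)) \<omega> j) x - poly (u (\<tau> n i) \<omega> j) x))
        (\<lambda>\<omega>. LINT s:{0..t}|lborel. (poly (q s \<omega> j) x)\<^sup>2)"
      using c unfolding conv_in_prob_def
      by (simp add: e1 e2 cong: measurable_cong conj_cong Collect_cong)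
  qed
qed

text \<open>At each fixed time the uniform partitions already determine the limit in probability
  almost surely. Rational times and continuity of both versions make the null set independent of the
  time.\<close>

lemma quad_covariation_unique:
  assumes A: "is_quad_covariation M F T X Y A" and B: "is_quad_covariation M F T X Y B" and T: "T > 0"
  shows "AE \<omega> in M. \<forall>t\<in>{0..T}. A t \<omega> = B t \<omega>"
proof -
  have "AE \<omega> in M. A t \<omega> = B t \<omega>" if t: "t \<in> {0..T}" for t
  proof -
    define s where "s n i = t * real i / real (Suc n)" for n i
    have p: "is_partition t (Suc n) (s n)" for n
      using t by (auto simp: is_partition_def s_def intro!: divide_right_mono mult_left_mono)
    have inc: "s n (Suc i) - s n i = t / real (Suc n)" for n i
      by (simp add: s_def diff_divide_distrib[symmetric] algebra_simps)
    have "(\<lambda>n. t / real (Suc n)) \<longlonglongrightarrow> 0" by (intro LIMSEQ_Suc lim_const_over_n)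
    then have "\<forall>\<delta>>0. \<forall>\<^sub>F n in sequentially. \<forall>i<Suc n. s n (Suc i) - s n i < \<delta>"
      unfolding inc by (auto dest: order_tendstoD(2) elim: eventually_mono)
    then show ?thesis
      using A B t p unfolding is_quad_covariation_def by (intro conv_in_prob_unique) blast+
  qed
  then have "AE \<omega> in M. \<forall>t\<in>\<rat> \<inter> {0..T}. A t \<omega> = B t \<omega>"
    by (intro AE_ball_countable' countable_Int1 countable_rat) auto
  then show ?thesis
    using AE_space
  proof eventually_elim
    case (elim \<omega>)
    have "continuous_on {0..T} (\<lambda>t. A t \<omega>)" "continuous_on {0..T} (\<lambda>t. B t \<omega>)"
      using A B elim(2) by (auto simp: is_quad_covariation_def continuous_adapted_def)
    from continuous_on_eq_if_eq_on_Rats[OF this T] elim(1) show ?case by blast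
  qed
qed

text \<open>The exceptional null set of two versions may depend on \<open>x\<close>; joint measurability and Fubini
  exchange it for one that does not.\<close>

lemma pointwise_bracket_unique:
  assumes A: "is_pointwise_bracket M F T xs j u A" and B: "is_pointwise_bracket M F T xs j u B" and T: "T > 0"
  shows "AE \<omega> in M. AE x in restrict_space lborel (cell xs j). \<forall>t\<in>{0..T}. A x t \<omega> = B x t \<omega>"
proof -
  let ?R = "restrict_space lborel (cell xs j)"
  have sp: "space ?R = cell xs j" by (simp add: space_restrict_space)
  interpret R: sigma_finite_measure ?R
    by (intro sigma_finite_measure_restrict_space lborel.sigma_finite_measure_axioms) simp
  interpret RM: pair_sigma_finite ?R M by unfold_locales
  have "AE \<omega> in M. AE x in ?R. A x t \<omega> = B x t \<omega>" if t: "t \<in> {0..T}" for t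
  proof (subst RM.AE_commute[symmetric])
    have "(\<lambda>(x, \<omega>). A x t \<omega>) \<in> borel_measurable (?R \<Otimes>\<^sub>M M)" "(\<lambda>(x, \<omega>). B x t \<omega>) \<in> borel_measurable (?R \<Otimes>\<^sub>M M)"
      using A B t by (simp_all add: is_pointwise_bracket_def)
    then have "{z \<in> space (?R \<Otimes>\<^sub>M M). (case z of (x, \<omega>) \<Rightarrow> A x t \<omega>) = (case z of (x, \<omega>) \<Rightarrow> B x t \<omega>)} \<in> sets (?R \<Otimes>\<^sub>M M)"
      by measurable
    then show "{z \<in> space (?R \<Otimes>\<^sub>M M). A (fst z) t (snd z) = B (fst z) t (snd z)} \<in> sets (?R \<Otimes>\<^sub>M M)"
      by (simp add: split_beta)
    show "AE x in ?R. AE \<omega> in M. A x t \<omega> = B x t \<omega>"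
    proof (rule AE_I2)
      fix x assume "x \<in> space ?R"
      then have "AE \<omega> in M. \<forall>t\<in>{0..T}. A x t \<omega> = B x t \<omega>"
        using A B sp by (intro quad_covariation_unique[OF _ _ T]) (auto simp: is_pointwise_bracket_def)
      then show "AE \<omega> in M. A x t \<omega> = B x t \<omega>" by eventually_elim (use t in blast)
    qed
  qed
  \<comment> \<open>Joint measurability is available at fixed times, so the null sets are exchanged
    one time at a time. Countably many times can be combined for fixed \<omega>, and then continuity
    in \<open>t\<close> is used at almost every \<open>x\<close>.\<close>
  then have "AE \<omega> in M. \<forall>t\<in>\<rat> \<inter> {0..T}. AE x in ?R. A x t \<omega> = B x t \<omega>"
    by (intro AE_ball_countable' countable_Int1 countable_rat) auto
  then show ?thesis
    using AE_space
  proof eventually_elim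
    case (elim \<omega>)
    have "AE x in ?R. \<forall>t\<in>\<rat> \<inter> {0..T}. A x t \<omega> = B x t \<omega>"
      using elim(1) by (intro AE_ball_countable' countable_Int1 countable_rat) auto
    then show ?case
      using AE_space
    proof eventually_elim
      case (elim x)
      then have "is_quad_covariation M F T (\<lambda>t \<omega>. poly (u t \<omega> j) x) (\<lambda>t \<omega>. poly (u t \<omega> j) x) (A x)"
          "is_quad_covariation M F T (\<lambda>t \<omega>. poly (u t \<omega> j) x) (\<lambda>t \<omega>. poly (u t \<omega> j) x) (B x)"
        using A B sp by (auto simp: is_pointwise_bracket_def)
      then have "continuous_on {0..T} (\<lambda>t. A x t \<omega>)" "continuous_on {0..T} (\<lambda>t. B x t \<omega>)"
        using \<open>\<omega> \<in> space M\<close> by (auto simp: is_quad_covariation_def continuous_adapted_def)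
      from continuous_on_eq_if_eq_on_Rats[OF this T] elim(1) show ?case by blast
    qed
  qed
qed

text \<open>The candidate is jointly measurable because \<open>q\<close> is a sum of coefficients,
  jointly measurable in \<omega> and time, times powers of \<open>x\<close>; integrating over time
  preserves this.\<close>

lemma ldg_pointwise_bracket:
  assumes \<sigma>: "C2 \<sigma>" and mesh: "is_mesh N xs"
    and f: "is_numerical_flux N Fu" "is_numerical_flux N Ftq"
    and sol: "is_ldg_solution M F W T \<sigma> ubar N xs k Fu Ftu Ftq u q" and j: "j < N"
  shows "is_pointwise_bracket M F T xs j u (\<lambda>x t \<omega>. LINT s:{0..t}|lborel. (poly (q s \<omega> j) x)\<^sup>2)"
  unfolding is_pointwise_bracket_def
proof (intro conjI ballI)
  show "is_quad_covariation M F T (\<lambda>t \<omega>. poly (u t \<omega> j) x) (\<lambda>t \<omega>. poly (u t \<omega> j) x)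
    (\<lambda>t \<omega>. LINT s:{0..t}|lborel. (poly (q s \<omega> j) x)\<^sup>2)" for x
    by (rule ldg_quad_covariation[OF \<sigma> mesh f sol j])
  have q: "continuous_adapted_DG M F T N k q" using sol unfolding is_ldg_solution_def by blast
  fix t assume t: "t \<in> {0..T}"
  let ?R = "restrict_space lborel (cell xs j)"
  let ?c = "\<lambda>l s \<omega>. coeff (q s \<omega> j) l"
  have c: "?c l s \<in> borel_measurable M" if "l \<le> k" "s \<in> {0..T}" for l s
    using q j that continuous_adaptedD(2)[of T "?c l" s] by (auto simp: continuous_adapted_DG_def)
  have cc: "(\<lambda>(\<omega>, s). indicator {0..t} s * ?c l s \<omega>) \<in> borel_measurable (M \<Otimes>\<^sub>M lborel)" if l: "l \<le> k" for l
  proof (rule joint_borel_measurable_continuous)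
    show "?c l s \<in> borel_measurable M" if "s \<in> {0..t}" for s by (rule c[OF l]) (use that t in auto)
    have "continuous_adapted M F T (?c l)" using q j l by (auto simp: continuous_adapted_DG_def)
    then show "continuous_on {0..t} (\<lambda>s. ?c l s \<omega>)" if "\<omega> \<in> space M" for \<omega>
      by (rule continuous_adapted_path) (use that t in auto)
  qed
  have m: "(\<lambda>(z, s). indicator {0..t} s * ?c l s (snd z)) \<in> borel_measurable ((?R \<Otimes>\<^sub>M M) \<Otimes>\<^sub>M lborel)" if l: "l \<le> k" for l
  proof -
    have "(\<lambda>w. (snd (fst w), snd w)) \<in> (?R \<Otimes>\<^sub>M M) \<Otimes>\<^sub>M lborel \<rightarrow>\<^sub>M M \<Otimes>\<^sub>M lborel" by measurable
    from measurable_compose[OF this cc[OF l]] show ?thesis by (simp add: split_beta)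
  qed
  have idm[measurable]: "(\<lambda>x. x) \<in> borel_measurable ?R" by (rule measurable_restrict_space1) simp
  \<comment> \<open>The indicator sits inside the square, attached to each coefficient, as the joint
    measurability of the coefficients provides it. Being its own square, it can be pulled out again
    below.\<close>
  have "(\<lambda>(z, s). (\<Sum>l\<le>k. (indicator {0..t} s * ?c l s (snd z)) * fst z ^ l)\<^sup>2)
      \<in> borel_measurable ((?R \<Otimes>\<^sub>M M) \<Otimes>\<^sub>M lborel)"
    unfolding split_beta
  proof (intro borel_measurable_power borel_measurable_sum)
    fix l assume "l \<in> {..k}"
    then have "(\<lambda>x. indicator {0..t} (snd x) * ?c l (snd x) (snd (fst x))) \<in> borel_measurable ((?R \<Otimes>\<^sub>M M) \<Otimes>\<^sub>M lborel)"
      using m[of l] by (simp add: split_beta)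
    moreover have "(\<lambda>x. fst (fst x)) \<in> borel_measurable ((?R \<Otimes>\<^sub>M M) \<Otimes>\<^sub>M lborel)"
      by (rule measurable_compose[OF measurable_fst measurable_compose[OF measurable_fst idm]])
    ultimately show "(\<lambda>x. (indicator {0..t} (snd x) * ?c l (snd x) (snd (fst x))) * fst (fst x) ^ l)
        \<in> borel_measurable ((?R \<Otimes>\<^sub>M M) \<Otimes>\<^sub>M lborel)"
      by (rule borel_measurable_times[OF _ borel_measurable_power])
  qed
  then have "(\<lambda>z. \<integral>s. (\<Sum>l\<le>k. (indicator {0..t} s * ?c l s (snd z)) * fst z ^ l)\<^sup>2 \<partial>lborel) \<in> borel_measurable (?R \<Otimes>\<^sub>M M)"
    by (rule lborel.borel_measurable_lebesgue_integral)
  moreover have "(case z of (x, \<omega>) \<Rightarrow> LINT s:{0..t}|lborel. (poly (q s \<omega> j) x)\<^sup>2)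
     = (\<integral>s. (\<Sum>l\<le>k. (indicator {0..t} s * ?c l s (snd z)) * fst z ^ l)\<^sup>2 \<partial>lborel)" if "z \<in> space (?R \<Otimes>\<^sub>M M)" for z
  proof -
    have "snd z \<in> space M" using that by (auto simp: space_pair_measure)
    then have "poly (q s (snd z) j) (fst z) = (\<Sum>l\<le>k. ?c l s (snd z) * fst z ^ l)" if "s \<in> {0..t}" for s
      by (intro poly_eq_sum_le continuous_DG_path_degree[OF continuous_adapted_DG_path[OF q] _ j]) (use that t in auto)
    then have "indicator {0..t} s *\<^sub>R (poly (q s (snd z) j) (fst z))\<^sup>2
       = (\<Sum>l\<le>k. (indicator {0..t} s * ?c l s (snd z)) * fst z ^ l)\<^sup>2" for s
      by (cases "s \<in> {0..t}") simp_all
    then show ?thesis by (simp add: split_beta set_lebesgue_integral_def)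
  qed
  ultimately show "(\<lambda>(x, \<omega>). LINT s:{0..t}|lborel. (poly (q s \<omega> j) x)\<^sup>2) \<in> borel_measurable (?R \<Otimes>\<^sub>M M)"
    by (simp cong: measurable_cong)
qed

end

section \<open>The cell identity integrated in time, and its transfer to every version of the
  bracket\<close>

lemma LINT_LINT_square_DG:
  assumes v: "continuous_DG_path T N k v" and j: "j < N" and t: "t \<in> {0..T}"
  shows "set_integrable lborel {a..b} (\<lambda>x. LINT s:{0..t}|lborel. (poly (v s j) x)\<^sup>2)"
    and "(LINT x:{a..b}|lborel. LINT s:{0..t}|lborel. (poly (v s j) x)\<^sup>2)
      = (LINT s:{0..t}|lborel. LINT x:{a..b}|lborel. (poly (v s j) x)\<^sup>2)"
proof -
  let ?c = "\<lambda>l l' s. coeff (v s j) l * coeff (v s j) l'"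
  let ?J = "\<lambda>l l'. LINT s:{0..t}|lborel. ?c l l' s"
  let ?P = "\<lambda>n. LINT x:{a..b}|lborel. x ^ n"
  have deg: "degree (v s j) \<le> k" if "s \<in> {0..t}" for s
    by (rule continuous_DG_path_degree[OF v _ j]) (use that t in auto)
  have ci: "set_integrable lborel {0..t} (?c l l')" if "l \<le> k" "l' \<le> k" for l l'
    using v j t that by (intro borel_integrable_atLeastAtMost' continuous_intros)
      (auto simp: continuous_DG_path_def intro: continuous_on_subset[of "{0..T}"])
  have xi: "set_integrable lborel {a..b} (\<lambda>x::real. x ^ n)" for n
    by (intro borel_integrable_atLeastAtMost' continuous_intros)
  have sum2: "(LINT y:S|lborel. \<Sum>l\<le>k. \<Sum>l'\<le>k. f l l' y) = (\<Sum>l\<le>k. \<Sum>l'\<le>k. LINT y:S|lborel. f l l' y)"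
    if "\<And>l l'. l \<le> k \<Longrightarrow> l' \<le> k \<Longrightarrow> set_integrable lborel S (f l l')" for S and f :: "nat \<Rightarrow> nat \<Rightarrow> real \<Rightarrow> real"
    unfolding set_lebesgue_integral_def scaleR_sum_right
    using that[unfolded set_integrable_def]
    by (subst Bochner_Integration.integral_sum; (intro Bochner_Integration.integrable_sum sum.cong refl)?;
        (subst Bochner_Integration.integral_sum)?) auto
  have Q: "(LINT s:{0..t}|lborel. (poly (v s j) x)\<^sup>2) = (\<Sum>l\<le>k. \<Sum>l'\<le>k. x ^ (l + l') * ?J l l')" for x
  proof -
    have "(LINT s:{0..t}|lborel. (poly (v s j) x)\<^sup>2) = (LINT s:{0..t}|lborel. \<Sum>l\<le>k. \<Sum>l'\<le>k. x ^ (l + l') * ?c l l' s)"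
      by (intro set_lebesgue_integral_cong ballI allI impI poly_square_eq_sum deg) auto
    also have "\<dots> = (\<Sum>l\<le>k. \<Sum>l'\<le>k. x ^ (l + l') * ?J l l')"
      using ci by (subst sum2) (auto simp: set_integral_mult_right)
    finally show ?thesis .
  qed
  show "set_integrable lborel {a..b} (\<lambda>x. LINT s:{0..t}|lborel. (poly (v s j) x)\<^sup>2)"
    unfolding Q by (intro borel_integrable_atLeastAtMost' continuous_intros)
  \<comment> \<open>Expansion in coefficients separates \<open>x\<close> from \<open>s\<close>: both
    iterated integrals reduce to the same finite double sum of moments times time integrals.\<close>
  have "(LINT x:{a..b}|lborel. LINT s:{0..t}|lborel. (poly (v s j) x)\<^sup>2) = (\<Sum>l\<le>k. \<Sum>l'\<le>k. ?P (l + l') * ?J l l')"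
    unfolding Q using xi by (subst sum2) (auto simp: set_integral_mult_left)
  also have "\<dots> = (LINT s:{0..t}|lborel. \<Sum>l\<le>k. \<Sum>l'\<le>k. ?P (l + l') * ?c l l' s)"
    using ci by (subst sum2) (auto simp: set_integral_mult_right)
  also have "\<dots> = (LINT s:{0..t}|lborel. LINT x:{a..b}|lborel. (poly (v s j) x)\<^sup>2)"
  proof (intro set_lebesgue_integral_cong allI impI)
    fix s assume "s \<in> {0..t}"
    then have "(LINT x:{a..b}|lborel. (poly (v s j) x)\<^sup>2) = (LINT x:{a..b}|lborel. \<Sum>l\<le>k. \<Sum>l'\<le>k. x ^ (l + l') * ?c l l' s)"
      by (simp only: poly_square_eq_sum[OF deg])
    also have "\<dots> = (\<Sum>l\<le>k. \<Sum>l'\<le>k. ?P (l + l') * ?c l l' s)"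
      using xi by (subst sum2) (auto simp: set_integral_mult_left)
    finally show "(\<Sum>l\<le>k. \<Sum>l'\<le>k. ?P (l + l') * ?c l l' s) = (LINT x:{a..b}|lborel. (poly (v s j) x)\<^sup>2)" ..
  qed simp
  finally show "(LINT x:{a..b}|lborel. LINT s:{0..t}|lborel. (poly (v s j) x)\<^sup>2)
      = (LINT s:{0..t}|lborel. LINT x:{a..b}|lborel. (poly (v s j) x)\<^sup>2)" .
qed

text \<open>A version of the bracket is known to be measurable only on the cell. The comparison
  therefore takes place in the restricted space and is translated back to set integrals.\<close>

lemma set_integral_cong_restrict_AE:
  fixes f g :: "real \<Rightarrow> real"
  assumes S: "S \<in> sets lborel" and f: "f \<in> borel_measurable (restrict_space lborel S)"
    and g: "set_integrable lborel S g" and eq: "AE x in restrict_space lborel S. f x = g x"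
  shows "set_integrable lborel S f" "(LINT x:S|lborel. f x) = (LINT x:S|lborel. g x)"
proof -
  have S': "S \<inter> space lborel \<in> sets lborel" using S by simp
  have gi: "integrable (restrict_space lborel S) g"
    using g unfolding integrable_restrict_space[OF S'] set_integrable_def .
  have "integrable (restrict_space lborel S) f"
    using gi integrable_cong_AE[OF f _ eq] by auto
  then show "set_integrable lborel S f"
    unfolding integrable_restrict_space[OF S'] set_integrable_def .
  have "integral\<^sup>L (restrict_space lborel S) f = integral\<^sup>L (restrict_space lborel S) g"
    using gi by (intro integral_cong_AE f eq) auto
  then show "(LINT x:S|lborel. f x) = (LINT x:S|lborel. g x)"
    unfolding integral_restrict_space[OF S'] set_lebesgue_integral_def .
qed

text \<open>In \<open>ldg_b\<close> the test function \<open>u\<close> moves with time. Solving the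
  cell identity for \<open>2 * ldg_b\<close> leaves a difference of two functions continuous in
  time, and the integral can be split there.\<close>

lemma ldg_integrated_identity:
  assumes \<sigma>: "C2 \<sigma>" and mesh: "is_mesh N xs" and j: "j < N"
    and f: "is_numerical_flux N Ftu" "is_numerical_flux N Ftq"
    and u: "continuous_DG_path T N k u" and q: "continuous_DG_path T N k q"
    and eq: "\<And>s. s \<in> {0..T} \<Longrightarrow> ldg_q_equation N xs \<sigma> Ftu j (u s) (q s) (q s)" and t: "t \<in> {0..T}"
  shows "2 * (LINT s:{0..t}|lborel. ldg_b N xs \<sigma> Ftq j (u s) (q s) (u s))
      + (LINT x:cell xs j|lborel. LINT s:{0..t}|lborel. (poly (q s j) x)\<^sup>2)
    = (LINT s:{0..t}|lborel.
         ldg_Lambda N xs \<sigma> Ftu Ftq (u s) (q s) (Suc j)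
       - ldg_Lambda N xs \<sigma> Ftu Ftq (u s) (q s) j
       + ldg_Theta N xs \<sigma> Ftu Ftq (u s) (q s) j)"
proof -
  let ?b = "\<lambda>s. ldg_b N xs \<sigma> Ftq j (u s) (q s) (u s)"
  let ?g = "\<lambda>s. LINT x:cell xs j|lborel. (poly (q s j) x)\<^sup>2"
  let ?e = "\<lambda>s. ldg_Lambda N xs \<sigma> Ftu Ftq (u s) (q s) (Suc j) - ldg_Lambda N xs \<sigma> Ftu Ftq (u s) (q s) j
       + ldg_Theta N xs \<sigma> Ftu Ftq (u s) (q s) j"
  have sub: "{0..t} \<subseteq> {0..T}" using t by auto
  have i: "j \<le> N" "Suc j \<le> N" "1 \<le> N" using j by auto
  have "continuous_on {0..T} ?e"
    by (intro continuous_intros continuous_on_ldg_flux_terms[OF u q f] i)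
  then have e: "set_integrable lborel {0..t} ?e"
    by (rule borel_integrable_atLeastAtMost'[OF continuous_on_subset[OF _ sub]])
  have g: "set_integrable lborel {0..t} ?g"
    by (rule borel_integrable_atLeastAtMost'[OF continuous_on_subset[OF continuous_on_LINT_square_DG[OF q j] sub]])
  have "2 * (LINT s:{0..t}|lborel. ?b s) = (LINT s:{0..t}|lborel. 2 * ?b s)"
    by (simp add: set_integral_mult_right)
  also have "\<dots> = (LINT s:{0..t}|lborel. ?e s - ?g s)"
  proof (intro set_lebesgue_integral_cong allI impI)
    fix s assume "s \<in> {0..t}"
    then have "ldg_q_equation N xs \<sigma> Ftu j (u s) (q s) (q s)" using sub by (intro eq) auto
    from ldg_cell_identity[OF \<sigma> mesh j this, of Ftq] show "2 * ?b s = ?e s - ?g s" by simp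
  qed simp
  also have "\<dots> = (LINT s:{0..t}|lborel. ?e s) - (LINT s:{0..t}|lborel. ?g s)"
    by (rule set_integral_diff(2)[OF e g])
  finally show ?thesis unfolding LINT_LINT_square_DG(2)[OF q j t] by simp
qed

text \<open>The bracket is determined only up to versions, so the identity is asserted for every
  jointly measurable one, including integrability over the cell. The existence clause excludes a
  vacuous reading.\<close>

theorem lemma3p8:
  fixes M :: "'w measure" and F :: "real \<Rightarrow> 'w measure" and W :: "real \<Rightarrow> 'w \<Rightarrow> real"
    and T :: real and \<sigma> ubar :: "real \<Rightarrow> real"
    and N k :: nat and xs :: "nat \<Rightarrow> real"
    and Fu Ftu Ftq :: flux
    and u q :: "real \<Rightarrow> 'w \<Rightarrow> dg" and j :: nat
  assumes "T > 0"
    and "brownian_motion M F W"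
    and "C2 \<sigma>"
    and "in_Linf (deriv \<sigma>)"
    and "in_Linf (deriv (deriv \<sigma>))"
    and "in_Linf (deriv (deriv (\<lambda>x. (\<sigma> x)\<^sup>2)))"
    and "in_L2 ubar"
    and "is_mesh N xs"
    and "is_numerical_flux N Fu"
    and "is_numerical_flux N Ftu"
    and "is_numerical_flux N Ftq"
    and "is_ldg_solution M F W T \<sigma> ubar N xs k Fu Ftu Ftq u q"
    and "j < N"
  shows "(\<exists>A. is_pointwise_bracket M F T xs j u A) \<and>
    (\<forall>A. is_pointwise_bracket M F T xs j u A \<longrightarrow>
      (AE \<omega> in M. \<forall>t\<in>{0..T}.
        set_integrable lborel (cell xs j) (\<lambda>x. A x t \<omega>) \<and>
        2 * (LINT s:{0..t}|lborel. ldg_b N xs \<sigma> Ftq j (u s \<omega>) (q s \<omega>) (u s \<omega>))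
          + (LINT x:cell xs j|lborel. A x t \<omega>)
        = (LINT s:{0..t}|lborel.
             ldg_Lambda N xs \<sigma> Ftu Ftq (u s \<omega>) (q s \<omega>) (Suc j)
           - ldg_Lambda N xs \<sigma> Ftu Ftq (u s \<omega>) (q s \<omega>) j
           + ldg_Theta N xs \<sigma> Ftu Ftq (u s \<omega>) (q s \<omega>) j)))"
proof -
  interpret brownian_motion M F W by fact
  note \<sigma> = \<open>C2 \<sigma>\<close> and mesh = \<open>is_mesh N xs\<close> and j = \<open>j < N\<close>
    and sol = \<open>is_ldg_solution M F W T \<sigma> ubar N xs k Fu Ftu Ftq u q\<close>
  have u: "continuous_adapted_DG M F T N k u" and q: "continuous_adapted_DG M F T N k q"
    and qeq: "AE \<omega> in M. \<forall>t\<in>{0..T}. \<forall>j<N. \<forall>\<psi>\<in>DG N k. ldg_q_equation N xs \<sigma> Ftu j (u t \<omega>) (q t \<omega>) \<psi>"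
    using sol unfolding is_ldg_solution_def by blast+
  let ?Q = "\<lambda>x t \<omega>. LINT s:{0..t}|lborel. (poly (q s \<omega> j) x)\<^sup>2"
  have Q: "is_pointwise_bracket M F T xs j u ?Q"
    by (rule ldg_pointwise_bracket[OF \<sigma> mesh assms(9,11) sol j])
  show ?thesis
  proof (intro conjI allI impI)
    show "\<exists>A. is_pointwise_bracket M F T xs j u A" using Q by blast
    fix A assume A: "is_pointwise_bracket M F T xs j u A"
    let ?R = "restrict_space lborel (cell xs j)"
    from pointwise_bracket_unique[OF A Q \<open>T > 0\<close>] qeq AE_space
    show "AE \<omega> in M. \<forall>t\<in>{0..T}.
        set_integrable lborel (cell xs j) (\<lambda>x. A x t \<omega>) \<and>
        2 * (LINT s:{0..t}|lborel. ldg_b N xs \<sigma> Ftq j (u s \<omega>) (q s \<omega>) (u s \<omega>))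
          + (LINT x:cell xs j|lborel. A x t \<omega>)
        = (LINT s:{0..t}|lborel.
             ldg_Lambda N xs \<sigma> Ftu Ftq (u s \<omega>) (q s \<omega>) (Suc j)
           - ldg_Lambda N xs \<sigma> Ftu Ftq (u s \<omega>) (q s \<omega>) j
           + ldg_Theta N xs \<sigma> Ftu Ftq (u s \<omega>) (q s \<omega>) j)"
    proof eventually_elim
      fix \<omega>
      assume AQ: "AE x in ?R. \<forall>t\<in>{0..T}. A x t \<omega> = ?Q x t \<omega>" and \<omega>: "\<omega> \<in> space M"
        and qe: "\<forall>t\<in>{0..T}. \<forall>j<N. \<forall>\<psi>\<in>DG N k. ldg_q_equation N xs \<sigma> Ftu j (u t \<omega>) (q t \<omega>) \<psi>"
      note pu = continuous_adapted_DG_path[OF u \<omega>] and pq = continuous_adapted_DG_path[OF q \<omega>]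
      \<comment> \<open>The test function is \<open>q\<close> itself and thus depends on \<omega>.
        This is legitimate because the equation for \<open>q\<close> holds for all test functions
        and times outside one null set.\<close>
      have qe': "ldg_q_equation N xs \<sigma> Ftu j (u s \<omega>) (q s \<omega>) (q s \<omega>)" if "s \<in> {0..T}" for s
        using qe that j pq unfolding continuous_DG_path_def by blast
      show "\<forall>t\<in>{0..T}.
        set_integrable lborel (cell xs j) (\<lambda>x. A x t \<omega>) \<and>
        2 * (LINT s:{0..t}|lborel. ldg_b N xs \<sigma> Ftq j (u s \<omega>) (q s \<omega>) (u s \<omega>))
          + (LINT x:cell xs j|lborel. A x t \<omega>)
        = (LINT s:{0..t}|lborel.
             ldg_Lambda N xs \<sigma> Ftu Ftq (u s \<omega>) (q s \<omega>) (Suc j)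
           - ldg_Lambda N xs \<sigma> Ftu Ftq (u s \<omega>) (q s \<omega>) j
           + ldg_Theta N xs \<sigma> Ftu Ftq (u s \<omega>) (q s \<omega>) j)"
      proof
        fix t assume t: "t \<in> {0..T}"
        have "(\<lambda>(x, \<omega>). A x t \<omega>) \<in> borel_measurable (?R \<Otimes>\<^sub>M M)"
          using A t by (simp add: is_pointwise_bracket_def)
        \<comment> \<open>The section at this \<omega> of the jointly measurable version.\<close>
        from measurable_compose[OF measurable_Pair[OF measurable_ident measurable_const[OF \<omega>]] this]
        have m: "(\<lambda>x. A x t \<omega>) \<in> borel_measurable ?R" by (simp add: id_def)
        have ae: "AE x in ?R. A x t \<omega> = ?Q x t \<omega>" using AQ by eventually_elim (use t in blast)
        note AI = set_integral_cong_restrict_AE[OF _ m LINT_LINT_square_DG(1)[OF pq j t] ae]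
        show "set_integrable lborel (cell xs j) (\<lambda>x. A x t \<omega>) \<and>
          2 * (LINT s:{0..t}|lborel. ldg_b N xs \<sigma> Ftq j (u s \<omega>) (q s \<omega>) (u s \<omega>))
            + (LINT x:cell xs j|lborel. A x t \<omega>)
          = (LINT s:{0..t}|lborel.
               ldg_Lambda N xs \<sigma> Ftu Ftq (u s \<omega>) (q s \<omega>) (Suc j)
             - ldg_Lambda N xs \<sigma> Ftu Ftq (u s \<omega>) (q s \<omega>) j
             + ldg_Theta N xs \<sigma> Ftu Ftq (u s \<omega>) (q s \<omega>) j)"
          using AI(1) ldg_integrated_identity[OF \<sigma> mesh j assms(10,11) pu pq qe' t] AI(2) by simp
      qed
    qed
  qed
qed

end
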